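(* Let $\mathfrak g$ be a simple Lie algebra over $\mathbb C$ and let $\mathcal T_\lambda$ be the phase space of the periodic Full Kostant-Toda lattice on $\mathfrak g$, equipped with the Poisson bracket $\{\cdot,\cdot\}_{\tilde R}$. Let $H(L(\lambda)):=\frac12\langle L(\lambda)\,|\,L(\lambda)\rangle_\lambda$. Then the Hamiltonian vector field on $\mathcal T_\lambda$ of the function $H$ coincides with the equation of motion of the periodic Full Kostant-Toda lattice $$\dot L(\lambda)=[L(\lambda),L(\lambda)_-],\qquad L(\lambda)\in\mathcal T_\lambda .$$
   Context: **Lie algebra.** $\mathfrak g$ is a simple Lie algebra over $\mathbb C$ of rank $\ell$ with Killing form $\langle\cdot\,|\,\cdot\rangle$, $\mathfrak h$ is a Cartan subalgebra with root system $\Phi$, simple roots $\alpha_1,\dots,\alpha_\ell$, simple coroots $h_1,\dots,h_\ell$ and positive roots $\Phi_+$. For $\alpha\in\Phi$, $e_\alpha$ is a chosen non-zero root vector, and $e_i:=e_{\alpha_i}$. The length of $\alpha=\sum_i a_i\alpha_i$ is $|\alpha|:=\sum_i a_i$; $\beta$ is the longest (highest) root. Put $\mathfrak g_0:=\mathfrak h$ and, for $k\neq0$, $\mathfrak g_k:=\mathrm{span}\{e_\alpha : |\alpha|=k\}$; $\mathfrak g_{>0}:=\bigoplus_{k>0}\mathfrak g_k$, $\mathfrak g_{\le0}:=\bigoplus_{k\le0}\mathfrak g_k$. **Loop algebra.** $\tilde{\mathfrak g}:=\mathfrak g\otimes\mathbb C[\lambda,\lambda^{-1}]$ with the $\mathbb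 C[\lambda,\lambda^{-1}]$-bilinear extension of the bracket. It is graded by $\tilde{\mathfrak g}_i:=\bigoplus_{m+(|\beta|+1)k=i}\lambda^k\mathfrak g_m$. Set $\tilde{\mathfrak g}_+:=\bigoplus_{i\ge0}\tilde{\mathfrak g}_i$, $\tilde{\mathfrak g}_-:=\bigoplus_{i<0}\tilde{\mathfrak g}_i$, with projections $x\mapsto x_\pm$ along $\tilde{\mathfrak g}=\tilde{\mathfrak g}_+\oplus\tilde{\mathfrak g}_-$; $\tilde R(x):=x_+-x_-$ and $[x,y]_{\tilde R}:=\frac12([\tilde R x,y]+[x,\tilde R y])=[x_+,y_+]-[x_-,y_-]$. The form $\langle\sum_k X_k\lambda^k\,|\,\sum_k Y_k\lambda^k\rangle_\lambda:=\sum_k\langle X_k|Y_{-k}\rangle$ is non-degenerate, symmetric and ad-invariant. $\mathcal F(\tilde{\mathfrak g})$ is the algebra of polynomial functions on $\tilde{\mathfrak g}$ generated by the linear forms vanishing on all but finitely many $\tilde{\mathfrak g}_i$; gradients $\nabla_x F\in\tilde{\mathfrak g}$ are taken with respect to $\langle\cdot|\cdot\rangle_\lambda$. The Poisson bracket on $\mathcal F(\tilde{\mathfrak g})$ is $\{F,G\}_{\tilde R}(x):=\langle x\,|\,[\nabla_xF,\nabla_xG]_{\tilde R}\rangle_\lambda$. **Phase space.** $\mathcal T_\lambda:=\lambda^{-1}\mathfrak g_{>0}+\big(\mathfrak g_{\le0}+\sum_{i=1}^\ell e_i\big)+\lambda e_{-\beta}$, a finite-dimensional affine subspace of $\tilde{\mathfrak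 g}$. Its algebra of polynomial functions $\mathcal F(\mathcal T_\lambda)$ carries the unique Poisson bracket, also denoted $\{\cdot,\cdot\}_{\tilde R}$, for which the (surjective) restriction map $\mathcal F(\tilde{\mathfrak g})\to\mathcal F(\mathcal T_\lambda)$ is a Poisson morphism. For $L(\lambda)=\lambda e_{-\beta}+\sum_{i=1}^\ell(a_ih_i+e_i)+\sum_{\alpha\in\Phi_+}(a_{-\alpha}e_{-\alpha}+\lambda^{-1}b_\alpha e_\alpha)\in\mathcal T_\lambda$ one has $L(\lambda)_-=\sum_{\alpha\in\Phi_+}(a_{-\alpha}e_{-\alpha}+\lambda^{-1}b_\alpha e_\alpha)$. **Hamiltonian vector field of $H$.** The function $H$ is not in $\mathcal F(\tilde{\mathfrak g})$, but there are elements $F^H\in\mathcal F(\tilde{\mathfrak g})$ with the same restriction to $\mathcal T_\lambda$, for instance $F^H(\sum_k x_k\lambda^k)=\frac12(\langle x_{-1}|x_1\rangle+\langle x_0|x_0\rangle+\langle x_1|x_{-1}\rangle)$. The Hamiltonian vector field of $H$ on $\mathcal T_\lambda$ is by definition the Hamiltonian vector field on $\mathcal T_\lambda$ of the restriction of any such $F^H$ (it does not depend on the choice). Convention: the Hamiltonian vector field of $G$ is $\mathcal X_G:=\{\cdot\,,G\}_{\tilde R}$. *)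

theory Defs
  imports "HOL-Analysis.Analysis" "HOL-Library.Poly_Mapping"
begin

section \<open>Complex Lie algebras\<close>

locale lie_algebra = finite_dimensional_vector_space scale Basis
  for scale :: "complex \<Rightarrow> 'g::ab_group_add \<Rightarrow> 'g" (infixr \<open>*s\<close> 75)
    and Basis :: "'g set" +
  fixes bracket :: "'g \<Rightarrow> 'g \<Rightarrow> 'g"
  assumes bracket_linear_left: "Vector_Spaces.linear scale scale (\<lambda>x. bracket x y)"
    and bracket_linear_right: "Vector_Spaces.linear scale scale (bracket x)"
    and bracket_self: "bracket x x = 0"
    and jacobi: "bracket x (bracket y z) + bracket y (bracket z x) + bracket z (bracket x y) = 0"
begin

definition lie_subalgebra :: "'g set \<Rightarrow> bool" where
  "lie_subalgebra S \<longleftrightarrow> subspace S \<and> (\<forall>x\<in>S. \<forall>y\<in>S. bracket x y \<in> S)"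

definition lie_ideal :: "'g set \<Rightarrow> bool" where
  "lie_ideal I \<longleftrightarrow> subspace I \<and> (\<forall>x. \<forall>y\<in>I. bracket x y \<in> I)"

primrec lower_central :: "'g set \<Rightarrow> nat \<Rightarrow> 'g set" where
  "lower_central S 0 = S"
| "lower_central S (Suc n) = span {bracket x y | x y. x \<in> S \<and> y \<in> lower_central S n}"

definition nilpotent_subalgebra :: "'g set \<Rightarrow> bool" where
  "nilpotent_subalgebra S \<longleftrightarrow> lie_subalgebra S \<and> (\<exists>n. lower_central S n = {0})"

definition normalizer :: "'g set \<Rightarrow> 'g set" where
  "normalizer S = {x. \<forall>y\<in>S. bracket x y \<in> S}"

definition cartan_subalgebra :: "'g set \<Rightarrow> bool" where
  "cartan_subalgebra S \<longleftrightarrow> nilpotent_subalgebra S \<and> normalizer S = S"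

text \<open>The trace of an endomorphism does not depend on the basis in which it is computed.\<close>

definition endo_trace :: "('g \<Rightarrow> 'g) \<Rightarrow> complex" where
  "endo_trace f = (\<Sum>b\<in>Basis. representation Basis (f b) b)"

definition killing :: "'g \<Rightarrow> 'g \<Rightarrow> complex" where
  "killing x y = endo_trace (\<lambda>z. bracket x (bracket y z))"

text \<open>
  Linear forms on a subspace \<open>\<hh>\<close> are represented by functions on the whole type that vanish
  outside \<open>\<hh>\<close>, so that equality of forms is equality of functions.
\<close>

definition dual_space :: "'g set \<Rightarrow> ('g \<Rightarrow> complex) set" where
  "dual_space \<hh> = {\<phi>. (\<forall>x\<in>\<hh>. \<forall>y\<in>\<hh>. \<phi> (x + y) = \<phi> x + \<phi> y) \<and>
     (\<forall>c. \<forall>x\<in>\<hh>. \<phi> (c *s x) = c * \<phi> x) \<and> (\<forall>x. x \<notin> \<hh> \<longrightarrow> \<phi> x = 0)}"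

definition root_space :: "'g set \<Rightarrow> ('g \<Rightarrow> complex) \<Rightarrow> 'g set" where
  "root_space \<hh> \<alpha> = {x. \<forall>h\<in>\<hh>. bracket h x = \<alpha> h *s x}"

definition roots :: "'g set \<Rightarrow> ('g \<Rightarrow> complex) set" where
  "roots \<hh> = {\<alpha> \<in> dual_space \<hh>. \<alpha> \<noteq> (\<lambda>_. 0) \<and> root_space \<hh> \<alpha> \<noteq> {0}}"

definition root_base :: "'g set \<Rightarrow> ('g \<Rightarrow> complex) set \<Rightarrow> bool" where
  "root_base \<hh> \<Delta> \<longleftrightarrow> \<Delta> \<subseteq> roots \<hh> \<and> finite \<Delta> \<and>
     (\<forall>c :: ('g \<Rightarrow> complex) \<Rightarrow> complex.
        (\<forall>x. (\<Sum>\<delta>\<in>\<Delta>. c \<delta> * \<delta> x) = 0) \<longrightarrow> (\<forall>\<delta>\<in>\<Delta>. c \<delta> = 0)) \<and>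
     (\<forall>\<alpha>\<in>roots \<hh>. \<exists>n :: ('g \<Rightarrow> complex) \<Rightarrow> nat.
        \<alpha> = (\<lambda>x. \<Sum>\<delta>\<in>\<Delta>. of_nat (n \<delta>) * \<delta> x) \<or>
        \<alpha> = (\<lambda>x. - (\<Sum>\<delta>\<in>\<Delta>. of_nat (n \<delta>) * \<delta> x)))"

definition root_length :: "('g \<Rightarrow> complex) set \<Rightarrow> ('g \<Rightarrow> complex) \<Rightarrow> int" where
  "root_length \<Delta> \<alpha> = (THE n. \<exists>a :: ('g \<Rightarrow> complex) \<Rightarrow> int.
     \<alpha> = (\<lambda>x. \<Sum>\<delta>\<in>\<Delta>. of_int (a \<delta>) * \<delta> x) \<and> n = (\<Sum>\<delta>\<in>\<Delta>. a \<delta>))"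

end

locale simple_lie_algebra = lie_algebra +
  assumes non_abelian: "\<exists>x y. bracket x y \<noteq> 0"
    and no_proper_ideal: "lie_ideal I \<Longrightarrow> I = {0} \<or> I = UNIV"


section \<open>The loop algebra\<close>

text \<open>
  The Laurent polynomial \<open>\<Sum>k. x\<^sub>k \<lambda>\<^sup>k\<close> with coefficients in \<open>\<gg>\<close> is the finitely supported map
  \<open>k \<mapsto> x\<^sub>k\<close>; in particular \<open>Poly_Mapping.single k x\<close> stands for \<open>\<lambda>\<^sup>k x\<close>.
\<close>

type_synonym 'g loop = "int \<Rightarrow>\<^sub>0 'g"

context lie_algebra
begin

definition loop_scale :: "complex \<Rightarrow> 'g loop \<Rightarrow> 'g loop" where
  "loop_scale c x = Poly_Mapping.map (scale c) x"

lemma lookup_loop_scale [simp]: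
  "Poly_Mapping.lookup (loop_scale c x) k = c *s Poly_Mapping.lookup x k"
  by (simp add: loop_scale_def Poly_Mapping.map.rep_eq when_def)

sublocale loop: vector_space loop_scale
  by unfold_locales
    (auto intro!: poly_mapping_eqI simp: lookup_add scale_right_distrib scale_left_distrib)

definition loop_bracket :: "'g loop \<Rightarrow> 'g loop \<Rightarrow> 'g loop" where
  "loop_bracket x y = (\<Sum>i\<in>Poly_Mapping.keys x. \<Sum>j\<in>Poly_Mapping.keys y.
     Poly_Mapping.single (i + j) (bracket (Poly_Mapping.lookup x i) (Poly_Mapping.lookup y j)))"

definition loop_form :: "'g loop \<Rightarrow> 'g loop \<Rightarrow> complex" where
  "loop_form x y = (\<Sum>k\<in>Poly_Mapping.keys x.
     killing (Poly_Mapping.lookup x k) (Poly_Mapping.lookup y (- k)))"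

definition gradient :: "('g loop \<Rightarrow> complex) \<Rightarrow> 'g loop \<Rightarrow> 'g loop" where
  "gradient F x = (THE g. \<forall>y.
     ((\<lambda>t. F (x + loop_scale t y)) has_field_derivative loop_form g y) (at 0))"

end


section \<open>Algebras of functions and Poisson brackets\<close>

inductive_set generated_algebra :: "('a \<Rightarrow> complex) set \<Rightarrow> ('a \<Rightarrow> complex) set"
  for S :: "('a \<Rightarrow> complex) set" where
  const: "(\<lambda>_. c) \<in> generated_algebra S"
| gen: "\<phi> \<in> S \<Longrightarrow> \<phi> \<in> generated_algebra S"
| add: "F \<in> generated_algebra S \<Longrightarrow> G \<in> generated_algebra S \<Longrightarrow>
    (\<lambda>x. F x + G x) \<in> generated_algebra S"
| mult: "F \<in> generated_algebra S \<Longrightarrow> G \<in> generated_algebra S \<Longrightarrow>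
    (\<lambda>x. F x * G x) \<in> generated_algebra S"

text \<open>
  Here \<open>A\<close> is an algebra of functions on \<open>X\<close>; such functions are taken to be extensional, that is,
  equal to \<open>undefined\<close> outside \<open>X\<close>.
\<close>

definition poisson_bracket_on ::
  "'a set \<Rightarrow> ('a \<Rightarrow> complex) set \<Rightarrow> (('a \<Rightarrow> complex) \<Rightarrow> ('a \<Rightarrow> complex) \<Rightarrow> 'a \<Rightarrow> complex) \<Rightarrow> bool" where
  "poisson_bracket_on X A P \<longleftrightarrow>
     (\<forall>F\<in>A. \<forall>G\<in>A. P F G \<in> A) \<and>
     (\<forall>F\<in>A. \<forall>G\<in>A. \<forall>K\<in>A. \<forall>a b. P (\<lambda>x\<in>X. a * F x + b * G x) K = (\<lambda>x\<in>X. a * P F K x + b * P G K x)) \<and>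
     (\<forall>F\<in>A. \<forall>G\<in>A. P F G = (\<lambda>x\<in>X. - P G F x)) \<and>
     (\<forall>F\<in>A. \<forall>G\<in>A. \<forall>K\<in>A. P (\<lambda>x\<in>X. F x * G x) K = (\<lambda>x\<in>X. F x * P G K x + G x * P F K x)) \<and>
     (\<forall>F\<in>A. \<forall>G\<in>A. \<forall>K\<in>A. \<forall>x\<in>X. P F (P G K) x + P G (P K F) x + P K (P F G) x = 0)"


section \<open>The periodic Full Kostant-Toda lattice\<close>

text \<open>\<open>\<Delta>\<close> is the set of simple roots, so the rank of the Lie algebra is \<open>card \<Delta>\<close>.\<close>

locale kostant_toda = simple_lie_algebra scale Basis bracket
  for scale :: "complex \<Rightarrow> 'g::ab_group_add \<Rightarrow> 'g" (infixr \<open>*s\<close> 75)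
    and Basis :: "'g set" and bracket :: "'g \<Rightarrow> 'g \<Rightarrow> 'g" +
  fixes \<hh> :: "'g set"
    and \<Delta> :: "('g \<Rightarrow> complex) set"
    and \<beta> :: "'g \<Rightarrow> complex"
    and e :: "('g \<Rightarrow> complex) \<Rightarrow> 'g"
  assumes cartan: "cartan_subalgebra \<hh>"
    and base: "root_base \<hh> \<Delta>"
    and longest_root: "\<beta> \<in> roots \<hh>"
      "\<And>\<alpha>. \<alpha> \<in> roots \<hh> \<Longrightarrow> root_length \<Delta> \<alpha> \<le> root_length \<Delta> \<beta>"
    and root_vector: "\<And>\<alpha>. \<alpha> \<in> roots \<hh> \<Longrightarrow> e \<alpha> \<in> root_space \<hh> \<alpha> \<and> e \<alpha> \<noteq> 0"
begin

definition graded :: "int \<Rightarrow> 'g set" where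
  "graded k = (if k = 0 then \<hh> else span {e \<alpha> | \<alpha>. \<alpha> \<in> roots \<hh> \<and> root_length \<Delta> \<alpha> = k})"

definition graded_pos :: "'g set" where
  "graded_pos = span (\<Union>k\<in>{0<..}. graded k)"

definition graded_nonpos :: "'g set" where
  "graded_nonpos = span (\<Union>k\<in>{..0}. graded k)"

definition loop_graded :: "int \<Rightarrow> 'g loop set" where
  "loop_graded i = loop.span {Poly_Mapping.single k x | k m x.
     m + (root_length \<Delta> \<beta> + 1) * k = i \<and> x \<in> graded m}"

definition loop_plus :: "'g loop set" where
  "loop_plus = loop.span (\<Union>i\<in>{0..}. loop_graded i)"

definition loop_minus :: "'g loop set" where
  "loop_minus = loop.span (\<Union>i\<in>{..<0}. loop_graded i)"

definition proj_plus :: "'g loop \<Rightarrow> 'g loop" where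
  "proj_plus x = (THE y. y \<in> loop_plus \<and> x - y \<in> loop_minus)"

definition proj_minus :: "'g loop \<Rightarrow> 'g loop" where
  "proj_minus x = (THE y. y \<in> loop_minus \<and> x - y \<in> loop_plus)"

definition R_operator :: "'g loop \<Rightarrow> 'g loop" where
  "R_operator x = proj_plus x - proj_minus x"

definition R_bracket :: "'g loop \<Rightarrow> 'g loop \<Rightarrow> 'g loop" where
  "R_bracket x y = loop_scale (1/2) (loop_bracket (R_operator x) y + loop_bracket x (R_operator y))"

definition loop_functions :: "('g loop \<Rightarrow> complex) set" where
  "loop_functions = generated_algebra
     {\<phi>. Vector_Spaces.linear loop_scale (*) \<phi> \<and> finite {i. \<exists>x\<in>loop_graded i. \<phi> x \<noteq> 0}}"

definition R_poisson ::
  "('g loop \<Rightarrow> complex) \<Rightarrow> ('g loop \<Rightarrow> complex) \<Rightarrow> 'g loop \<Rightarrow> complex" where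
  "R_poisson F G x = loop_form x (R_bracket (gradient F x) (gradient G x))"

definition phase_space :: "'g loop set" where
  "phase_space = {Poly_Mapping.single (-1) y + Poly_Mapping.single 0 (z + (\<Sum>\<delta>\<in>\<Delta>. e \<delta>)) +
     Poly_Mapping.single 1 (e (\<lambda>x. - \<beta> x)) | y z. y \<in> graded_pos \<and> z \<in> graded_nonpos}"

definition phase_direction :: "'g loop set" where
  "phase_direction = {Poly_Mapping.single (-1) y + Poly_Mapping.single 0 z | y z.
     y \<in> graded_pos \<and> z \<in> graded_nonpos}"

text \<open>
  Every affine function on an affine subspace is the restriction of a linear form plus a constant.
\<close>

definition phase_functions :: "('g loop \<Rightarrow> complex) set" where
  "phase_functions = (\<lambda>F. restrict F phase_space) `
     generated_algebra {\<phi>. Vector_Spaces.linear loop_scale (*) \<phi>}"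

definition reduced_poisson_bracket ::
  "(('g loop \<Rightarrow> complex) \<Rightarrow> ('g loop \<Rightarrow> complex) \<Rightarrow> 'g loop \<Rightarrow> complex) \<Rightarrow> bool" where
  "reduced_poisson_bracket P \<longleftrightarrow> poisson_bracket_on phase_space phase_functions P \<and>
     (\<forall>F\<in>loop_functions. \<forall>G\<in>loop_functions.
        P (restrict F phase_space) (restrict G phase_space) = restrict (R_poisson F G) phase_space)"

text \<open>
  A vector field on the phase space is a map into its direction; it is the Hamiltonian vector
  field of \<open>G\<close> if the derivative of every function \<open>F\<close> along it is \<open>{F, G}\<close>.
\<close>

definition hamiltonian_vector_field ::
  "(('g loop \<Rightarrow> complex) \<Rightarrow> ('g loop \<Rightarrow> complex) \<Rightarrow> 'g loop \<Rightarrow> complex) \<Rightarrow>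
   ('g loop \<Rightarrow> complex) \<Rightarrow> ('g loop \<Rightarrow> 'g loop) \<Rightarrow> bool" where
  "hamiltonian_vector_field P G V \<longleftrightarrow>
     (\<forall>L\<in>phase_space. V L \<in> phase_direction \<and>
       (\<forall>F\<in>phase_functions.
          ((\<lambda>t. F (L + loop_scale t (V L))) has_field_derivative P F G L) (at 0)))"

definition toda_hamiltonian :: "'g loop \<Rightarrow> complex" where
  "toda_hamiltonian L = 1/2 * loop_form L L"

end

end

theory Submission
  imports Defs "HOL-Computational_Algebra.Fundamental_Theorem_Algebra"
begin

text \<open>
  On the phase space the Hamiltonian agrees with a polynomial function on the loop algebra whose
  gradient at \<open>L\<close> is \<open>L\<close> itself. In \<open>{F, H}(L) = \<langle>L | [\<nabla>F, L]\<^sub>R\<rangle>\<close> the term \<open>\<langle>L | [R (\<nabla>F), L]\<rangle>\<close> vanishes by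
  invariance of the form, and the other term is \<open>1/2 \<langle>\<nabla>F | [R L, L]\<rangle> = \<langle>\<nabla>F | [L, L\<^sub>-]\<rangle>\<close>, because
  \<open>R L = L - 2 L\<^sub>-\<close>. This is the derivative of \<open>F\<close> along \<open>[L, L\<^sub>-]\<close> (\<open>R_poisson_energy\<close>). A degree count
  shows that \<open>[L, L\<^sub>-]\<close> is tangent to the phase space (\<open>phase_space_Lax\<close>), and linear forms separate
  tangent vectors, so there is no other Hamiltonian vector field.

  The computation rests on three facts about \<open>\<gg>\<close>. Gradients exist and are unique because the Killing
  form is non-degenerate. The parts \<open>L\<^sub>+\<close> and \<open>L\<^sub>-\<close> are well defined because the pieces \<open>\<gg>\<^sub>k\<close> are
  independent. The degree count needs \<open>[\<gg>\<^sub>m, \<gg>\<^sub>n] \<subseteq> \<gg>\<^sub>m\<^sub>+\<^sub>n\<close>, which holds because every root space is the line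
  spanned by its chosen root vector; moreover \<open>-\<beta>\<close> has to be a root. These facts are derived here from
  the axioms of a simple Lie algebra with a Cartan subalgebra \<open>\<hh>\<close> and a base \<open>\<Delta>\<close>.

  Generalised eigenspaces of the operators \<open>ad h\<close> decompose \<open>\<gg>\<close> into generalised weight spaces of \<open>\<hh>\<close>,
  indexed by \<open>0\<close> and the roots; each of them contains a common eigenvector
  (\<open>weight_vector_exists\<close>), and the one of weight \<open>0\<close> is \<open>\<hh>\<close> (\<open>cartan_weight_space_zero\<close>). Linear
  independence of \<open>\<Delta>\<close> yields \<open>h \<in> \<hh>\<close> on which each root takes its length as value. Hence the Killing
  square of \<open>h\<close> is a positive integer, and simplicity makes the Killing form non-degenerate. Then every
  root \<open>\<alpha>\<close> has an opposite root, and there is \<open>y\<close> of weight \<open>-\<alpha>\<close> that pairs non-trivially with \<open>e\<^sub>\<alpha>\<close>. The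
  trace of \<open>[e\<^sub>\<alpha>, y]\<close> vanishes on every subspace stable under \<open>e\<^sub>\<alpha>\<close> and \<open>y\<close>; for suitable sums of weight
  spaces this forces the weight space of \<open>-\<alpha>\<close> to be a line (\<open>dim_minus_root_space\<close>).
\<close>

(* The infix symbol is reserved for the scalar multiplication of an abstract vector space. *)
no_notation vector_scalar_mult (infixl \<open>*s\<close> 70)

section \<open>Generalised eigenspaces\<close>

locale complex_vector_space = finite_dimensional_vector_space scale Basis
  for scale :: "complex \<Rightarrow> 'v::ab_group_add \<Rightarrow> 'v" (infixr \<open>*s\<close> 75)
    and Basis :: "'v set"
begin

abbreviation endo :: "('v \<Rightarrow> 'v) \<Rightarrow> bool" where
  "endo \<equiv> Vector_Spaces.linear scale scale"

lemmas endo_0 = module_hom.zero[OF module_hom_linearI]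
  and endo_add = module_hom.add[OF module_hom_linearI]
  and endo_diff = module_hom.diff[OF module_hom_linearI]
  and endo_scale = module_hom.scale[OF module_hom_linearI]
  and endo_sum = module_hom.sum[OF module_hom_linearI]

definition gen_eigenspace :: "('v \<Rightarrow> 'v) \<Rightarrow> complex \<Rightarrow> 'v set" where
  "gen_eigenspace T \<mu> = {x. \<exists>n. ((\<lambda>y. T y - \<mu> *s y) ^^ n) x = 0}"

lemma endoI:
  assumes "\<And>x y. T (x + y) = T x + T y" "\<And>c x. T (c *s x) = c *s T x"
  shows "endo T"
  by unfold_locales (simp_all add: assms)

lemma endo_shift:
  assumes "endo T"
  shows "endo (\<lambda>y. T y - \<mu> *s y)"
  by (rule endoI) (simp_all add: endo_add[OF assms] endo_scale[OF assms] algebra_simps)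

lemma endo_funpow: "endo T \<Longrightarrow> endo (T ^^ n)"
proof (induction n)
  case 0
  show ?case by (rule endoI) simp_all
next
  case (Suc n)
  then show ?case using Vector_Spaces.linear_compose[OF Suc.IH[OF Suc.prems] Suc.prems] by (simp add: o_def)
qed

lemma subspace_gen_eigenspace:
  assumes "endo T"
  shows "subspace (gen_eigenspace T \<mu>)"
proof -
  let ?N = "\<lambda>y. T y - \<mu> *s y"
  have lin: "endo (?N ^^ n)" for n
    by (intro endo_funpow endo_shift assms)
  have mono: "(?N ^^ (m + n)) x = 0" if "(?N ^^ n) x = 0" for m n x
    using that endo_0[OF lin] by (simp add: funpow_add)
  show ?thesis
  proof (rule subspaceI)
    show "0 \<in> gen_eigenspace T \<mu>"
      by (auto simp: gen_eigenspace_def intro: exI[of _ 0])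
  next
    fix x y assume "x \<in> gen_eigenspace T \<mu>" "y \<in> gen_eigenspace T \<mu>"
    then obtain m n where "(?N ^^ m) x = 0" "(?N ^^ n) y = 0"
      by (auto simp: gen_eigenspace_def)
    then have "(?N ^^ (m + n)) (x + y) = 0"
      using mono[of m x n] mono[of n y m] by (simp add: endo_add[OF lin] add.commute)
    then show "x + y \<in> gen_eigenspace T \<mu>"
      by (auto simp: gen_eigenspace_def)
  next
    fix c x assume "x \<in> gen_eigenspace T \<mu>"
    then show "c *s x \<in> gen_eigenspace T \<mu>"
      by (auto simp: gen_eigenspace_def endo_scale[OF lin])
  qed
qed

lemma eigenvector_in_gen_eigenspace: "T x = \<mu> *s x \<Longrightarrow> x \<in> gen_eigenspace T \<mu>"
  by (auto simp: gen_eigenspace_def intro!: exI[of _ 1])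

lemma shift_gen_eigenspace:
  assumes "endo T" "x \<in> gen_eigenspace T \<mu>"
  shows "T x - a *s x \<in> gen_eigenspace T \<mu>"
proof -
  let ?N = "\<lambda>y. T y - \<mu> *s y"
  have lin: "endo (?N ^^ n)" for n
    by (intro endo_funpow endo_shift assms)
  obtain n where n: "(?N ^^ n) x = 0"
    using assms by (auto simp: gen_eigenspace_def)
  have "(?N ^^ n) (?N x) = ?N ((?N ^^ n) x)"
    by (metis funpow_swap1)
  also have "\<dots> = 0"
    using n endo_0[OF endo_shift[OF assms(1)]] by simp
  finally have "?N x \<in> gen_eigenspace T \<mu>"
    by (auto simp: gen_eigenspace_def)
  moreover have "T x - a *s x = ?N x + (\<mu> - a) *s x"
    by (simp add: scale_left_diff_distrib)
  ultimately show ?thesis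
    using subspace_gen_eigenspace[OF assms(1)] assms(2)
    by (metis subspace_add subspace_scale)
qed

lemma eigenvector_in_gen_eigenspace_eq:
  assumes "endo T" "T x = a *s x" "x \<in> gen_eigenspace T \<mu>" "x \<noteq> 0"
  shows "a = \<mu>"
proof -
  let ?N = "\<lambda>y. T y - \<mu> *s y"
  have N: "?N x = (a - \<mu>) *s x"
    using assms(2) by (simp add: scale_left_diff_distrib)
  have "(?N ^^ n) x = (a - \<mu>) ^ n *s x" for n
  proof (induction n)
    case (Suc n)
    have "(?N ^^ Suc n) x = ?N ((a - \<mu>) ^ n *s x)"
      using Suc by simp
    also have "\<dots> = (a - \<mu>) ^ n *s ?N x"
      by (rule endo_scale[OF endo_shift[OF assms(1)]])
    finally show ?case
      using N by (simp add: mult.commute)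
  qed simp
  then show ?thesis
    using assms(3,4) by (auto simp: gen_eigenspace_def)
qed

text \<open>The last non-zero iterate of \<open>T - \<mu>\<close> on a vector of the generalised eigenspace is a
  genuine eigenvector.\<close>

lemma gen_eigenspace_eigenvector:
  assumes "endo T" "x \<in> gen_eigenspace T \<mu>" "x \<noteq> 0"
  obtains n where "((\<lambda>y. T y - \<mu> *s y) ^^ n) x \<noteq> 0"
    "T (((\<lambda>y. T y - \<mu> *s y) ^^ n) x) = \<mu> *s ((\<lambda>y. T y - \<mu> *s y) ^^ n) x"
proof -
  let ?N = "\<lambda>y. T y - \<mu> *s y"
  obtain m where "(?N ^^ m) x = 0"
    using assms(2) by (auto simp: gen_eigenspace_def)
  then obtain n where "(?N ^^ n) x \<noteq> 0" "(?N ^^ (Suc n)) x = 0"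
    using ex_least_nat_less[of "\<lambda>m. (?N ^^ m) x = 0" m] assms(3) by auto
  then show thesis
    using that by simp
qed

lemma gen_eigenspace_inter_trivial:
  assumes T: "endo T"
    and x: "x \<in> gen_eigenspace T \<mu>" "x \<in> gen_eigenspace T \<nu>" and "\<mu> \<noteq> \<nu>"
  shows "x = 0"
proof (rule ccontr)
  assume "x \<noteq> 0"
  let ?N = "\<lambda>y. T y - \<mu> *s y"
  obtain n where n: "(?N ^^ n) x \<noteq> 0" "T ((?N ^^ n) x) = \<mu> *s (?N ^^ n) x"
    using gen_eigenspace_eigenvector[OF T x(1) \<open>x \<noteq> 0\<close>] by blast
  have "(?N ^^ n) x \<in> gen_eigenspace T \<nu>"
  proof (induction n)
    case (Suc n)
    then show ?case using shift_gen_eigenspace[OF T] by simp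
  qed (simp add: x)
  then show False
    using eigenvector_in_gen_eigenspace_eq[OF T n(2) _ n(1)] \<open>\<mu> \<noteq> \<nu>\<close> by blast
qed

text \<open>If \<open>n\<close> is so large that \<open>(T - a)\<^sup>n\<close> annihilates the component in the generalised eigenspace of
  \<open>a\<close>, it is still injective on the other ones; this removes one component from a relation.\<close>

lemma gen_eigenspace_independent:
  assumes T: "endo T" and "finite F"
    and "\<And>\<mu>. \<mu> \<in> F \<Longrightarrow> x \<mu> \<in> gen_eigenspace T \<mu>" and "(\<Sum>\<mu>\<in>F. x \<mu>) = 0"
  shows "\<forall>\<mu>\<in>F. x \<mu> = 0"
  using assms(2-)
proof (induction F arbitrary: x rule: finite_induct)
  case (insert a F)
  let ?N = "\<lambda>y. T y - a *s y"
  have lin: "endo (?N ^^ n)" for n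
    by (intro endo_funpow endo_shift T)
  have xa: "x a \<in> gen_eigenspace T a"
    by (simp add: insert.prems)
  then obtain n where n: "(?N ^^ n) (x a) = 0"
    by (auto simp: gen_eigenspace_def)
  have mem: "(?N ^^ k) (x \<mu>) \<in> gen_eigenspace T \<mu>" if "\<mu> \<in> F" for \<mu> k
  proof (induction k)
    case 0
    then show ?case using insert.prems(1)[of \<mu>] that by simp
  next
    case (Suc k)
    then show ?case using shift_gen_eigenspace[OF T Suc.IH, of a] by simp
  qed
  have "(\<Sum>\<mu>\<in>F. (?N ^^ n) (x \<mu>)) = (\<Sum>\<mu>\<in>insert a F. (?N ^^ n) (x \<mu>))"
    unfolding sum.insert[OF insert.hyps] n by simp
  also have "\<dots> = (?N ^^ n) (\<Sum>\<mu>\<in>insert a F. x \<mu>)"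
    by (rule endo_sum[OF lin, symmetric])
  also have "\<dots> = 0"
    unfolding insert.prems(2) by (rule endo_0[OF lin])
  finally have zero: "\<forall>\<mu>\<in>F. (?N ^^ n) (x \<mu>) = 0"
    using insert.IH[of "\<lambda>\<mu>. (?N ^^ n) (x \<mu>)"] mem by blast
  have "x \<mu> = 0" if "\<mu> \<in> F" for \<mu>
  proof (rule gen_eigenspace_inter_trivial[OF T])
    show "x \<mu> \<in> gen_eigenspace T \<mu>" using insert.prems that by simp
    show "x \<mu> \<in> gen_eigenspace T a" using zero that by (auto simp: gen_eigenspace_def)
    show "\<mu> \<noteq> a" using that insert.hyps by auto
  qed
  then show ?case
    using insert.prems(2) insert.hyps by simp
qed simp

text \<open>On the generalised eigenspace of \<open>\<mu> \<noteq> a\<close> the operator \<open>T - a\<close> is the non-zero scalar \<open>\<mu> - a\<close> plus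
  the locally nilpotent \<open>T - \<mu>\<close>.\<close>

lemma gen_eigenspace_shift_surj:
  assumes T: "endo T" and W: "subspace W" "\<And>x. x \<in> W \<Longrightarrow> T x \<in> W"
    and "a \<noteq> \<mu>" and "y \<in> gen_eigenspace T \<mu> \<inter> W"
  shows "\<exists>z \<in> gen_eigenspace T \<mu> \<inter> W. T z - a *s z = y"
proof -
  let ?N = "\<lambda>y. T y - \<mu> *s y"
  have sub: "subspace (gen_eigenspace T \<mu> \<inter> W)"
    by (intro subspace_inter subspace_gen_eigenspace T W)
  obtain n where "(?N ^^ n) y = 0"
    using assms(5) by (auto simp: gen_eigenspace_def)
  then show ?thesis
    using assms(5)
  proof (induction n arbitrary: y)
    case 0
    then show ?case using subspace_0[OF sub] endo_0[OF T] by (auto intro!: bexI[of _ 0])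
  next
    case (Suc n)
    have "?N y \<in> gen_eigenspace T \<mu> \<inter> W"
      using Suc.prems(2) shift_gen_eigenspace[OF T] W by (auto intro!: subspace_diff subspace_scale)
    moreover have "(?N ^^ n) (?N y) = 0"
      using Suc.prems(1) unfolding funpow_Suc_right by simp
    ultimately obtain z where z: "z \<in> gen_eigenspace T \<mu> \<inter> W" "T z - a *s z = ?N y"
      using Suc.IH by blast
    let ?z = "(1 / (\<mu> - a)) *s (y - z)"
    have "T y - a *s y = ?N y + (\<mu> - a) *s y"
      by (simp add: scale_left_diff_distrib)
    then have "T (y - z) - a *s (y - z) = (\<mu> - a) *s y"
      using z(2) by (simp add: endo_diff[OF T] scale_right_diff_distrib algebra_simps)
    then have "T ?z - a *s ?z = y"
      using endo_scale[OF endo_shift[OF T, of a], of "1 / (\<mu> - a)" "y - z"] \<open>a \<noteq> \<mu>\<close>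
      by simp
    moreover have "?z \<in> gen_eigenspace T \<mu> \<inter> W"
      by (intro subspace_scale[OF sub] subspace_diff[OF sub] Suc.prems z)
    ultimately show ?case by blast
  qed
qed

definition poly_op :: "('v \<Rightarrow> 'v) \<Rightarrow> complex poly \<Rightarrow> 'v \<Rightarrow> 'v" where
  "poly_op T p x = (\<Sum>i\<le>degree p. coeff p i *s (T ^^ i) x)"

lemma poly_op_bound: "degree p \<le> n \<Longrightarrow> poly_op T p x = (\<Sum>i\<le>n. coeff p i *s (T ^^ i) x)"
  unfolding poly_op_def
  by (rule sum.mono_neutral_left) (auto simp: coeff_eq_0)

lemma poly_op_linear_factor:
  assumes T: "endo T"
  shows "poly_op T ([:- a, 1:] * q) x = poly_op T q (T x - a *s x)"
proof -
  let ?n = "degree q"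
  have lin: "endo (T ^^ i)" for i by (rule endo_funpow[OF T])
  have q: "[:- a, 1:] * q = pCons 0 q - smult a q"
    by simp
  have "poly_op T ([:- a, 1:] * q) x =
      (\<Sum>i\<le>Suc ?n. coeff (pCons 0 q) i *s (T ^^ i) x) - (\<Sum>i\<le>Suc ?n. (a * coeff q i) *s (T ^^ i) x)"
    unfolding q
    by (subst poly_op_bound[of _ "Suc ?n"])
      (auto simp: sum_subtractf[symmetric] scale_left_diff_distrib
        intro!: degree_diff_le order.trans[OF degree_smult_le])
  also have "(\<Sum>i\<le>Suc ?n. coeff (pCons 0 q) i *s (T ^^ i) x) = (\<Sum>i\<le>?n. coeff q i *s (T ^^ i) (T x))"
    by (subst sum.atMost_Suc_shift) (simp add: funpow_Suc_right del: funpow.simps(2))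
  also have "(\<Sum>i\<le>Suc ?n. (a * coeff q i) *s (T ^^ i) x) = (\<Sum>i\<le>?n. (a * coeff q i) *s (T ^^ i) x)"
    by (simp add: coeff_eq_0)
  finally show ?thesis
    by (simp add: poly_op_def endo_diff[OF lin] endo_scale[OF lin] scale_right_diff_distrib
        sum_subtractf mult.commute)
qed

text \<open>The vectors \<open>T\<^sup>i x\<close> with \<open>i \<le> dim\<close> are too many to be distinct and independent.\<close>

lemma annihilating_poly:
  obtains p where "p \<noteq> 0" "poly_op T p x = 0"
proof (cases "inj_on (\<lambda>i. (T ^^ i) x) {..card Basis}")
  case False
  then obtain i j where ij: "(T ^^ i) x = (T ^^ j) x" "i \<noteq> j"
    by (auto simp: inj_on_def)
  let ?p = "monom 1 i - monom (1::complex) j"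
  have "coeff ?p i \<noteq> 0" using ij by simp
  then have "?p \<noteq> 0" by force
  moreover have "poly_op T ?p x =
      (\<Sum>k\<le>i+j. (if k = i then (T ^^ k) x else 0) - (if k = j then (T ^^ k) x else 0))"
    by (subst poly_op_bound[of _ "i + j"])
      (auto intro!: sum.cong degree_diff_le order.trans[OF degree_monom_le])
  then have "poly_op T ?p x = 0"
    using ij(1) by (simp add: sum_subtractf)
  ultimately show ?thesis using that by blast
next
  case True
  let ?B = "(\<lambda>i. (T ^^ i) x) ` {..card Basis}"
  have card: "card ?B = Suc (card Basis)"
    using card_image[OF True] by simp
  have "dependent ?B"
    using independent_card_le_dim[of ?B UNIV] card by force
  then obtain u where u: "(\<Sum>v\<in>?B. u v *s v) = 0" "\<exists>v\<in>?B. u v \<noteq> 0"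
    by (auto simp: dependent_finite)
  then obtain j where j: "j \<le> card Basis" "u ((T ^^ j) x) \<noteq> 0" by auto
  define p where "p = (\<Sum>i\<le>card Basis. monom (u ((T ^^ i) x)) i)"
  have coeff: "coeff p i = (if i \<le> card Basis then u ((T ^^ i) x) else 0)" for i
    by (auto simp: p_def coeff_sum)
  have "degree p \<le> card Basis"
    by (rule degree_le) (auto simp: coeff)
  then have "poly_op T p x = (\<Sum>i\<le>card Basis. u ((T ^^ i) x) *s (T ^^ i) x)"
    by (simp add: poly_op_bound coeff)
  also have "\<dots> = 0"
    using u(1) by (simp add: sum.reindex[OF True])
  finally have "poly_op T p x = 0" .
  moreover have "p \<noteq> 0" using coeff[of j] j by force
  ultimately show ?thesis using that by blast
qed

text \<open>Induction on the degree of an annihilating polynomial of \<open>x\<close>: splitting off a root \<open>a\<close>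
  reduces \<open>x\<close> to \<open>T x - a x\<close>, and \<open>T - a\<close> is onto on the other generalised eigenspaces.\<close>

theorem gen_eigenspace_decomposition:
  assumes T: "endo T" and W: "subspace W" "\<And>x. x \<in> W \<Longrightarrow> T x \<in> W"
    and "x \<in> W"
  shows "x \<in> span (\<Union>\<mu>. gen_eigenspace T \<mu> \<inter> W)"
proof -
  let ?S = "span (\<Union>\<mu>. gen_eigenspace T \<mu> \<inter> W)"
  have surj: "\<exists>z \<in> ?S. T z - a *s z - y \<in> gen_eigenspace T a \<inter> W" if "y \<in> ?S" for a y
    using that
  proof (induction rule: span_induct_alt)
    case base
    then show ?case
      by (intro bexI[of _ 0]) (auto simp: span_zero endo_0[OF T] W subspace_0 subspace_gen_eigenspace[OF T])
  next
    case (step c y x)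
    then obtain z \<mu> where z: "z \<in> ?S" "T z - a *s z - x \<in> gen_eigenspace T a \<inter> W"
      and y: "y \<in> gen_eigenspace T \<mu> \<inter> W" by blast
    have sub: "subspace (gen_eigenspace T a \<inter> W)"
      by (intro subspace_inter subspace_gen_eigenspace T W)
    show ?case
    proof (cases "\<mu> = a")
      case True
      then have "T z - a *s z - x - c *s y \<in> gen_eigenspace T a \<inter> W"
        using subspace_diff[OF sub z(2) subspace_scale[OF sub]] y by blast
      then show ?thesis
        using z(1) by (intro bexI[of _ z]) (simp_all add: algebra_simps)
    next
      case False
      then obtain w where w: "w \<in> gen_eigenspace T \<mu> \<inter> W" "T w - a *s w = y"
        using gen_eigenspace_shift_surj[OF T W, of a \<mu> y] y by auto
      have "T (c *s w + z) - a *s (c *s w + z) - (c *s y + x) = T z - a *s z - x"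
        unfolding endo_add[OF T] endo_scale[OF T] w(2)[symmetric] by (simp add: algebra_simps)
      moreover have "c *s w + z \<in> ?S"
        using w(1) z(1) by (intro span_add span_scale) (auto intro!: span_base)
      ultimately show ?thesis using z(2) by metis
    qed
  qed
  obtain p where p: "p \<noteq> 0" "poly_op T p x = 0"
    using annihilating_poly .
  define n where "n = degree p"
  from p n_def \<open>x \<in> W\<close> show ?thesis
  proof (induction n arbitrary: p x)
    case 0
    then obtain c where "p = [:c:]" "c \<noteq> 0" by (metis degree_eq_zeroE pCons_0_0)
    then have "x = 0" using 0 by (simp add: poly_op_def)
    then show ?case by (simp add: span_zero)
  next
    case (Suc n)
    then have "\<not> constant (poly p)" by (simp add: constant_degree)
    then obtain a where "poly p a = 0" using fundamental_theorem_of_algebra by blast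
    then obtain q where q: "p = [:- a, 1:] * q" by (metis dvdE poly_eq_0_iff_dvd)
    have "q \<noteq> 0" using q Suc.prems by auto
    have "degree q = n" using q Suc.prems(3) \<open>q \<noteq> 0\<close> by (simp add: degree_mult_eq del: mult_pCons_left)
    moreover have "poly_op T q (T x - a *s x) = 0"
      using Suc.prems(2) poly_op_linear_factor[OF T] by (simp add: q del: mult_pCons_left)
    moreover have "T x - a *s x \<in> W"
      using W Suc.prems(4) by (intro subspace_diff subspace_scale) auto
    ultimately have "T x - a *s x \<in> ?S" using Suc.IH \<open>q \<noteq> 0\<close> by blast
    then obtain z where z: "z \<in> ?S" "T z - a *s z - (T x - a *s x) \<in> gen_eigenspace T a \<inter> W"
      using surj by blast
    have "z \<in> W"
      using z(1) span_minimal[of "\<Union>\<mu>. gen_eigenspace T \<mu> \<inter> W" W] W(1) by blast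
    have "T (z - x) - a *s (z - x) \<in> gen_eigenspace T a"
      using z(2) by (simp add: endo_diff[OF T] algebra_simps)
    then obtain k where "((\<lambda>y. T y - a *s y) ^^ k) (T (z - x) - a *s (z - x)) = 0"
      by (auto simp: gen_eigenspace_def)
    then have "((\<lambda>y. T y - a *s y) ^^ Suc k) (z - x) = 0"
      unfolding funpow_Suc_right by simp
    then have "z - x \<in> gen_eigenspace T a \<inter> W"
      using \<open>z \<in> W\<close> Suc.prems(4) W(1)
      unfolding gen_eigenspace_def by (blast intro: subspace_diff)
    then have "z - x \<in> ?S" by (blast intro: span_base)
    then have "z - (z - x) \<in> ?S" using z(1) span_diff by blast
    then show ?case by simp
  qed
qed

corollary gen_eigenspace_exists:
  assumes T: "endo T" and W: "subspace W" "\<And>x. x \<in> W \<Longrightarrow> T x \<in> W"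
    and "W \<noteq> {0}"
  obtains \<mu> x where "x \<in> gen_eigenspace T \<mu> \<inter> W" "x \<noteq> 0"
proof -
  obtain x where "x \<in> W" "x \<noteq> 0" using assms(4) subspace_0[OF W(1)] by blast
  then have "x \<in> span (\<Union>\<mu>. gen_eigenspace T \<mu> \<inter> W)"
    using gen_eigenspace_decomposition[OF T W] by blast
  then have "\<not> (\<Union>\<mu>. gen_eigenspace T \<mu> \<inter> W) \<subseteq> {0}"
    using \<open>x \<noteq> 0\<close> span_minimal[of _ "{0}"] by auto
  then show thesis using that by blast
qed

end

section \<open>Traces on invariant subspaces\<close>

context complex_vector_space
begin

definition basis_trace :: "'v set \<Rightarrow> ('v \<Rightarrow> 'v) \<Rightarrow> complex" where
  "basis_trace C T = (\<Sum>b\<in>C. representation C (T b) b)"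

lemma representation_endo:
  assumes C: "independent C" and D: "independent D" and T: "endo T"
    and inv: "\<And>x. x \<in> span C \<Longrightarrow> T x \<in> span D" and x: "x \<in> span C"
  shows "representation D (T x) d = (\<Sum>c\<in>C. representation C x c * representation D (T c) d)"
proof -
  have fin: "finite C" using C by (rule finiteI_independent)
  have "T x = T (\<Sum>c\<in>C. representation C x c *s c)"
    using sum_representation_eq[OF C x fin order.refl] by simp
  also have "\<dots> = (\<Sum>c\<in>C. representation C x c *s T c)"
    by (simp add: endo_sum[OF T] endo_scale[OF T])
  finally have Tx: "T x = (\<Sum>c\<in>C. representation C x c *s T c)" .
  have mem: "T c \<in> span D" if "c \<in> C" for c
    using inv span_base that by blast
  have "representation D (T x) d = (\<Sum>c\<in>C. representation D (representation C x c *s T c) d)"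
    unfolding Tx by (subst representation_sum[OF D]) (auto intro: span_scale mem)
  also have "\<dots> = (\<Sum>c\<in>C. representation C x c * representation D (T c) d)"
    by (rule sum.cong) (auto simp: representation_scale[OF D mem])
  finally show ?thesis .
qed

lemma basis_trace_commute:
  assumes C: "independent C" and S: "endo S" and T: "endo T"
    and inv: "\<And>x. x \<in> span C \<Longrightarrow> S x \<in> span C" "\<And>x. x \<in> span C \<Longrightarrow> T x \<in> span C"
  shows "basis_trace C (\<lambda>x. S (T x)) = basis_trace C (\<lambda>x. T (S x))"
proof -
  have *: "representation C (S (T b)) b =
      (\<Sum>c\<in>C. representation C (T b) c * representation C (S c) b)"
    if "b \<in> C" "endo S" "\<And>x. x \<in> span C \<Longrightarrow> S x \<in> span C" "\<And>x. x \<in> span C \<Longrightarrow> T x \<in> span C"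
    for b S T
    by (rule representation_endo) (use that C in \<open>auto intro: span_base\<close>)
  have "basis_trace C (\<lambda>x. S (T x)) =
      (\<Sum>b\<in>C. \<Sum>c\<in>C. representation C (T b) c * representation C (S c) b)"
    unfolding basis_trace_def by (intro sum.cong refl * S inv)
  also have "\<dots> = (\<Sum>c\<in>C. \<Sum>b\<in>C. representation C (S c) b * representation C (T b) c)"
    by (subst sum.swap) (simp add: mult.commute)
  also have "\<dots> = basis_trace C (\<lambda>x. T (S x))"
    unfolding basis_trace_def by (intro sum.cong refl *[symmetric] T inv)
  finally show ?thesis .
qed

text \<open>Expanding each basis in the other one turns both traces into the same double sum.\<close>

lemma basis_trace_eq:
  assumes C: "independent C" and D: "independent D" and CD: "span C = span D"
    and T: "endo T" and inv: "\<And>x. x \<in> span C \<Longrightarrow> T x \<in> span C"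
  shows "basis_trace C T = basis_trace D T"
proof -
  have id: "endo (\<lambda>x. x)" by (rule endoI) auto
  have "basis_trace C T = (\<Sum>b\<in>C. \<Sum>d\<in>D. representation D b d * representation C (T d) b)"
    unfolding basis_trace_def
    by (intro sum.cong refl representation_endo C D T) (use inv CD in \<open>auto intro: span_base\<close>)
  also have "\<dots> = (\<Sum>d\<in>D. \<Sum>b\<in>C. representation C (T d) b * representation D b d)"
    by (subst sum.swap) (simp add: mult.commute)
  also have "\<dots> = basis_trace D T"
    unfolding basis_trace_def
    by (intro sum.cong refl representation_endo[OF C D id, symmetric])
      (use inv CD in \<open>auto intro: span_base\<close>)
  finally show ?thesis .
qed

lemma basis_trace_linear:
  assumes "independent C" "\<And>x. x \<in> span C \<Longrightarrow> S x \<in> span C" "\<And>x. x \<in> span C \<Longrightarrow> T x \<in> span C"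
  shows "basis_trace C (\<lambda>x. S x + a *s T x) = basis_trace C S + a * basis_trace C T"
  unfolding basis_trace_def sum_distrib_left sum.distrib[symmetric]
  by (rule sum.cong)
    (use assms in \<open>auto simp: representation_add representation_scale span_base span_scale\<close>)

lemma basis_trace_ident: "independent C \<Longrightarrow> basis_trace C (\<lambda>x. x) = of_nat (card C)"
  by (simp add: basis_trace_def representation_basis)

lemma basis_trace_superset:
  assumes B: "independent B" and CB: "C \<subseteq> B" and inv: "\<And>x. x \<in> span C \<Longrightarrow> T x \<in> span C"
  shows "basis_trace B T = basis_trace C T + (\<Sum>b\<in>B - C. representation B (T b) b)"
proof -
  have fin: "finite B" using B by (rule finiteI_independent)
  have "(\<Sum>b\<in>C. representation B (T b) b) = basis_trace C T"
    unfolding basis_trace_def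
  proof (intro sum.cong refl)
    fix b assume "b \<in> C"
    then have "T b \<in> span C" using inv span_base by blast
    from representation_extend[OF B this CB]
    show "representation B (T b) b = representation C (T b) b" by simp
  qed
  then show ?thesis
    unfolding basis_trace_def by (subst sum.subset_diff[OF CB fin]) simp
qed

text \<open>The image of a nilpotent \<open>N\<close> on \<open>span C\<close> is a smaller invariant subspace that carries the
  whole trace, so the trace vanishes by induction on the dimension.\<close>

lemma basis_trace_nilpotent:
  assumes "independent C" and N: "endo N" and "\<And>x. x \<in> span C \<Longrightarrow> N x \<in> span C"
    and "\<And>x. x \<in> span C \<Longrightarrow> \<exists>n. (N ^^ n) x = 0"
  shows "basis_trace C N = 0"
  using assms(1,3,4)
proof (induction "card C" arbitrary: C rule: less_induct)
  case less
  show ?case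
  proof (cases "C = {}")
    case True
    then show ?thesis by (simp add: basis_trace_def)
  next
    case False
    then obtain b where "b \<in> C" by blast
    then have b: "b \<in> span C" "b \<noteq> 0"
      using less.prems(1) dependent_zero by (auto intro: span_base)
    have "b \<in> gen_eigenspace N 0"
      using less.prems(3)[OF b(1)] by (simp add: gen_eigenspace_def)
    then obtain n where "((\<lambda>y. N y - 0 *s y) ^^ n) b \<noteq> 0"
      "N (((\<lambda>y. N y - 0 *s y) ^^ n) b) = 0 *s ((\<lambda>y. N y - 0 *s y) ^^ n) b"
      using gen_eigenspace_eigenvector[OF N _ b(2)] by metis
    then have n: "(N ^^ n) b \<noteq> 0" "N ((N ^^ n) b) = 0" by simp_all
    define v where "v = (N ^^ n) b"
    have "(N ^^ k) b \<in> span C" for k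
      by (induction k) (use b less.prems(2) in auto)
    then have v: "v \<in> span C" "v \<noteq> 0" "N v = 0" using n by (auto simp: v_def)
    have "independent {v}" using v(2) by simp
    then obtain C1 where C1: "{v} \<subseteq> C1" "C1 \<subseteq> span C" "independent C1" "span C \<subseteq> span C1"
      using maximal_independent_subset_extend[of "{v}" "span C"] v(1) by auto
    have span1: "span C1 = span C"
      using C1 span_minimal[of C1 "span C"] by auto
    have fin1: "finite C1" using C1(3) by (rule finiteI_independent)
    have card1: "card C1 = card C"
      using span1 C1(3) less.prems(1) by (metis dim_span_eq_card_independent)
    let ?W = "N ` span C"
    have subW: "subspace ?W"
      using module_hom.subspace_image[OF module_hom_linearI[OF N]] by auto
    obtain D where D: "D \<subseteq> ?W" "independent D" "?W \<subseteq> span D" "card D = dim ?W"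
      using basis_exists by blast
    have spanD: "span D = ?W"
      using D subW by (simp add: span_subspace)
    have "?W \<subseteq> span (N ` (C1 - {v}))"
    proof -
      have "?W = span (N ` C1)"
        using module_hom.span_image[OF module_hom_linearI[OF N], of C1] span1 by simp
      also have "N ` C1 \<subseteq> insert 0 (N ` (C1 - {v}))" using v(3) by auto
      then have "span (N ` C1) \<subseteq> span (N ` (C1 - {v}))"
        by (intro span_minimal subspace_span)
          (metis insert_subset order_trans span_superset span_zero)
      finally show ?thesis .
    qed
    then have "dim ?W \<le> card (N ` (C1 - {v}))"
      by (rule dim_le_card) (use fin1 in auto)
    also have "\<dots> \<le> card (C1 - {v})" by (rule card_image_le) (use fin1 in auto)
    also have "\<dots> < card C1" by (rule card_Diff1_less) (use fin1 C1(1) in auto)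
    finally have smaller: "card D < card C" using card1 D(4) by simp
    have DC: "span D \<subseteq> span C" using spanD less.prems(2) by auto
    have invD: "N x \<in> span D" if "x \<in> span C" for x using that spanD by auto
    have "basis_trace D N = 0"
      by (rule less.hyps[OF smaller D(2)]) (use invD DC less.prems(3) in auto)
    obtain C2 where C2: "D \<subseteq> C2" "C2 \<subseteq> span C" "independent C2" "span C \<subseteq> span C2"
      using maximal_independent_subset_extend[OF _ D(2), of "span C"] DC span_superset by blast
    have span2: "span C2 = span C"
      using C2 span_minimal[of C2 "span C"] by auto
    have "representation C2 (N b) b = 0" if "b \<in> C2 - D" for b
    proof -
      have "N b \<in> span D" using that C2(2) invD by auto
      then have "representation C2 (N b) = representation D (N b)"
        using representation_extend[OF C2(3) _ C2(1)] by blast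
      then show ?thesis using representation_ne_zero that by (metis DiffD2)
    qed
    then have "basis_trace C2 N = basis_trace D N"
      using basis_trace_superset[OF C2(3) C2(1), of N] invD DC by auto
    moreover have "basis_trace C N = basis_trace C2 N"
      by (rule basis_trace_eq[OF less.prems(1) C2(3) span2[symmetric] N less.prems(2)])
    ultimately show ?thesis using \<open>basis_trace D N = 0\<close> by simp
  qed
qed

text \<open>Only meaningful if \<open>T\<close> maps \<open>W\<close> into itself; it then does not depend on the basis.\<close>

definition trace_on :: "'v set \<Rightarrow> ('v \<Rightarrow> 'v) \<Rightarrow> complex" where
  "trace_on W = basis_trace (SOME C. independent C \<and> span C = W)"

lemma trace_on_eq_basis_trace:
  assumes "independent C" "span C = W" "endo T" "\<And>x. x \<in> W \<Longrightarrow> T x \<in> W"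
  shows "trace_on W T = basis_trace C T"
proof -
  let ?D = "SOME C. independent C \<and> span C = W"
  have "independent ?D \<and> span ?D = W" by (rule someI) (use assms in blast)
  then show ?thesis
    unfolding trace_on_def using assms by (intro basis_trace_eq) auto
qed

lemma subspace_basis:
  assumes "subspace W"
  obtains C where "independent C" "span C = W" "finite C" "card C = dim W"
proof -
  obtain C where "C \<subseteq> W" "independent C" "W \<subseteq> span C" "card C = dim W"
    using basis_exists by blast
  then show thesis
    using that[of C] span_subspace[of C W] finiteI_independent assms by blast
qed

lemma trace_on_commute:
  assumes "subspace W" "endo S" "endo T"
    and "\<And>x. x \<in> W \<Longrightarrow> S x \<in> W" "\<And>x. x \<in> W \<Longrightarrow> T x \<in> W"
  shows "trace_on W (\<lambda>x. S (T x)) = trace_on W (\<lambda>x. T (S x))"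
proof -
  obtain C where C: "independent C" "span C = W" using subspace_basis[OF assms(1)] by blast
  have "endo (\<lambda>x. S (T x))" "endo (\<lambda>x. T (S x))"
    using Vector_Spaces.linear_compose[OF assms(2,3)] Vector_Spaces.linear_compose[OF assms(3,2)]
    by (simp_all add: o_def)
  then show ?thesis
    using basis_trace_commute[OF C(1) assms(2,3)] assms C
    by (simp add: trace_on_eq_basis_trace[OF C])
qed

lemma trace_on_linear:
  assumes "subspace W" "endo S" "endo T"
    and "\<And>x. x \<in> W \<Longrightarrow> S x \<in> W" "\<And>x. x \<in> W \<Longrightarrow> T x \<in> W"
  shows "trace_on W (\<lambda>x. S x + a *s T x) = trace_on W S + a * trace_on W T"
proof -
  obtain C where C: "independent C" "span C = W" using subspace_basis[OF assms(1)] by blast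
  have "endo (\<lambda>x. S x + a *s T x)"
    by (rule endoI)
      (simp_all add: endo_add[OF assms(2)] endo_add[OF assms(3)] endo_scale[OF assms(2)]
        endo_scale[OF assms(3)] scale_right_distrib mult.commute)
  then show ?thesis
    using basis_trace_linear[OF C(1), of S T a] assms C
    by (simp add: trace_on_eq_basis_trace[OF C] subspace_add subspace_scale)
qed

lemma trace_on_ident: "subspace W \<Longrightarrow> trace_on W (\<lambda>x. x) = of_nat (dim W)"
proof -
  assume W: "subspace W"
  obtain C where C: "independent C" "span C = W" "card C = dim W"
    using subspace_basis[OF W] by blast
  have "endo (\<lambda>x. x)" by (rule endoI) auto
  then have "trace_on W (\<lambda>x. x) = basis_trace C (\<lambda>x. x)"
    by (intro trace_on_eq_basis_trace C)
  then show ?thesis using basis_trace_ident[OF C(1)] C(3) by simp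
qed

lemma trace_on_gen_eigenspace:
  assumes "subspace W" and T: "endo T" and "\<And>x. x \<in> W \<Longrightarrow> T x \<in> W" and "W \<subseteq> gen_eigenspace T c"
  shows "trace_on W T = c * of_nat (dim W)"
proof -
  obtain C where C: "independent C" "span C = W" using subspace_basis[OF assms(1)] by blast
  let ?N = "\<lambda>x. T x - c *s x"
  have N: "endo ?N" by (rule endo_shift[OF T])
  have invN: "?N x \<in> W" if "x \<in> W" for x
    using that assms by (auto intro: subspace_diff subspace_scale)
  have "basis_trace C ?N = 0"
    by (rule basis_trace_nilpotent[OF C(1) N]) (use C invN assms(4) in \<open>auto simp: gen_eigenspace_def\<close>)
  then have "trace_on W ?N = 0"
    using trace_on_eq_basis_trace[OF C N invN] by simp
  moreover have "trace_on W (\<lambda>x. ?N x + c *s x) = trace_on W ?N + c * trace_on W (\<lambda>x. x)"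
    by (rule trace_on_linear) (use assms(1) N invN in \<open>auto intro: endoI\<close>)
  ultimately show ?thesis
    using trace_on_ident[OF assms(1)] by simp
qed

definition direct_family :: "'i set \<Rightarrow> ('i \<Rightarrow> 'v set) \<Rightarrow> bool" where
  "direct_family I W \<longleftrightarrow> (\<forall>x. (\<forall>i\<in>I. x i \<in> W i) \<longrightarrow> (\<Sum>i\<in>I. x i) = 0 \<longrightarrow> (\<forall>i\<in>I. x i = 0))"

text \<open>The union of bases of the summands is a basis of the sum, and the diagonal entries of \<open>T\<close> at a
  basis vector of \<open>W i\<close> only see \<open>W i\<close>.\<close>

lemma trace_on_direct_sum:
  assumes "finite I" and dir: "direct_family I W" and W: "\<And>i. i \<in> I \<Longrightarrow> subspace (W i)"
    and T: "endo T" and inv: "\<And>i x. i \<in> I \<Longrightarrow> x \<in> W i \<Longrightarrow> T x \<in> W i"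
  shows "trace_on (span (\<Union>i\<in>I. W i)) T = (\<Sum>i\<in>I. trace_on (W i) T)"
proof -
  have "\<exists>C. independent C \<and> span C = W i" if "i \<in> I" for i
    using subspace_basis[OF W[OF that]] by blast
  then have "\<exists>C. \<forall>i\<in>I. independent (C i) \<and> span (C i) = W i"
    by (intro bchoice) blast
  then obtain C where C: "\<And>i. i \<in> I \<Longrightarrow> independent (C i)" "\<And>i. i \<in> I \<Longrightarrow> span (C i) = W i"
    by blast
  have fin: "finite (C i)" if "i \<in> I" for i using C(1)[OF that] by (rule finiteI_independent)
  have CW: "v \<in> W i" if "i \<in> I" "v \<in> C i" for i v using that C(2) span_base by blast
  have disj: "C i \<inter> C j = {}" if ij: "i \<in> I" "j \<in> I" "i \<noteq> j" for i j
  proof (rule ccontr)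
    assume "C i \<inter> C j \<noteq> {}"
    then obtain v where v: "v \<in> C i" "v \<in> C j" by auto
    let ?x = "\<lambda>k. if k = i then v else if k = j then - v else 0"
    have "(\<Sum>k\<in>I. ?x k) = (\<Sum>k\<in>I. (if k = i then v else 0) + (if k = j then - v else 0))"
      by (rule sum.cong) (use ij in auto)
    also have "\<dots> = 0" using ij \<open>finite I\<close> by (simp add: sum.distrib)
    finally have "(\<Sum>k\<in>I. ?x k) = 0" .
    moreover have "\<forall>k\<in>I. ?x k \<in> W k"
      using ij v CW W by (auto intro: subspace_neg subspace_0)
    ultimately have "\<forall>k\<in>I. ?x k = 0"
      using dir unfolding direct_family_def by (elim allE[of _ ?x]) blast
    then have "?x i = 0" using ij by blast
    then have "v = 0" by simp
    then show False using v(1) C(1)[OF ij(1)] dependent_zero by blast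
  qed
  let ?B = "\<Union>i\<in>I. C i"
  have finB: "finite ?B" using fin \<open>finite I\<close> by blast
  have indep: "independent ?B"
  proof -
    have "u v = 0" if u: "(\<Sum>v\<in>?B. u v *s v) = 0" and "v \<in> ?B" for u v
    proof -
      have "(\<Sum>i\<in>I. \<Sum>v\<in>C i. u v *s v) = 0"
        using u by (subst (asm) sum.UNION_disjoint) (use fin disj \<open>finite I\<close> in auto)
      moreover have "\<forall>i\<in>I. (\<Sum>v\<in>C i. u v *s v) \<in> W i"
        using W CW by (auto intro!: subspace_sum subspace_scale)
      ultimately have zero: "\<forall>i\<in>I. (\<Sum>v\<in>C i. u v *s v) = 0"
        using dir unfolding direct_family_def by (elim allE[of _ "\<lambda>i. \<Sum>v\<in>C i. u v *s v"]) blast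
      obtain i where i: "i \<in> I" "v \<in> C i" using \<open>v \<in> ?B\<close> by blast
      then show ?thesis using independentD[OF C(1)[OF i(1)] fin[OF i(1)] order.refl _ i(2)] zero by blast
    qed
    then show ?thesis using dependent_finite[OF finB] by blast
  qed
  have spanB: "span ?B = span (\<Union>i\<in>I. W i)"
  proof (rule antisym)
    show "span ?B \<subseteq> span (\<Union>i\<in>I. W i)" by (rule span_mono) (use CW in blast)
    have "W i \<subseteq> span ?B" if "i \<in> I" for i
      using C(2)[OF that] span_mono[of "C i" ?B] that by blast
    then show "span (\<Union>i\<in>I. W i) \<subseteq> span ?B" by (intro span_minimal) auto
  qed
  have "T x \<in> span (\<Union>i\<in>I. W i)" if "x \<in> span (\<Union>i\<in>I. W i)" for x
    using that
  proof (induction rule: span_induct_alt)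
    case (step c x y)
    then show ?case
      using inv by (auto simp: endo_add[OF T] endo_scale[OF T] intro!: span_add span_scale intro: span_base)
  qed (simp add: endo_0[OF T] span_zero)
  then have "trace_on (span (\<Union>i\<in>I. W i)) T = basis_trace ?B T"
    by (intro trace_on_eq_basis_trace indep spanB T)
  also have "\<dots> = (\<Sum>i\<in>I. \<Sum>b\<in>C i. representation ?B (T b) b)"
    unfolding basis_trace_def by (rule sum.UNION_disjoint) (use fin disj \<open>finite I\<close> in auto)
  also have "\<dots> = (\<Sum>i\<in>I. basis_trace (C i) T)"
    unfolding basis_trace_def
  proof (intro sum.cong refl)
    fix i b assume i: "i \<in> I" "b \<in> C i"
    have "T b \<in> span (C i)" using C(2) inv CW i by auto
    then show "representation ?B (T b) b = representation (C i) (T b) b"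
      using representation_extend[OF indep, of "T b" "C i"] i(1) by (auto intro: fun_cong)
  qed
  also have "\<dots> = (\<Sum>i\<in>I. trace_on (W i) T)"
    by (intro sum.cong refl trace_on_eq_basis_trace[symmetric] C T) (auto simp: C(2) inv)
  finally show ?thesis .
qed

corollary trace_on_gen_eigenspaces:
  assumes "finite I" "direct_family I W" "\<And>i. i \<in> I \<Longrightarrow> subspace (W i)" "endo T"
    and "\<And>i x. i \<in> I \<Longrightarrow> x \<in> W i \<Longrightarrow> T x \<in> W i"
    and "\<And>i. i \<in> I \<Longrightarrow> W i \<subseteq> gen_eigenspace T (c i)"
  shows "trace_on (span (\<Union>i\<in>I. W i)) T = (\<Sum>i\<in>I. c i * of_nat (dim (W i)))"
proof -
  have "trace_on (span (\<Union>i\<in>I. W i)) T = (\<Sum>i\<in>I. trace_on (W i) T)"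
    by (rule trace_on_direct_sum[OF assms(1-4)]) (use assms(5) in auto)
  also have "\<dots> = (\<Sum>i\<in>I. c i * of_nat (dim (W i)))"
    by (intro sum.cong refl trace_on_gen_eigenspace assms)
  finally show ?thesis .
qed

end

section \<open>Weights of a nilpotent subalgebra\<close>

sublocale lie_algebra \<subseteq> complex_vector_space scale Basis
  by unfold_locales

context lie_algebra
begin

lemmas endo_ad = bracket_linear_right

lemma bracket_add_left: "bracket (x + y) z = bracket x z + bracket y z"
  by (rule endo_add[OF bracket_linear_left])

lemma bracket_scale_left: "bracket (c *s x) z = c *s bracket x z"
  by (rule endo_scale[OF bracket_linear_left])

lemma bracket_diff_left: "bracket (x - y) z = bracket x z - bracket y z"
  by (rule endo_diff[OF bracket_linear_left])

lemma bracket_0_left: "bracket 0 z = 0"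
  by (rule endo_0[OF bracket_linear_left])

lemmas bracket_add_right = endo_add[OF endo_ad]
  and bracket_scale_right = endo_scale[OF endo_ad]
  and bracket_diff_right = endo_diff[OF endo_ad]
  and bracket_0_right = endo_0[OF endo_ad]

lemma bracket_anti: "bracket x y = - bracket y x"
proof -
  have "bracket (x + y) (x + y) = 0" by (rule bracket_self)
  then have "bracket x y + bracket y x = 0"
    unfolding bracket_add_left bracket_add_right by (simp add: bracket_self add.commute)
  then show ?thesis by (simp only: eq_neg_iff_add_eq_0)
qed

lemma bracket_derivation: "bracket x (bracket y z) = bracket (bracket x y) z + bracket y (bracket x z)"
proof -
  have "bracket y (bracket z x) = - bracket y (bracket x z)"
    by (subst bracket_anti[of z x]) (rule module_hom.neg[OF module_hom_linearI[OF endo_ad]])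
  moreover have "bracket z (bracket x y) = - bracket (bracket x y) z"
    by (rule bracket_anti)
  ultimately show ?thesis using jacobi[of x y z] by (simp add: algebra_simps)
qed

text \<open>The trace of a commutator, on subspaces \<open>U\<close> that need not contain \<open>x\<close> and \<open>y\<close>.\<close>

lemma trace_on_bracket:
  assumes U: "subspace U" and x: "\<And>u. u \<in> U \<Longrightarrow> bracket x u \<in> U"
    and y: "\<And>u. u \<in> U \<Longrightarrow> bracket y u \<in> U"
  shows "trace_on U (bracket (bracket x y)) = 0"
proof -
  have xy: "endo (\<lambda>u. bracket x (bracket y u))" and yx: "endo (\<lambda>u. bracket y (bracket x u))"
    by (rule endoI; simp add: bracket_add_right bracket_scale_right)+
  have "(\<lambda>u. bracket x (bracket y u) + (-1) *s bracket y (bracket x u)) = bracket (bracket x y)"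
    by (rule ext) (simp add: bracket_derivation[of x y])
  then have "trace_on U (bracket (bracket x y)) =
      trace_on U (\<lambda>u. bracket x (bracket y u)) + (-1) * trace_on U (\<lambda>u. bracket y (bracket x u))"
    using trace_on_linear[OF U xy yx, of "-1"] x y by simp
  also have "trace_on U (\<lambda>u. bracket x (bracket y u)) = trace_on U (\<lambda>u. bracket y (bracket x u))"
    by (rule trace_on_commute[OF U endo_ad endo_ad x y])
  finally show ?thesis by simp
qed

text \<open>Leibniz rule: \<open>ad d - (\<mu> + \<nu>)\<close> acts on a bracket as \<open>ad d - \<mu>\<close> on the first and \<open>ad d - \<nu>\<close>
  on the second factor.\<close>

lemma bracket_gen_eigenspace:
  assumes "x \<in> gen_eigenspace (bracket d) \<mu>" "y \<in> gen_eigenspace (bracket d) \<nu>"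
  shows "bracket x y \<in> gen_eigenspace (bracket d) (\<mu> + \<nu>)"
proof -
  define M where "M = (\<lambda>z. bracket d z - \<mu> *s z)"
  define N where "N = (\<lambda>z. bracket d z - \<nu> *s z)"
  define K where "K = (\<lambda>z. bracket d z - (\<mu> + \<nu>) *s z)"
  have leibniz: "K (bracket x y) = bracket (M x) y + bracket x (N y)" for x y
    by (simp add: K_def M_def N_def bracket_derivation[of d x y] bracket_diff_left bracket_scale_left
        bracket_diff_right bracket_scale_right algebra_simps)
  have K: "endo (K ^^ k)" for k
    unfolding K_def by (intro endo_funpow endo_shift endo_ad)
  have "(K ^^ (m + n)) (bracket x y) = 0" if "(M ^^ m) x = 0" "(N ^^ n) y = 0" for m n x y
    using that
  proof (induction "m + n" arbitrary: m n x y)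
    case 0
    then show ?case by (simp add: bracket_0_left)
  next
    case (Suc k)
    show ?case
    proof (cases "m = 0 \<or> n = 0")
      case True
      then have "bracket x y = 0"
        using Suc.prems by (auto simp: bracket_0_left bracket_0_right)
      then show ?thesis using endo_0[OF K] by simp
    next
      case False
      then obtain m' n' where mn: "m = Suc m'" "n = Suc n'" by (metis not0_implies_Suc)
      have "(K ^^ (m' + n)) (bracket (M x) y) = 0"
        by (rule Suc.hyps(1)) (use Suc.hyps(2) Suc.prems mn in \<open>auto simp: funpow_Suc_right simp del: funpow.simps\<close>)
      moreover have "(K ^^ (m + n')) (bracket x (N y)) = 0"
        by (rule Suc.hyps(1)) (use Suc.hyps(2) Suc.prems mn in \<open>auto simp: funpow_Suc_right simp del: funpow.simps\<close>)
      moreover have "m + n = Suc (m' + n)" "m + n' = m' + n" using mn by auto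
      ultimately have "(K ^^ (m' + n)) (K (bracket x y)) = 0"
        unfolding leibniz by (simp add: endo_add[OF K])
      then show ?thesis
        using \<open>m + n = Suc (m' + n)\<close> by (simp add: funpow_Suc_right del: funpow.simps)
    qed
  qed
  moreover obtain m n where "(M ^^ m) x = 0" "(N ^^ n) y = 0"
    using assms unfolding gen_eigenspace_def M_def N_def by blast
  ultimately have "(K ^^ (m + n)) (bracket x y) = 0" by blast
  then show ?thesis
    unfolding gen_eigenspace_def K_def by blast
qed

definition invariant_under :: "'g set \<Rightarrow> 'g set \<Rightarrow> bool" where
  "invariant_under S W \<longleftrightarrow> subspace W \<and> (\<forall>h\<in>S. \<forall>w\<in>W. bracket h w \<in> W)"

lemma lower_central_subset:
  assumes "lie_subalgebra S"
  shows "lower_central S n \<subseteq> S"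
proof (induction n)
  case (Suc n)
  have "{bracket x y | x y. x \<in> S \<and> y \<in> lower_central S n} \<subseteq> S"
    using Suc assms unfolding lie_subalgebra_def by blast
  then show ?case
    using assms unfolding lie_subalgebra_def by (simp add: span_minimal)
qed simp

lemma nilpotent_subset_gen_eigenspace:
  assumes "nilpotent_subalgebra S" "h \<in> S"
  shows "S \<subseteq> gen_eigenspace (bracket h) 0"
proof
  fix x assume x: "x \<in> S"
  obtain n where n: "lower_central S n = {0}"
    using assms(1) unfolding nilpotent_subalgebra_def by blast
  have "(bracket h ^^ k) x \<in> lower_central S k" for k
  proof (induction k)
    case (Suc k)
    then show ?case using assms(2) by (auto intro!: span_base)
  qed (simp add: x)
  then have "(bracket h ^^ n) x = 0" using n by blast
  then show "x \<in> gen_eigenspace (bracket h) 0"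
    by (auto simp: gen_eigenspace_def)
qed

lemma invariant_gen_eigenspace:
  assumes "nilpotent_subalgebra S" "h \<in> S" "invariant_under S W"
  shows "invariant_under S (gen_eigenspace (bracket h) \<mu> \<inter> W)"
  unfolding invariant_under_def
proof (intro conjI ballI)
  show "subspace (gen_eigenspace (bracket h) \<mu> \<inter> W)"
    using assms(3) unfolding invariant_under_def
    by (intro subspace_inter subspace_gen_eigenspace endo_ad) auto
next
  fix g w assume gw: "g \<in> S" "w \<in> gen_eigenspace (bracket h) \<mu> \<inter> W"
  then have "bracket g w \<in> gen_eigenspace (bracket h) (0 + \<mu>)"
    using nilpotent_subset_gen_eigenspace[OF assms(1,2)] by (intro bracket_gen_eigenspace) auto
  then show "bracket g w \<in> gen_eigenspace (bracket h) \<mu> \<inter> W"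
    using gw assms(3) unfolding invariant_under_def by auto
qed

text \<open>On a minimal non-zero invariant subspace \<open>M\<close> every term of the lower central series of \<open>S\<close>
  acts by scalars, by descending induction: if \<open>[h, a]\<close> acts by the scalar \<open>c\<close> for \<open>h \<in> S\<close>, then
  \<open>c dim M\<close> is the trace of a commutator, so \<open>a\<close> commutes with the action of \<open>S\<close> and its
  eigenspaces in \<open>M\<close> are invariant.\<close>

theorem weight_vector_exists:
  assumes S: "nilpotent_subalgebra S" and W: "invariant_under S W" "W \<noteq> {0}"
  obtains w \<gamma> where "w \<in> W" "w \<noteq> 0" "\<And>h. h \<in> S \<Longrightarrow> bracket h w = \<gamma> h *s w"
proof -
  let ?P = "\<lambda>M. invariant_under S M \<and> M \<subseteq> W \<and> M \<noteq> {0}"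
  obtain M where M: "?P M" and least: "\<And>M'. ?P M' \<Longrightarrow> dim M \<le> dim M'"
    using ex_has_least_nat[of ?P W dim] W by auto
  have subM: "subspace M" and invM: "\<And>h w. h \<in> S \<Longrightarrow> w \<in> M \<Longrightarrow> bracket h w \<in> M"
    using M unfolding invariant_under_def by auto
  have minimal: "M' = M" if "invariant_under S M'" "M' \<subseteq> M" "M' \<noteq> {0}" for M'
    using that M subM least[of M'] subspace_dim_equal[of M' M]
    unfolding invariant_under_def by blast
  have "M \<noteq> {}" using subspace_0[OF subM] by blast
  then have dimM: "dim M \<noteq> 0" using M dim_eq_0[of M] by blast
  have S': "lie_subalgebra S" using S unfolding nilpotent_subalgebra_def by blast
  obtain n where n: "lower_central S n = {0}"
    using S unfolding nilpotent_subalgebra_def by blast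
  have "\<forall>a\<in>lower_central S 0. \<exists>c. \<forall>w\<in>M. bracket a w = c *s w"
  proof (rule inc_induct[of 0 n])
    show "\<forall>a\<in>lower_central S n. \<exists>c. \<forall>w\<in>M. bracket a w = c *s w"
      unfolding n by (auto simp: bracket_0_left intro!: exI[of _ 0])
  next
    fix k
    assume IH: "\<forall>a\<in>lower_central S (Suc k). \<exists>c. \<forall>w\<in>M. bracket a w = c *s w"
    show "\<forall>a\<in>lower_central S k. \<exists>c. \<forall>w\<in>M. bracket a w = c *s w"
    proof
      fix a assume a: "a \<in> lower_central S k"
      then have aS: "a \<in> S" using lower_central_subset[OF S'] by blast
      have commute: "bracket (bracket h a) w = 0" if h: "h \<in> S" and w: "w \<in> M" for h w
      proof -
        have "bracket h a \<in> lower_central S (Suc k)"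
          using h a by (auto intro!: span_base)
        then obtain c where c: "\<And>w. w \<in> M \<Longrightarrow> bracket (bracket h a) w = c *s w"
          using IH by blast
        have "trace_on M (bracket (bracket h a)) = 0"
          by (rule trace_on_bracket[OF subM]) (use invM h aS in auto)
        moreover have "trace_on M (bracket (bracket h a)) = c * of_nat (dim M)"
          by (rule trace_on_gen_eigenspace[OF subM endo_ad])
            (use c subM in \<open>auto intro: subspace_scale eigenvector_in_gen_eigenspace\<close>)
        ultimately have "c = 0" using dimM by simp
        then show ?thesis using c[OF w] by simp
      qed
      have inva: "bracket a w \<in> M" if "w \<in> M" for w using invM aS that by blast
      have "M \<noteq> {0}" using M by blast
      then obtain \<mu> x where x: "x \<in> gen_eigenspace (bracket a) \<mu> \<inter> M" "x \<noteq> 0"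
        using gen_eigenspace_exists[OF endo_ad subM inva] by blast
      obtain m where m: "((\<lambda>y. bracket a y - \<mu> *s y) ^^ m) x \<noteq> 0"
        "bracket a (((\<lambda>y. bracket a y - \<mu> *s y) ^^ m) x) = \<mu> *s ((\<lambda>y. bracket a y - \<mu> *s y) ^^ m) x"
        using gen_eigenspace_eigenvector[OF endo_ad _ x(2)] x(1) by blast
      have iter: "((\<lambda>y. bracket a y - \<mu> *s y) ^^ j) x \<in> M" for j
        by (induction j) (use x(1) invM aS subM in \<open>auto intro: subspace_diff subspace_scale\<close>)
      let ?E = "{w \<in> M. bracket a w = \<mu> *s w}"
      have "?E = M"
      proof (rule minimal)
        show "?E \<noteq> {0}" using m iter by blast
        show "invariant_under S ?E"
          unfolding invariant_under_def
        proof (intro conjI ballI)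
          show "subspace ?E"
            by (rule subspaceI)
              (use subM in \<open>auto simp: subspace_0 subspace_add subspace_scale bracket_add_right
                 bracket_scale_right bracket_0_right scale_right_distrib mult.commute\<close>)
        next
          fix h w assume h: "h \<in> S" and w: "w \<in> ?E"
          have "bracket a (bracket h w) = bracket h (bracket a w) - bracket (bracket h a) w"
            unfolding bracket_derivation[of h a w] by simp
          also have "\<dots> = \<mu> *s bracket h w"
            using w commute[OF h, of w] by (simp add: bracket_scale_right)
          finally show "bracket h w \<in> ?E" using h w invM by auto
        qed
      qed auto
      then show "\<exists>c. \<forall>w\<in>M. bracket a w = c *s w" by blast
    qed
  qed simp
  then have "\<forall>a\<in>S. \<exists>c. \<forall>w\<in>M. bracket a w = c *s w" by simp
  then obtain \<gamma> where "\<forall>a\<in>S. \<forall>w\<in>M. bracket a w = \<gamma> a *s w"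
    using bchoice[of S "\<lambda>a c. \<forall>w\<in>M. bracket a w = c *s w"] by blast
  moreover obtain w where "w \<in> M" "w \<noteq> 0" using M subspace_0[OF subM] by blast
  ultimately show thesis using that M by blast
qed

text \<open>Generalised eigenvectors are used because it is not clear beforehand that a Cartan subalgebra acts
  diagonalisably; this follows once the weight spaces of the roots are known to be lines.\<close>

definition weight_space :: "'g set \<Rightarrow> ('g \<Rightarrow> complex) \<Rightarrow> 'g set" where
  "weight_space S \<gamma> = {x. \<forall>h\<in>S. x \<in> gen_eigenspace (bracket h) (\<gamma> h)}"

lemma subspace_weight_space: "subspace (weight_space S \<gamma>)"
proof -
  have "weight_space S \<gamma> = (\<Inter>h\<in>S. gen_eigenspace (bracket h) (\<gamma> h))"
    by (auto simp: weight_space_def)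
  then show ?thesis
    by (simp add: subspace_Int subspace_gen_eigenspace[OF endo_ad])
qed

lemma bracket_weight_space:
  assumes "x \<in> weight_space S \<alpha>" "y \<in> weight_space S \<gamma>"
  shows "bracket x y \<in> weight_space S (\<lambda>h. \<alpha> h + \<gamma> h)"
  using assms bracket_gen_eigenspace unfolding weight_space_def by auto

lemma nilpotent_subset_weight_space:
  "nilpotent_subalgebra S \<Longrightarrow> S \<subseteq> weight_space S (\<lambda>_. 0)"
  using nilpotent_subset_gen_eigenspace unfolding weight_space_def by auto

lemma invariant_weight_space:
  assumes "nilpotent_subalgebra S"
  shows "invariant_under S (weight_space S \<gamma>)"
  unfolding invariant_under_def
  using bracket_weight_space[of _ S "\<lambda>_. 0" _ \<gamma>] nilpotent_subset_weight_space[OF assms]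
  by (auto simp: subspace_weight_space)

lemma root_space_subset_weight_space: "root_space S \<gamma> \<subseteq> weight_space S \<gamma>"
  by (auto simp: root_space_def weight_space_def intro: eigenvector_in_gen_eigenspace)

lemma subspace_root_space: "subspace (root_space S \<gamma>)"
  by (rule subspaceI)
    (auto simp: root_space_def bracket_0_right bracket_add_right bracket_scale_right
      scale_right_distrib mult.commute)

lemma dual_space_zero: "(\<lambda>_. 0) \<in> dual_space S"
  by (simp add: dual_space_def)

lemma dual_space_diff:
  "\<phi> \<in> dual_space S \<Longrightarrow> \<psi> \<in> dual_space S \<Longrightarrow> (\<lambda>x. \<phi> x - \<psi> x) \<in> dual_space S"
  by (auto simp: dual_space_def algebra_simps)

lemma dual_space_add: "\<phi> \<in> dual_space S \<Longrightarrow> x \<in> S \<Longrightarrow> y \<in> S \<Longrightarrow> \<phi> (x + y) = \<phi> x + \<phi> y"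
  and dual_space_scale: "\<phi> \<in> dual_space S \<Longrightarrow> x \<in> S \<Longrightarrow> \<phi> (c *s x) = c * \<phi> x"
  and dual_space_outside: "\<phi> \<in> dual_space S \<Longrightarrow> x \<notin> S \<Longrightarrow> \<phi> x = 0"
  by (auto simp: dual_space_def)

text \<open>Weights with a non-zero eigenvector are linear, because the action is.\<close>

lemma eigenvector_weight_root:
  assumes S: "subspace S" and w: "w \<noteq> 0" "\<And>h. h \<in> S \<Longrightarrow> bracket h w = \<gamma> h *s w"
    and outside: "\<And>x. x \<notin> S \<Longrightarrow> \<gamma> x = 0"
  shows "\<gamma> \<in> insert (\<lambda>_. 0) (roots S)"
proof -
  have "\<gamma> (x + y) = \<gamma> x + \<gamma> y" if "x \<in> S" "y \<in> S" for x y
  proof -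
    have "\<gamma> (x + y) *s w = (\<gamma> x + \<gamma> y) *s w"
      using w(2)[of "x + y"] w(2) that S by (simp add: bracket_add_left subspace_add scale_left_distrib)
    then show ?thesis using w(1) by simp
  qed
  moreover have "\<gamma> (c *s x) = c * \<gamma> x" if "x \<in> S" for c x
  proof -
    have "\<gamma> (c *s x) *s w = bracket (c *s x) w"
      using w(2)[OF subspace_scale[OF S that]] by simp
    also have "\<dots> = (c * \<gamma> x) *s w"
      using w(2)[OF that] by (simp add: bracket_scale_left)
    finally have "\<gamma> (c *s x) *s w = (c * \<gamma> x) *s w" .
    then show ?thesis using w(1) by simp
  qed
  ultimately have "\<gamma> \<in> dual_space S" using outside by (auto simp: dual_space_def)
  moreover have "w \<in> root_space S \<gamma>" using w(2) by (auto simp: root_space_def)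
  ultimately show ?thesis using w(1) by (auto simp: roots_def)
qed

lemma weight_space_nonzero_root:
  assumes S: "nilpotent_subalgebra S" and "weight_space S \<gamma> \<noteq> {0}"
    and "\<And>x. x \<notin> S \<Longrightarrow> \<gamma> x = 0"
  shows "\<gamma> \<in> insert (\<lambda>_. 0) (roots S)"
proof -
  obtain w \<delta> where w: "w \<in> weight_space S \<gamma>" "w \<noteq> 0" "\<And>h. h \<in> S \<Longrightarrow> bracket h w = \<delta> h *s w"
    using weight_vector_exists[OF S invariant_weight_space[OF S] assms(2)] by blast
  have "bracket h w = \<gamma> h *s w" if h: "h \<in> S" for h
  proof -
    have "w \<in> gen_eigenspace (bracket h) (\<gamma> h)"
      using w(1) h by (simp add: weight_space_def)
    then have "\<delta> h = \<gamma> h"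
      by (rule eigenvector_in_gen_eigenspace_eq[OF endo_ad w(3)[OF h] _ w(2)])
    then show ?thesis using w(3)[OF h] by simp
  qed
  moreover have "subspace S"
    using S unfolding nilpotent_subalgebra_def lie_subalgebra_def by blast
  ultimately show ?thesis using eigenvector_weight_root w(2) assms(3) by blast
qed

text \<open>A vector space over an infinite field is not a finite union of hyperplanes: if \<open>h\<close> avoids the
  kernels in \<open>F\<close> and \<open>\<psi>(k) \<noteq> 0\<close>, all but finitely many \<open>h + t k\<close> avoid the kernel of \<open>\<psi>\<close> as well.\<close>

lemma dual_space_avoid:
  assumes S: "subspace S" and "finite F" "F \<subseteq> dual_space S" "(\<lambda>_. 0) \<notin> F"
  shows "\<exists>h\<in>S. \<forall>\<phi>\<in>F. \<phi> h \<noteq> 0"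
  using assms(2-)
proof (induction F rule: finite_induct)
  case empty
  then show ?case using subspace_0[OF S] by blast
next
  case (insert \<psi> F)
  then obtain h where h: "h \<in> S" "\<forall>\<phi>\<in>F. \<phi> h \<noteq> 0" by auto
  have \<psi>: "\<psi> \<in> dual_space S" "\<psi> \<noteq> (\<lambda>_. 0)" using insert.prems by auto
  then obtain k where "\<psi> k \<noteq> 0" by blast
  then have k: "k \<in> S" "\<psi> k \<noteq> 0" using dual_space_outside[OF \<psi>(1)] by auto
  have "finite ((\<lambda>\<phi>. - \<phi> h / \<phi> k) ` insert \<psi> F)" using insert.hyps by simp
  then obtain t where t: "t \<notin> (\<lambda>\<phi>. - \<phi> h / \<phi> k) ` insert \<psi> F"
    using ex_new_if_finite[OF infinite_UNIV_char_0] by blast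
  have "\<phi> (h + t *s k) \<noteq> 0" if "\<phi> \<in> insert \<psi> F" for \<phi>
  proof
    assume zero: "\<phi> (h + t *s k) = 0"
    have "\<phi> \<in> dual_space S" using that insert.prems by auto
    then have eq: "\<phi> h + t * \<phi> k = 0"
      using zero h k S by (simp add: dual_space_add dual_space_scale subspace_scale)
    show False
    proof (cases "\<phi> k = 0")
      case True
      then show False using eq that h k by auto
    next
      case False
      then have "t = - \<phi> h / \<phi> k" using eq by (simp add: field_simps add_eq_0_iff)
      then show False using t that by blast
    qed
  qed
  then show ?case using h k S by (blast intro: subspace_add subspace_scale)
qed

lemma dual_space_separate:
  assumes S: "subspace S" and F: "finite F" "F \<subseteq> dual_space S"
  obtains h where "h \<in> S" "inj_on (\<lambda>\<phi>. \<phi> h) F"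
proof -
  define D where "D = (\<lambda>p x. fst p x - snd p x) ` {p \<in> F \<times> F. fst p \<noteq> snd p}"
  have D: "(\<lambda>x. \<phi> x - \<psi> x) \<in> D" if "\<phi> \<in> F" "\<psi> \<in> F" "\<phi> \<noteq> \<psi>" for \<phi> \<psi>
    unfolding D_def by (rule image_eqI[of _ _ "(\<phi>, \<psi>)"]) (use that in auto)
  have "finite D" unfolding D_def using F(1) by simp
  moreover have "D \<subseteq> dual_space S"
    unfolding D_def by (rule image_subsetI, rule dual_space_diff) (use F(2) in auto)
  moreover have "(\<lambda>_. 0) \<notin> D"
  proof
    assume "(\<lambda>_. 0) \<in> D"
    then obtain p where p: "p \<in> {p \<in> F \<times> F. fst p \<noteq> snd p}" "(\<lambda>_. 0) = (\<lambda>x. fst p x - snd p x)"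
      unfolding D_def by (elim imageE)
    then have "fst p = snd p" by (simp add: fun_eq_iff)
    then show False using p(1) by simp
  qed
  ultimately obtain h where h: "h \<in> S" "\<forall>\<phi>\<in>D. \<phi> h \<noteq> 0" using dual_space_avoid[OF S] by blast
  have "inj_on (\<lambda>\<phi>. \<phi> h) F"
  proof (rule inj_onI, rule ccontr)
    fix \<phi> \<psi> assume eq: "\<phi> \<in> F" "\<psi> \<in> F" "\<phi> h = \<psi> h" "\<phi> \<noteq> \<psi>"
    show False using bspec[OF h(2) D[OF eq(1,2,4)]] eq(3) by simp
  qed
  then show thesis using that h by blast
qed

text \<open>Finitely many roots are separated by some \<open>h\<close>; their root vectors are then eigenvectors of
  \<open>ad h\<close> for distinct eigenvalues, so there are at most as many of them as the dimension.\<close>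

lemma finite_roots:
  assumes S: "subspace S"
  shows "finite (roots S)"
proof (rule ccontr)
  assume "infinite (roots S)"
  then obtain F where F: "F \<subseteq> roots S" "finite F" "card F = Suc (card Basis)"
    using infinite_arbitrarily_large by blast
  have dual: "F \<subseteq> dual_space S" using F by (auto simp: roots_def)
  obtain h where h: "h \<in> S" "inj_on (\<lambda>\<phi>. \<phi> h) F"
    using dual_space_separate[OF S F(2) dual] by blast
  have "\<exists>x. x \<in> root_space S \<alpha> \<and> x \<noteq> 0" if "\<alpha> \<in> F" for \<alpha>
    using that F subspace_0[OF subspace_root_space] by (auto simp: roots_def)
  then obtain v where v: "\<And>\<alpha>. \<alpha> \<in> F \<Longrightarrow> v \<alpha> \<in> root_space S \<alpha> \<and> v \<alpha> \<noteq> 0"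
    by metis
  have eig: "bracket h (v \<alpha>) = \<alpha> h *s v \<alpha>" if "\<alpha> \<in> F" for \<alpha>
    using v[OF that] h by (auto simp: root_space_def)
  have indep: "u \<alpha> = 0" if u: "(\<Sum>\<alpha>\<in>F. u \<alpha> *s v \<alpha>) = 0" and \<alpha>: "\<alpha> \<in> F" for u \<alpha>
  proof -
    let ?inv = "the_inv_into F (\<lambda>\<phi>. \<phi> h)"
    let ?x = "\<lambda>\<mu>. u (?inv \<mu>) *s v (?inv \<mu>)"
    have inv: "?inv (\<alpha> h) = \<alpha>" if "\<alpha> \<in> F" for \<alpha>
      using the_inv_into_f_f[OF h(2) that] .
    have "(\<Sum>\<mu>\<in>(\<lambda>\<phi>. \<phi> h) ` F. ?x \<mu>) = 0"
      unfolding sum.reindex[OF h(2)] using u inv by (simp cong: sum.cong)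
    moreover have "?x \<mu> \<in> gen_eigenspace (bracket h) \<mu>" if \<mu>: "\<mu> \<in> (\<lambda>\<phi>. \<phi> h) ` F" for \<mu>
    proof -
      obtain \<phi> where \<phi>: "\<phi> \<in> F" "\<mu> = \<phi> h" using \<mu> by blast
      have "v \<phi> \<in> gen_eigenspace (bracket h) \<mu>"
        unfolding \<phi>(2) by (rule eigenvector_in_gen_eigenspace[of "bracket h"]) (rule eig[OF \<phi>(1)])
      then show ?thesis
        using inv[OF \<phi>(1)] \<phi>(2) subspace_scale[OF subspace_gen_eigenspace[OF endo_ad]] by simp
    qed
    ultimately have "\<forall>\<mu>\<in>(\<lambda>\<phi>. \<phi> h) ` F. ?x \<mu> = 0"
      by (intro gen_eigenspace_independent[OF endo_ad]) (use F(2) in auto)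
    then have "u \<alpha> *s v \<alpha> = 0" using \<alpha> inv by force
    then show ?thesis using v[OF \<alpha>] by simp
  qed
  have inj: "inj_on v F"
  proof (rule inj_onI)
    fix \<alpha> \<alpha>' assume a: "\<alpha> \<in> F" "\<alpha>' \<in> F" "v \<alpha> = v \<alpha>'"
    then have "\<alpha> h = \<alpha>' h"
      using eig[OF a(1)] eig[OF a(2)] v[OF a(1)] by simp
    then show "\<alpha> = \<alpha>'" using h(2) a by (auto simp: inj_on_def)
  qed
  have "independent (v ` F)"
  proof -
    have "u (v \<alpha>) = 0" if "(\<Sum>x\<in>v ` F. u x *s x) = 0" "\<alpha> \<in> F" for u \<alpha>
      using indep[of "\<lambda>\<alpha>. u (v \<alpha>)"] that by (simp add: sum.reindex[OF inj])
    then show ?thesis using dependent_finite[of "v ` F"] F(2) by blast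
  qed
  then have "card (v ` F) \<le> card Basis"
    using independent_card_le_dim[of "v ` F" UNIV] by simp
  then show False using F(3) card_image[OF inj] by simp
qed

text \<open>A single element of \<open>S\<close> that separates the weights already has the weight spaces as its
  generalised eigenspaces.\<close>

lemma gen_eigenspace_subset_weight_space:
  assumes S: "nilpotent_subalgebra S" and d: "d \<in> S"
    and inj: "inj_on (\<lambda>\<gamma>. \<gamma> d) (insert (\<lambda>_. 0) (roots S))"
    and nz: "gen_eigenspace (bracket d) \<mu> \<noteq> {0}"
  obtains \<gamma> where "\<gamma> \<in> insert (\<lambda>_. 0) (roots S)" "\<gamma> d = \<mu>"
    "gen_eigenspace (bracket d) \<mu> \<subseteq> weight_space S \<gamma>"
proof -
  let ?G = "gen_eigenspace (bracket d) \<mu>"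
  have subS: "subspace S"
    using S unfolding nilpotent_subalgebra_def lie_subalgebra_def by blast
  have weight: "\<exists>\<gamma>. \<gamma> \<in> insert (\<lambda>_. 0) (roots S) \<and> \<gamma> d = \<mu> \<and> (\<forall>h\<in>S. \<forall>\<nu>. W \<subseteq> gen_eigenspace (bracket h) \<nu> \<longrightarrow> \<gamma> h = \<nu>)"
    if W: "invariant_under S W" "W \<noteq> {0}" "W \<subseteq> ?G" for W
  proof -
    obtain w \<delta> where w: "w \<in> W" "w \<noteq> 0" "\<And>h. h \<in> S \<Longrightarrow> bracket h w = \<delta> h *s w"
      using weight_vector_exists[OF S W(1,2)] by blast
    define \<gamma> where "\<gamma> h = (if h \<in> S then \<delta> h else 0)" for h
    have eig: "bracket h w = \<gamma> h *s w" if "h \<in> S" for h using w(3) that by (simp add: \<gamma>_def)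
    have "\<gamma> \<in> insert (\<lambda>_. 0) (roots S)"
      by (rule eigenvector_weight_root[OF subS w(2) eig]) (auto simp: \<gamma>_def)
    moreover have "\<gamma> h = \<nu>" if "h \<in> S" "W \<subseteq> gen_eigenspace (bracket h) \<nu>" for h \<nu>
      using eigenvector_in_gen_eigenspace_eq[OF endo_ad eig[OF that(1)] _ w(2), of \<nu>] that w(1) by blast
    ultimately show ?thesis using d W(3) by blast
  qed
  have invG: "invariant_under S ?G"
    using invariant_gen_eigenspace[OF S d, of UNIV \<mu>] by (simp add: invariant_under_def)
  obtain \<gamma> where \<gamma>: "\<gamma> \<in> insert (\<lambda>_. 0) (roots S)" "\<gamma> d = \<mu>"
    using weight[OF invG nz] by blast
  have "?G \<subseteq> gen_eigenspace (bracket h) (\<gamma> h)" if h: "h \<in> S" for h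
  proof
    fix x assume "x \<in> ?G"
    then have x: "x \<in> span (\<Union>\<nu>. gen_eigenspace (bracket h) \<nu> \<inter> ?G)"
      by (intro gen_eigenspace_decomposition[OF endo_ad])
        (use invG h in \<open>auto simp: invariant_under_def\<close>)
    have "gen_eigenspace (bracket h) \<nu> \<inter> ?G \<subseteq> gen_eigenspace (bracket h) (\<gamma> h)" for \<nu>
    proof (cases "gen_eigenspace (bracket h) \<nu> \<inter> ?G = {0}")
      case True
      then show ?thesis using subspace_0[OF subspace_gen_eigenspace[OF endo_ad]] by auto
    next
      case False
      then obtain \<gamma>' where \<gamma>': "\<gamma>' \<in> insert (\<lambda>_. 0) (roots S)" "\<gamma>' d = \<mu>" "\<gamma>' h = \<nu>"
        using weight[OF invariant_gen_eigenspace[OF S h invG] False] h by auto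
      then have "\<gamma>' = \<gamma>" by (intro inj_onD[OF inj]) (use \<gamma> \<gamma>' in auto)
      then show ?thesis using \<gamma>'(3) by auto
    qed
    then have "span (\<Union>\<nu>. gen_eigenspace (bracket h) \<nu> \<inter> ?G) \<subseteq> gen_eigenspace (bracket h) (\<gamma> h)"
      by (intro span_minimal subspace_gen_eigenspace[OF endo_ad] UN_least)
    then show "x \<in> gen_eigenspace (bracket h) (\<gamma> h)" using x by (rule subsetD)
  qed
  then show thesis using that[OF \<gamma>] unfolding weight_space_def by blast
qed

theorem weight_space_decomposition:
  assumes S: "nilpotent_subalgebra S"
  shows "direct_family (insert (\<lambda>_. 0) (roots S)) (weight_space S)"
    and "span (\<Union>\<gamma>\<in>insert (\<lambda>_. 0) (roots S). weight_space S \<gamma>) = UNIV"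
proof -
  let ?R = "insert (\<lambda>_. 0) (roots S)"
  have subS: "subspace S"
    using S unfolding nilpotent_subalgebra_def lie_subalgebra_def by blast
  have fin: "finite ?R" using finite_roots[OF subS] by simp
  have "?R \<subseteq> dual_space S" using dual_space_zero by (auto simp: roots_def)
  then obtain d where d: "d \<in> S" "inj_on (\<lambda>\<gamma>. \<gamma> d) ?R"
    using dual_space_separate[OF subS fin] by blast
  show "direct_family ?R (weight_space S)"
    unfolding direct_family_def
  proof (intro allI impI)
    fix x assume x: "\<forall>\<gamma>\<in>?R. x \<gamma> \<in> weight_space S \<gamma>" "(\<Sum>\<gamma>\<in>?R. x \<gamma>) = 0"
    let ?inv = "the_inv_into ?R (\<lambda>\<gamma>. \<gamma> d)"
    have inv: "?inv (\<gamma> d) = \<gamma>" if "\<gamma> \<in> ?R" for \<gamma> using the_inv_into_f_f[OF d(2) that] .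
    have "(\<Sum>\<mu>\<in>(\<lambda>\<gamma>. \<gamma> d) ` ?R. x (?inv \<mu>)) = (\<Sum>\<gamma>\<in>?R. x (?inv (\<gamma> d)))"
      unfolding sum.reindex[OF d(2)] by simp
    also have "\<dots> = 0" unfolding x(2)[symmetric] by (intro sum.cong refl arg_cong[of _ _ x] inv)
    finally have "\<forall>\<mu>\<in>(\<lambda>\<gamma>. \<gamma> d) ` ?R. x (?inv \<mu>) = 0"
    proof (intro gen_eigenspace_independent[OF endo_ad[of d]])
      fix \<mu> assume "\<mu> \<in> (\<lambda>\<gamma>. \<gamma> d) ` ?R"
      then obtain \<gamma> where "\<gamma> \<in> ?R" "\<mu> = \<gamma> d" by blast
      then show "x (?inv \<mu>) \<in> gen_eigenspace (bracket d) \<mu>"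
        using inv x(1) d(1) by (auto simp: weight_space_def)
    qed (use fin in auto)
    then show "\<forall>\<gamma>\<in>?R. x \<gamma> = 0" using inv by force
  qed
  have "gen_eigenspace (bracket d) \<mu> \<subseteq> span (\<Union>\<gamma>\<in>?R. weight_space S \<gamma>)" for \<mu>
  proof (cases "gen_eigenspace (bracket d) \<mu> = {0}")
    case True
    then show ?thesis by (simp add: span_zero)
  next
    case False
    then obtain \<gamma> where \<gamma>: "\<gamma> \<in> ?R" "gen_eigenspace (bracket d) \<mu> \<subseteq> weight_space S \<gamma>"
      by (rule gen_eigenspace_subset_weight_space[OF S d])
    then have "gen_eigenspace (bracket d) \<mu> \<subseteq> (\<Union>\<gamma>\<in>?R. weight_space S \<gamma>)" by blast
    then show ?thesis using span_superset by (rule order_trans)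
  qed
  moreover have "x \<in> span (\<Union>\<mu>. gen_eigenspace (bracket d) \<mu> \<inter> UNIV)" for x
    by (rule gen_eigenspace_decomposition[OF endo_ad]) auto
  ultimately show "span (\<Union>\<gamma>\<in>?R. weight_space S \<gamma>) = UNIV"
    using span_minimal[of "\<Union>\<mu>. gen_eigenspace (bracket d) \<mu> \<inter> UNIV" "span (\<Union>\<gamma>\<in>?R. weight_space S \<gamma>)"]
    by auto
qed

text \<open>\<open>S\<close> acts nilpotently on its zero weight space. If that were larger than \<open>S\<close>, a minimal
  invariant subspace \<open>M\<close> strictly above \<open>S\<close> would be moved into \<open>S\<close> by every term of the lower
  central series, by descending induction, and would therefore normalise \<open>S\<close>.\<close>

theorem cartan_weight_space_zero:
  assumes "cartan_subalgebra S"
  shows "weight_space S (\<lambda>_. 0) = S"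
proof (rule ccontr)
  assume neq: "weight_space S (\<lambda>_. 0) \<noteq> S"
  have S: "nilpotent_subalgebra S" and norm: "normalizer S = S"
    using assms unfolding cartan_subalgebra_def by auto
  have S': "lie_subalgebra S" using S unfolding nilpotent_subalgebra_def by blast
  then have subS: "subspace S" and brS: "\<And>x y. x \<in> S \<Longrightarrow> y \<in> S \<Longrightarrow> bracket x y \<in> S"
    unfolding lie_subalgebra_def by auto
  let ?P = "\<lambda>M. invariant_under S M \<and> S \<subseteq> M \<and> M \<subseteq> weight_space S (\<lambda>_. 0) \<and> M \<noteq> S"
  have "?P (weight_space S (\<lambda>_. 0))"
    using neq invariant_weight_space[OF S] nilpotent_subset_weight_space[OF S] by blast
  then obtain M where M: "?P M" and least: "\<And>M'. ?P M' \<Longrightarrow> dim M \<le> dim M'"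
    using ex_has_least_nat[of ?P _ dim] by metis
  have subM: "subspace M" and invM: "\<And>h w. h \<in> S \<Longrightarrow> w \<in> M \<Longrightarrow> bracket h w \<in> M"
    using M unfolding invariant_under_def by auto
  obtain n where n: "lower_central S n = {0}"
    using S unfolding nilpotent_subalgebra_def by blast
  have "\<forall>a\<in>lower_central S 0. \<forall>w\<in>M. bracket a w \<in> S"
  proof (rule inc_induct[of 0 n])
    show "\<forall>a\<in>lower_central S n. \<forall>w\<in>M. bracket a w \<in> S"
      unfolding n by (auto simp: bracket_0_left subspace_0[OF subS])
  next
    fix k
    assume IH: "\<forall>a\<in>lower_central S (Suc k). \<forall>w\<in>M. bracket a w \<in> S"
    show "\<forall>a\<in>lower_central S k. \<forall>w\<in>M. bracket a w \<in> S"
    proof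
      fix a assume a: "a \<in> lower_central S k"
      then have aS: "a \<in> S" using lower_central_subset[OF S'] by blast
      let ?A = "{w \<in> M. bracket a w \<in> S}"
      have subA: "subspace ?A"
        by (rule subspaceI)
          (use subM subS in \<open>auto simp: subspace_0 subspace_add subspace_scale bracket_add_right
             bracket_scale_right bracket_0_right\<close>)
      have "bracket h w \<in> ?A" if h: "h \<in> S" and w: "w \<in> ?A" for h w
      proof -
        have "bracket h a \<in> lower_central S (Suc k)"
          using h a by (auto intro!: span_base)
        then have "bracket (bracket h a) w \<in> S" using IH w by blast
        moreover have "bracket a (bracket h w) = bracket h (bracket a w) - bracket (bracket h a) w"
          unfolding bracket_derivation[of h a w] by simp
        ultimately show ?thesis using w h invM brS subS by (auto intro: subspace_diff)
      qed
      then have inv: "invariant_under S ?A" using subA unfolding invariant_under_def by blast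
      obtain x where x: "x \<in> M" "x \<notin> S" using M by blast
      then have "x \<in> gen_eigenspace (bracket a) 0" using M aS by (auto simp: weight_space_def)
      then obtain m where "(bracket a ^^ m) x = 0" by (auto simp: gen_eigenspace_def)
      then have "(bracket a ^^ m) x \<in> S" using subspace_0[OF subS] by simp
      then obtain j where j: "(bracket a ^^ j) x \<notin> S" "(bracket a ^^ Suc j) x \<in> S"
        using ex_least_nat_less[of "\<lambda>m. (bracket a ^^ m) x \<in> S" m] x(2) by auto
      have "(bracket a ^^ i) x \<in> M" for i
        by (induction i) (use x invM aS in auto)
      then have "?A \<noteq> S" using j by auto
      moreover have "S \<subseteq> ?A" using M aS brS by auto
      ultimately have "dim M \<le> dim ?A" using least[of ?A] inv M by auto
      then have "?A = M" using subspace_dim_equal[OF subA subM] by auto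
      then show "\<forall>w\<in>M. bracket a w \<in> S" by blast
    qed
  qed simp
  then have moved: "bracket y x \<in> S" if "y \<in> S" "x \<in> M" for x y using that by simp
  have "bracket x y \<in> S" if "x \<in> M" "y \<in> S" for x y
    unfolding bracket_anti[of x y] by (rule subspace_neg[OF subS moved[OF that(2,1)]])
  then have "M \<subseteq> normalizer S" unfolding normalizer_def by blast
  then show False using M norm by blast
qed

end

section \<open>The Killing form\<close>

lemma (in complex_vector_space) direct_family_mono:
  assumes "direct_family I W" "finite I" "J \<subseteq> I"
    and "\<And>j. j \<in> J \<Longrightarrow> W' j \<subseteq> W j" "\<And>i. i \<in> I \<Longrightarrow> subspace (W i)"
  shows "direct_family J W'"
  unfolding direct_family_def
proof (intro allI impI)
  fix x assume x: "\<forall>j\<in>J. x j \<in> W' j" "(\<Sum>j\<in>J. x j) = 0"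
  let ?y = "\<lambda>i. if i \<in> J then x i else 0"
  have "(\<Sum>i\<in>I. ?y i) = (\<Sum>j\<in>J. x j)"
    by (rule sum.mono_neutral_cong_right[OF assms(2,3)]) auto
  moreover have "\<forall>i\<in>I. ?y i \<in> W i" using x(1) assms(4,5) by (auto intro: subspace_0)
  ultimately have "\<forall>i\<in>I. ?y i = 0"
    using assms(1) x(2) unfolding direct_family_def by (elim allE[of _ ?y]) simp
  then show "\<forall>j\<in>J. x j = 0" using assms(3) by (metis subsetD)
qed

lemma (in complex_vector_space) endo_span_subset:
  assumes "endo T" "\<And>x. x \<in> A \<Longrightarrow> T x \<in> U" "subspace U" "x \<in> span A"
  shows "T x \<in> U"
  using assms(4)
proof (induction rule: span_induct_alt)
  case base
  then show ?case using assms(3) by (simp add: endo_0[OF assms(1)] subspace_0)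
next
  case (step c x y)
  then show ?case
    using assms(2,3) by (simp add: endo_add[OF assms(1)] endo_scale[OF assms(1)] subspace_add subspace_scale)
qed

context lie_algebra
begin

lemma endo_bracket2: "endo (\<lambda>z. bracket x (bracket y z))"
  by (rule endoI) (simp_all add: bracket_add_right bracket_scale_right)

lemma killing_trace: "killing x y = trace_on UNIV (\<lambda>z. bracket x (bracket y z))"
  using trace_on_eq_basis_trace[OF independent_Basis span_Basis endo_bracket2]
  by (simp add: killing_def endo_trace_def basis_trace_def)

lemma killing_commute: "killing x y = killing y x"
  unfolding killing_trace by (rule trace_on_commute[OF subspace_UNIV endo_ad endo_ad]) auto

lemma killing_linear_left: "killing (x + a *s y) z = killing x z + a * killing y z"
  unfolding killing_trace bracket_add_left bracket_scale_left
  by (rule trace_on_linear[OF subspace_UNIV endo_bracket2 endo_bracket2]) auto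

lemma killing_add_left: "killing (x + y) z = killing x z + killing y z"
  using killing_linear_left[of x 1 y z] by simp

lemma killing_0_left: "killing 0 z = 0"
  using killing_add_left[of 0 0 z] by simp

lemma killing_scale_left: "killing (a *s y) z = a * killing y z"
  using killing_linear_left[of 0 a y z] by (simp add: killing_0_left)

lemma killing_add_right: "killing z (x + y) = killing z x + killing z y"
  and killing_scale_right: "killing z (a *s y) = a * killing z y"
  and killing_0_right: "killing z 0 = 0"
  using killing_add_left killing_scale_left killing_0_left by (simp_all add: killing_commute[of z])

lemma killing_invariant: "killing (bracket x y) z = killing x (bracket y z)"
proof -
  let ?tr = "trace_on UNIV"
  let ?xyz = "\<lambda>u. bracket x (bracket y (bracket z u))"
  let ?yxz = "\<lambda>u. bracket y (bracket x (bracket z u))"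
  let ?xzy = "\<lambda>u. bracket x (bracket z (bracket y u))"
  have endo3: "endo (\<lambda>u. bracket a (bracket b (bracket c u)))" for a b c
    by (rule endoI) (simp_all add: bracket_add_right bracket_scale_right)
  have "(\<lambda>u. bracket (bracket x y) (bracket z u)) = (\<lambda>u. ?xyz u + (-1) *s ?yxz u)"
    by (rule ext) (simp add: bracket_derivation[of x y])
  then have "killing (bracket x y) z = ?tr ?xyz + (-1) * ?tr ?yxz"
    unfolding killing_trace using trace_on_linear[OF subspace_UNIV endo3 endo3, where a="-1"] by simp
  also have "?tr ?yxz = ?tr ?xzy"
    by (rule trace_on_commute[OF subspace_UNIV endo_ad endo_bracket2]) auto
  finally have 1: "killing (bracket x y) z = ?tr ?xyz + (-1) * ?tr ?xzy" .
  have "(\<lambda>u. bracket x (bracket (bracket y z) u)) = (\<lambda>u. ?xyz u + (-1) *s ?xzy u)"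
    by (rule ext) (simp add: bracket_derivation[of y z] bracket_add_right)
  then have "killing x (bracket y z) = ?tr ?xyz + (-1) * ?tr ?xzy"
    unfolding killing_trace using trace_on_linear[OF subspace_UNIV endo3 endo3, where a="-1"] by simp
  then show ?thesis using 1 by simp
qed

text \<open>Invariance gives \<open>(\<mu> + \<nu>) \<langle>x | y\<rangle> = - \<langle>(ad d - \<mu>) x | y\<rangle> - \<langle>x | (ad d - \<nu>) y\<rangle>\<close>, and the
  right-hand side vanishes by induction on the orders of nilpotency.\<close>

lemma killing_gen_eigenspaces:
  assumes "x \<in> gen_eigenspace (bracket d) \<mu>" "y \<in> gen_eigenspace (bracket d) \<nu>" "\<mu> + \<nu> \<noteq> 0"
  shows "killing x y = 0"
proof -
  define M where "M = (\<lambda>z. bracket d z - \<mu> *s z)"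
  define N where "N = (\<lambda>z. bracket d z - \<nu> *s z)"
  have shift: "(\<mu> + \<nu>) * killing x y = - (killing (M x) y + killing x (N y))" for x y
  proof -
    have "killing (bracket d x) y = - killing x (bracket d y)"
      using killing_invariant[of x d y] killing_scale_left[of "-1" "bracket x d" y] bracket_anti[of d x]
      by simp
    moreover have "killing (bracket d x) y = killing (M x) y + \<mu> * killing x y"
      using killing_linear_left[of "M x" \<mu> x y] by (simp add: M_def)
    moreover have "killing x (bracket d y) = killing x (N y) + \<nu> * killing x y"
      using killing_add_right[of x "N y" "\<nu> *s y"] by (simp add: N_def killing_scale_right)
    ultimately show ?thesis by (simp add: algebra_simps)
  qed
  have "killing x y = 0" if "(M ^^ m) x = 0" "(N ^^ n) y = 0" for m n x y
    using that
  proof (induction "m + n" arbitrary: m n x y)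
    case 0
    then show ?case by (simp add: killing_0_left)
  next
    case (Suc k)
    show ?case
    proof (cases "m = 0 \<or> n = 0")
      case True
      then show ?thesis
        using Suc.prems by (auto simp: killing_0_left killing_0_right)
    next
      case False
      then obtain m' n' where mn: "m = Suc m'" "n = Suc n'" by (metis not0_implies_Suc)
      have "killing (M x) y = 0"
        by (rule Suc.hyps(1)[of m' n]) (use Suc.hyps(2) Suc.prems mn in \<open>auto simp: funpow_Suc_right simp del: funpow.simps\<close>)
      moreover have "killing x (N y) = 0"
        by (rule Suc.hyps(1)[of m n']) (use Suc.hyps(2) Suc.prems mn in \<open>auto simp: funpow_Suc_right simp del: funpow.simps\<close>)
      ultimately show ?thesis using shift[of x y] assms(3) by simp
    qed
  qed
  then show ?thesis
    using assms(1,2) unfolding gen_eigenspace_def M_def N_def by blast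
qed

text \<open>\<open>T\<^sup>2 - a\<^sup>2 = (T - a)\<^sup>2 + 2 a (T - a)\<close> is a multiple of \<open>T - a\<close>.\<close>

lemma gen_eigenspace_square:
  assumes T: "endo T"
  shows "gen_eigenspace T a \<subseteq> gen_eigenspace (\<lambda>z. T (T z)) (a\<^sup>2)"
proof
  fix x assume "x \<in> gen_eigenspace T a"
  define N where "N = (\<lambda>z. T z - a *s z)"
  define Q where "Q = (\<lambda>z. T (T z) - a\<^sup>2 *s z)"
  have N: "endo (N ^^ k)" for k unfolding N_def by (intro endo_funpow endo_shift T)
  have Q: "Q x = N (N x) + (2 * a) *s N x" for x
  proof -
    have "N (N x) = T (T x) - a *s T x - a *s (T x - a *s x)"
      by (simp add: N_def endo_diff[OF T] endo_scale[OF T])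
    moreover have "(2 * a) *s N x = a *s N x + a *s N x"
      by (simp only: mult_2 scale_left_distrib)
    ultimately show ?thesis
      by (simp add: Q_def N_def scale_right_diff_distrib power2_eq_square)
  qed
  obtain n where "(N ^^ n) x = 0"
    using \<open>x \<in> gen_eigenspace T a\<close> by (auto simp: gen_eigenspace_def N_def)
  then have "(Q ^^ n) x = 0"
  proof (induction n arbitrary: x)
    case (Suc n)
    have "(N ^^ n) (N x) = 0" using Suc.prems by (simp add: funpow_Suc_right del: funpow.simps)
    moreover have "(N ^^ n) (N (N x)) = N ((N ^^ n) (N x))" by (rule funpow_swap1[symmetric])
    ultimately have "(N ^^ n) (Q x) = 0"
      using endo_0[OF N[of 1]] by (simp add: Q endo_add[OF N] endo_scale[OF N])
    then show ?case using Suc.IH[of "Q x"] by (simp add: funpow_Suc_right del: funpow.simps)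
  qed simp
  then show "x \<in> gen_eigenspace (\<lambda>z. T (T z)) (a\<^sup>2)"
    by (auto simp: gen_eigenspace_def Q_def)
qed

text \<open>On a weight space \<open>(ad h)\<^sup>2\<close> has the single eigenvalue \<open>\<gamma>(h)\<^sup>2\<close>. The case of two different
  elements, whose actions on a weight space need not commute, follows by polarisation.\<close>

lemma killing_weight_sum:
  assumes S: "nilpotent_subalgebra S" and g: "g \<in> S" and h: "h \<in> S"
  shows "killing g h = (\<Sum>\<gamma>\<in>insert (\<lambda>_. 0) (roots S). \<gamma> g * \<gamma> h * of_nat (dim (weight_space S \<gamma>)))"
proof -
  let ?R = "insert (\<lambda>_. 0) (roots S)"
  have subS: "subspace S"
    using S unfolding nilpotent_subalgebra_def lie_subalgebra_def by blast
  have inv: "bracket k x \<in> weight_space S \<gamma>" if "k \<in> S" "x \<in> weight_space S \<gamma>" for k x \<gamma>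
    using invariant_weight_space[OF S] that by (auto simp: invariant_under_def)
  have square: "killing k k = (\<Sum>\<gamma>\<in>?R. (\<gamma> k)\<^sup>2 * of_nat (dim (weight_space S \<gamma>)))" if k: "k \<in> S" for k
  proof -
    have "trace_on (span (\<Union>\<gamma>\<in>?R. weight_space S \<gamma>)) (\<lambda>z. bracket k (bracket k z)) =
        (\<Sum>\<gamma>\<in>?R. (\<gamma> k)\<^sup>2 * of_nat (dim (weight_space S \<gamma>)))"
    proof (rule trace_on_gen_eigenspaces)
      show "weight_space S \<gamma> \<subseteq> gen_eigenspace (\<lambda>z. bracket k (bracket k z)) ((\<gamma> k)\<^sup>2)" for \<gamma>
        using gen_eigenspace_square[OF endo_ad] k by (auto simp: weight_space_def)
    qed (use finite_roots[OF subS] weight_space_decomposition(1)[OF S] subspace_weight_space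
        endo_bracket2 inv k in auto)
    then show ?thesis by (simp only: weight_space_decomposition(2)[OF S] killing_trace)
  qed
  have "2 * killing g h = killing (g + h) (g + h) - killing g g - killing h h"
    by (simp add: killing_add_left killing_add_right killing_commute[of h g])
  also have "\<dots> = (\<Sum>\<gamma>\<in>?R. ((\<gamma> (g + h))\<^sup>2 - (\<gamma> g)\<^sup>2 - (\<gamma> h)\<^sup>2) * of_nat (dim (weight_space S \<gamma>)))"
    using square[OF g] square[OF h] square[OF subspace_add[OF subS g h]]
    by (simp only: sum_subtractf left_diff_distrib)
  also have "\<dots> = (\<Sum>\<gamma>\<in>?R. 2 * (\<gamma> g * \<gamma> h * of_nat (dim (weight_space S \<gamma>))))"
  proof (intro sum.cong refl)
    fix \<gamma> assume "\<gamma> \<in> ?R"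
    then have "\<gamma> \<in> dual_space S" using dual_space_zero by (auto simp: roots_def)
    then have "\<gamma> (g + h) = \<gamma> g + \<gamma> h" using g h by (rule dual_space_add)
    then show "((\<gamma> (g + h))\<^sup>2 - (\<gamma> g)\<^sup>2 - (\<gamma> h)\<^sup>2) * of_nat (dim (weight_space S \<gamma>)) =
        2 * (\<gamma> g * \<gamma> h * of_nat (dim (weight_space S \<gamma>)))"
      by (simp add: power2_eq_square algebra_simps)
  qed
  also have "\<dots> = 2 * (\<Sum>\<gamma>\<in>?R. \<gamma> g * \<gamma> h * of_nat (dim (weight_space S \<gamma>)))"
    by (rule sum_distrib_left[symmetric])
  finally show ?thesis by simp
qed

lemma dual_space_sum:
  assumes "\<phi> \<in> dual_space S" "subspace S" "\<And>i. i \<in> I \<Longrightarrow> x i \<in> S"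
  shows "\<phi> (\<Sum>i\<in>I. c i *s x i) = (\<Sum>i\<in>I. c i * \<phi> (x i))"
  using assms(3)
proof (induction I rule: infinite_finite_induct)
  case (insert i I)
  then have "(\<Sum>i\<in>I. c i *s x i) \<in> S" using assms(2) by (auto intro!: subspace_sum subspace_scale)
  then show ?case
    using insert assms(1,2) by (simp add: dual_space_add dual_space_scale subspace_scale)
qed (use dual_space_scale[OF assms(1) subspace_0[OF assms(2)], of 0] in auto)

text \<open>Induction on \<open>D\<close>. By the induction hypothesis \<open>D\<close> has a dual system \<open>d\<close>; as \<open>\<phi>\<close> is not a
  combination of \<open>D\<close>, there is a vector \<open>k\<close> in the common kernel of \<open>D\<close> with \<open>\<phi>(k) \<noteq> 0\<close>, by which the
  value of \<open>\<phi>\<close> can be adjusted.\<close>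

lemma dual_space_prescribed_values:
  assumes S: "subspace S" and "finite D" "D \<subseteq> dual_space S"
    and "\<And>c. (\<And>x. (\<Sum>\<delta>\<in>D. c \<delta> * \<delta> x) = 0) \<Longrightarrow> \<forall>\<delta>\<in>D. c \<delta> = 0"
  shows "\<exists>h\<in>S. \<forall>\<delta>\<in>D. \<delta> h = v \<delta>"
  using assms(2-)
proof (induction D arbitrary: v rule: finite_induct)
  case empty
  then show ?case using subspace_0[OF S] by blast
next
  case (insert \<phi> D)
  have dual: "D \<subseteq> dual_space S" and \<phi>: "\<phi> \<in> dual_space S" using insert.prems(1) by auto
  have IH: "\<exists>h\<in>S. \<forall>\<delta>\<in>D. \<delta> h = v \<delta>" for v
  proof (rule insert.IH[OF dual])
    fix c assume c: "\<And>x. (\<Sum>\<delta>\<in>D. c \<delta> * \<delta> x) = 0"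
    let ?c = "\<lambda>\<delta>. if \<delta> = \<phi> then 0 else c \<delta>"
    have "(\<Sum>\<delta>\<in>insert \<phi> D. ?c \<delta> * \<delta> x) = (\<Sum>\<delta>\<in>D. c \<delta> * \<delta> x)" for x
    proof -
      have "(\<Sum>\<delta>\<in>D. ?c \<delta> * \<delta> x) = (\<Sum>\<delta>\<in>D. c \<delta> * \<delta> x)"
        by (rule sum.cong) (use insert.hyps in auto)
      then show ?thesis using insert.hyps by simp
    qed
    then have "\<forall>\<delta>\<in>insert \<phi> D. ?c \<delta> = 0" using c by (intro insert.prems(2)) simp
    then show "\<forall>\<delta>\<in>D. c \<delta> = 0" using insert.hyps(2) by (metis insertCI)
  qed
  have "\<exists>d. d \<in> S \<and> (\<forall>\<delta>'\<in>D. \<delta>' d = (if \<delta>' = \<delta> then 1 else 0))" for \<delta>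
    using IH[of "\<lambda>\<delta>'. if \<delta>' = \<delta> then 1 else 0"] by blast
  then obtain d where dS: "\<And>\<delta>. d \<delta> \<in> S"
    and d: "\<And>\<delta> \<delta>'. \<delta>' \<in> D \<Longrightarrow> \<delta>' (d \<delta>) = (if \<delta>' = \<delta> then 1 else 0)"
    by metis
  have comb: "\<delta>' (\<Sum>\<delta>\<in>D. c \<delta> *s d \<delta>) = c \<delta>'" if "\<delta>' \<in> D" for \<delta>' c
  proof -
    have "\<delta>' (\<Sum>\<delta>\<in>D. c \<delta> *s d \<delta>) = (\<Sum>\<delta>\<in>D. c \<delta> * \<delta>' (d \<delta>))"
      by (rule dual_space_sum[OF _ S]) (use that dual dS in auto)
    also have "\<dots> = c \<delta>'"
      using that insert.hyps by (simp add: d if_distrib[of "\<lambda>z. _ * z"] cong: if_cong)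
    finally show ?thesis .
  qed
  have combS: "(\<Sum>\<delta>\<in>D. c \<delta> *s d \<delta>) \<in> S" for c
    using S dS by (auto intro!: subspace_sum subspace_scale)
  have "\<exists>x. \<phi> x \<noteq> (\<Sum>\<delta>\<in>D. \<phi> (d \<delta>) * \<delta> x)"
  proof (rule ccontr)
    assume "\<not> ?thesis"
    then have *: "\<phi> x = (\<Sum>\<delta>\<in>D. \<phi> (d \<delta>) * \<delta> x)" for x by blast
    let ?c = "\<lambda>\<delta>. if \<delta> = \<phi> then 1 else - \<phi> (d \<delta>)"
    have "(\<Sum>\<delta>\<in>insert \<phi> D. ?c \<delta> * \<delta> x) = 0" for x
    proof -
      have "(\<Sum>\<delta>\<in>D. ?c \<delta> * \<delta> x) = - (\<Sum>\<delta>\<in>D. \<phi> (d \<delta>) * \<delta> x)"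
        unfolding sum_negf[symmetric] by (rule sum.cong) (use insert.hyps in auto)
      then show ?thesis using insert.hyps *[of x] by simp
    qed
    then have "\<forall>\<delta>\<in>insert \<phi> D. ?c \<delta> = 0" by (rule insert.prems(2))
    then show False by simp
  qed
  then obtain x where x: "\<phi> x \<noteq> (\<Sum>\<delta>\<in>D. \<phi> (d \<delta>) * \<delta> x)" by blast
  have xS: "x \<in> S"
  proof (rule ccontr)
    assume "x \<notin> S"
    then have zero: "\<delta> x = 0" if "\<delta> \<in> D" for \<delta>
      using that dual_space_outside dual by blast
    have "(\<Sum>\<delta>\<in>D. \<phi> (d \<delta>) * \<delta> x) = 0" by (rule sum.neutral) (simp add: zero)
    moreover have "\<phi> x = 0" using \<open>x \<notin> S\<close> dual_space_outside[OF \<phi>] by blast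
    ultimately show False using x by simp
  qed
  define k where "k = x - (\<Sum>\<delta>\<in>D. \<delta> x *s d \<delta>)"
  have kS: "k \<in> S" unfolding k_def using S xS combS by (intro subspace_diff)
  have eval: "\<psi> x = \<psi> k + \<psi> (\<Sum>\<delta>\<in>D. \<delta> x *s d \<delta>)" if "\<psi> \<in> dual_space S" for \<psi>
    using dual_space_add[OF that kS combS, of "\<lambda>\<delta>. \<delta> x"] by (simp add: k_def)
  have kD: "\<delta> k = 0" if "\<delta> \<in> D" for \<delta>
    using eval[of \<delta>] comb[OF that] that dual by auto
  have "\<phi> (\<Sum>\<delta>\<in>D. \<delta> x *s d \<delta>) = (\<Sum>\<delta>\<in>D. \<phi> (d \<delta>) * \<delta> x)"
    using dual_space_sum[OF \<phi> S, of D d] dS by (simp add: mult.commute)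
  then have k\<phi>: "\<phi> k \<noteq> 0" using eval[OF \<phi>] x by auto
  define g where "g = (\<Sum>\<delta>\<in>D. v \<delta> *s d \<delta>)"
  have gS: "g \<in> S" unfolding g_def by (rule combS)
  have "\<delta> (g + ((v \<phi> - \<phi> g) / \<phi> k) *s k) = v \<delta>" if "\<delta> \<in> insert \<phi> D" for \<delta>
  proof -
    have "\<delta> \<in> dual_space S" using that \<phi> dual by auto
    then have "\<delta> (g + ((v \<phi> - \<phi> g) / \<phi> k) *s k) = \<delta> g + ((v \<phi> - \<phi> g) / \<phi> k) * \<delta> k"
      using gS kS S by (simp add: dual_space_add dual_space_scale subspace_scale)
    then show ?thesis
      using that k\<phi> kD comb[of \<delta> v] by (auto simp: g_def)
  qed
  moreover have "g + ((v \<phi> - \<phi> g) / \<phi> k) *s k \<in> S"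
    using gS kS S by (intro subspace_add subspace_scale)
  ultimately show ?case by blast
qed

end

section \<open>Root space decomposition\<close>

context kostant_toda
begin

abbreviation weights :: "('g \<Rightarrow> complex) set" where
  "weights \<equiv> insert (\<lambda>_. 0) (roots \<hh>)"

lemma nilpotent_cartan: "nilpotent_subalgebra \<hh>"
  using cartan by (simp add: cartan_subalgebra_def)

lemma subspace_cartan: "subspace \<hh>"
  using nilpotent_cartan unfolding nilpotent_subalgebra_def lie_subalgebra_def by blast

lemma weight_space_zero: "weight_space \<hh> (\<lambda>_. 0) = \<hh>"
  by (rule cartan_weight_space_zero[OF cartan])

lemma finite_weights: "finite weights"
  using finite_roots[OF subspace_cartan] by simp

lemma weights_dual: "\<gamma> \<in> weights \<Longrightarrow> \<gamma> \<in> dual_space \<hh>"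
  using dual_space_zero by (auto simp: roots_def)

lemma root_outside: "\<gamma> \<in> weights \<Longrightarrow> x \<notin> \<hh> \<Longrightarrow> \<gamma> x = 0"
  by (rule dual_space_outside[OF weights_dual])

lemma root_nonzero: "\<alpha> \<in> roots \<hh> \<Longrightarrow> \<alpha> \<noteq> (\<lambda>_. 0)"
  by (simp add: roots_def)

lemma root_vector_weight:
  assumes "\<alpha> \<in> roots \<hh>"
  shows "e \<alpha> \<in> weight_space \<hh> \<alpha>" "e \<alpha> \<noteq> 0" "\<And>h. h \<in> \<hh> \<Longrightarrow> bracket h (e \<alpha>) = \<alpha> h *s e \<alpha>"
  using root_vector[OF assms] root_space_subset_weight_space by (auto simp: root_space_def)

lemma dim_weight_space_pos:
  assumes "\<alpha> \<in> roots \<hh>"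
  shows "dim (weight_space \<hh> \<alpha>) > 0"
proof -
  have "\<not> weight_space \<hh> \<alpha> \<subseteq> {0}" using root_vector_weight[OF assms] by blast
  then show ?thesis using dim_eq_0 by blast
qed

lemma weight_space_nonzero_weight:
  "weight_space \<hh> \<gamma> \<noteq> {0} \<Longrightarrow> (\<And>x. x \<notin> \<hh> \<Longrightarrow> \<gamma> x = 0) \<Longrightarrow> \<gamma> \<in> weights"
  by (rule weight_space_nonzero_root[OF nilpotent_cartan])

text \<open>Evaluation at an element on which all simple roots are \<open>1\<close> computes the length of a root.\<close>

definition grading_element :: 'g where
  "grading_element = (SOME h. h \<in> \<hh> \<and> (\<forall>\<delta>\<in>\<Delta>. \<delta> h = 1))"

lemma grading_element: "grading_element \<in> \<hh>" "\<delta> \<in> \<Delta> \<Longrightarrow> \<delta> grading_element = 1"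
proof -
  have \<Delta>: "finite \<Delta>" "\<Delta> \<subseteq> dual_space \<hh>"
    using base by (auto simp: root_base_def roots_def)
  have "(\<And>x. (\<Sum>\<delta>\<in>\<Delta>. c \<delta> * \<delta> x) = 0) \<Longrightarrow> \<forall>\<delta>\<in>\<Delta>. c \<delta> = 0" for c
    using base unfolding root_base_def by blast
  then have "\<exists>h\<in>\<hh>. \<forall>\<delta>\<in>\<Delta>. \<delta> h = 1"
    by (rule dual_space_prescribed_values[OF subspace_cartan \<Delta>])
  then have "\<exists>h. h \<in> \<hh> \<and> (\<forall>\<delta>\<in>\<Delta>. \<delta> h = 1)" by blast
  then have "grading_element \<in> \<hh> \<and> (\<forall>\<delta>\<in>\<Delta>. \<delta> grading_element = 1)"
    unfolding grading_element_def by (rule someI_ex)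
  then show "grading_element \<in> \<hh>" "\<delta> \<in> \<Delta> \<Longrightarrow> \<delta> grading_element = 1" by auto
qed

lemma combination_grading_element:
  assumes "\<alpha> = (\<lambda>x. \<Sum>\<delta>\<in>\<Delta>. of_int (a \<delta>) * \<delta> x)"
  shows "\<alpha> grading_element = of_int (\<Sum>\<delta>\<in>\<Delta>. a \<delta>)"
  unfolding assms of_int_sum by (rule sum.cong) (simp_all add: grading_element(2))

lemma root_combination:
  assumes "\<alpha> \<in> roots \<hh>"
  obtains a :: "('g \<Rightarrow> complex) \<Rightarrow> int"
  where "\<alpha> = (\<lambda>x. \<Sum>\<delta>\<in>\<Delta>. of_int (a \<delta>) * \<delta> x)" "(\<Sum>\<delta>\<in>\<Delta>. a \<delta>) \<noteq> 0"
proof -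
  obtain n :: "('g \<Rightarrow> complex) \<Rightarrow> nat" where n:
    "\<alpha> = (\<lambda>x. \<Sum>\<delta>\<in>\<Delta>. of_nat (n \<delta>) * \<delta> x) \<or> \<alpha> = (\<lambda>x. - (\<Sum>\<delta>\<in>\<Delta>. of_nat (n \<delta>) * \<delta> x))"
    using base assms unfolding root_base_def by blast
  have fin: "finite \<Delta>" using base by (simp add: root_base_def)
  have nz: "(\<Sum>\<delta>\<in>\<Delta>. n \<delta>) \<noteq> 0"
  proof
    assume "(\<Sum>\<delta>\<in>\<Delta>. n \<delta>) = 0"
    then have "(\<Sum>\<delta>\<in>\<Delta>. of_nat (n \<delta>) * \<delta> x) = 0" for x using fin by (intro sum.neutral) simp
    then show False using n root_nonzero[OF assms] by auto
  qed
  from n show thesis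
  proof
    assume "\<alpha> = (\<lambda>x. \<Sum>\<delta>\<in>\<Delta>. of_nat (n \<delta>) * \<delta> x)"
    then show thesis using that[of "\<lambda>\<delta>. int (n \<delta>)"] nz by (simp flip: of_nat_sum)
  next
    assume "\<alpha> = (\<lambda>x. - (\<Sum>\<delta>\<in>\<Delta>. of_nat (n \<delta>) * \<delta> x))"
    then show thesis using that[of "\<lambda>\<delta>. - int (n \<delta>)"] nz by (simp add: sum_negf flip: of_nat_sum)
  qed
qed

lemma root_length_grading:
  assumes "\<alpha> \<in> roots \<hh>"
  shows "\<alpha> grading_element = of_int (root_length \<Delta> \<alpha>)" "root_length \<Delta> \<alpha> \<noteq> 0"
proof -
  obtain a where a: "\<alpha> = (\<lambda>x. \<Sum>\<delta>\<in>\<Delta>. of_int (a \<delta>) * \<delta> x)" "(\<Sum>\<delta>\<in>\<Delta>. a \<delta>) \<noteq> 0"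
    using root_combination[OF assms] .
  have "root_length \<Delta> \<alpha> = (\<Sum>\<delta>\<in>\<Delta>. a \<delta>)"
    unfolding root_length_def
  proof (rule the_equality)
    show "\<exists>a' :: _ \<Rightarrow> int. \<alpha> = (\<lambda>x. \<Sum>\<delta>\<in>\<Delta>. of_int (a' \<delta>) * \<delta> x) \<and> (\<Sum>\<delta>\<in>\<Delta>. a \<delta>) = (\<Sum>\<delta>\<in>\<Delta>. a' \<delta>)"
      using a(1) by blast
  next
    fix n assume "\<exists>a :: _ \<Rightarrow> int. \<alpha> = (\<lambda>x. \<Sum>\<delta>\<in>\<Delta>. of_int (a \<delta>) * \<delta> x) \<and> n = (\<Sum>\<delta>\<in>\<Delta>. a \<delta>)"
    then obtain a' :: "_ \<Rightarrow> int" where "\<alpha> = (\<lambda>x. \<Sum>\<delta>\<in>\<Delta>. of_int (a' \<delta>) * \<delta> x)" "n = (\<Sum>\<delta>\<in>\<Delta>. a' \<delta>)"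
      by blast
    then have "(of_int n :: complex) = of_int (\<Sum>\<delta>\<in>\<Delta>. a \<delta>)"
      using combination_grading_element a(1) by metis
    then show "n = (\<Sum>\<delta>\<in>\<Delta>. a \<delta>)" by (simp only: of_int_eq_iff)
  qed
  then show "\<alpha> grading_element = of_int (root_length \<Delta> \<alpha>)" "root_length \<Delta> \<alpha> \<noteq> 0"
    using combination_grading_element[OF a(1)] a(2) by simp_all
qed

lemma root_grading_nonzero: "\<alpha> \<in> roots \<hh> \<Longrightarrow> \<alpha> grading_element \<noteq> 0"
  by (simp add: root_length_grading)

text \<open>The grading element has integer eigenvalues, not all zero, so its Killing square is a
  positive integer.\<close>

lemma killing_nonzero: "killing grading_element grading_element \<noteq> 0"
proof -
  let ?n = "\<lambda>\<gamma>. if \<gamma> = (\<lambda>_. 0) then 0 else root_length \<Delta> \<gamma>"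
  let ?m = "\<lambda>\<gamma>. (?n \<gamma>)\<^sup>2 * int (dim (weight_space \<hh> \<gamma>))"
  have n: "\<gamma> grading_element = of_int (?n \<gamma>)" if "\<gamma> \<in> weights" for \<gamma>
    using that root_length_grading(1) by auto
  have eq: "killing grading_element grading_element = of_int (\<Sum>\<gamma>\<in>weights. ?m \<gamma>)"
    unfolding killing_weight_sum[OF nilpotent_cartan grading_element(1) grading_element(1)] of_int_sum
    by (rule sum.cong) (simp_all only: n of_int_mult of_int_power of_int_of_nat_eq power2_eq_square)
  have pos: "(\<Sum>\<gamma>\<in>weights. ?m \<gamma>) > 0"
  proof (rule sum_pos2[OF finite_weights])
    show "\<beta> \<in> weights" using longest_root(1) by simp
    show "0 < ?m \<beta>"
      using root_nonzero[OF longest_root(1)] root_length_grading(2)[OF longest_root(1)]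
        dim_weight_space_pos[OF longest_root(1)] by simp
  qed simp
  show ?thesis
    unfolding eq of_int_eq_0_iff using pos by (rule less_imp_neq[THEN not_sym])
qed

text \<open>The radical of the Killing form is an ideal, and it is proper by the previous lemma.\<close>

theorem killing_nondegenerate:
  assumes "\<And>y. killing x y = 0"
  shows "x = 0"
proof -
  let ?I = "{x. \<forall>y. killing x y = 0}"
  have "lie_ideal ?I"
    unfolding lie_ideal_def
  proof (intro conjI allI ballI)
    show "subspace ?I"
      by (rule subspaceI) (auto simp: killing_0_left killing_add_left killing_scale_left)
  next
    fix z x assume x: "x \<in> ?I"
    have "killing (bracket z x) y = 0" for y
    proof -
      have "killing (bracket z x) y = (-1) * killing (bracket x z) y"
        using killing_scale_left[of "-1" "bracket x z" y] bracket_anti[of z x] by simp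
      then show ?thesis using x by (simp add: killing_invariant)
    qed
    then show "bracket z x \<in> ?I" by simp
  qed
  moreover have "?I \<noteq> UNIV" using killing_nonzero by blast
  ultimately have "?I = {0}" using no_proper_ideal by blast
  then show ?thesis using assms by blast
qed

lemma killing_weight_spaces:
  assumes "x \<in> weight_space \<hh> \<gamma>" "y \<in> weight_space \<hh> \<gamma>'" "h \<in> \<hh>" "\<gamma> h + \<gamma>' h \<noteq> 0"
  shows "killing x y = 0"
  using assms killing_gen_eigenspaces unfolding weight_space_def by blast

text \<open>\<open>x\<close> is orthogonal to all weight spaces except the one of \<open>-\<gamma>\<close>, so it cannot be orthogonal to
  that one too.\<close>

lemma killing_dual_weight_space:
  assumes x: "x \<in> weight_space \<hh> \<gamma>" "x \<noteq> 0" and \<gamma>: "\<gamma> \<in> weights"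
  obtains y where "y \<in> weight_space \<hh> (\<lambda>h. - \<gamma> h)" "killing x y \<noteq> 0"
proof (rule ccontr)
  note witness = that
  assume "\<not> thesis"
  then have zero: "killing x y = 0" if "y \<in> weight_space \<hh> (\<lambda>h. - \<gamma> h)" for y
    using witness[OF that] by blast
  have sub: "subspace {y. killing x y = 0}"
    by (rule subspaceI) (auto simp: killing_0_right killing_add_right killing_scale_right)
  have "weight_space \<hh> \<gamma>' \<subseteq> {y. killing x y = 0}" if "\<gamma>' \<in> weights" for \<gamma>'
  proof (cases "\<gamma>' = (\<lambda>h. - \<gamma> h)")
    case True
    then show ?thesis using zero by blast
  next
    case False
    then obtain h where h: "\<gamma>' h \<noteq> - \<gamma> h" by blast
    then have "h \<in> \<hh>"
      using root_outside[OF \<gamma>, of h] root_outside[OF that, of h] by force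
    moreover have "\<gamma> h + \<gamma>' h \<noteq> 0" using h by (simp add: add_eq_0_iff)
    ultimately show ?thesis
      using killing_weight_spaces[OF x(1)] by blast
  qed
  then have "span (\<Union>\<gamma>\<in>weights. weight_space \<hh> \<gamma>) \<subseteq> {y. killing x y = 0}"
    by (intro span_minimal sub UN_least)
  then have "killing x y = 0" for y
    unfolding weight_space_decomposition(2)[OF nilpotent_cartan] by blast
  then show False using killing_nondegenerate x(2) by blast
qed

lemma minus_root:
  assumes "\<alpha> \<in> roots \<hh>"
  shows "(\<lambda>h. - \<alpha> h) \<in> roots \<hh>"
proof -
  have \<alpha>: "\<alpha> \<in> weights" using assms by simp
  obtain y where "y \<in> weight_space \<hh> (\<lambda>h. - \<alpha> h)" "killing (e \<alpha>) y \<noteq> 0"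
    using killing_dual_weight_space[OF root_vector_weight(1,2)[OF assms] \<alpha>] .
  then have "weight_space \<hh> (\<lambda>h. - \<alpha> h) \<noteq> {0}" using killing_0_right by auto
  then have "(\<lambda>h. - \<alpha> h) \<in> weights"
    by (rule weight_space_nonzero_weight) (simp add: root_outside[OF \<alpha>])
  moreover have "(\<lambda>h. - \<alpha> h) \<noteq> (\<lambda>_. 0)"
    using root_nonzero[OF assms] by (auto simp: fun_eq_iff)
  ultimately show ?thesis by blast
qed

lemma root_length_minus:
  assumes "\<alpha> \<in> roots \<hh>"
  shows "root_length \<Delta> (\<lambda>h. - \<alpha> h) = - root_length \<Delta> \<alpha>"
proof -
  have "(of_int (root_length \<Delta> (\<lambda>h. - \<alpha> h)) :: complex) = of_int (- root_length \<Delta> \<alpha>)"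
    using root_length_grading(1)[OF assms] root_length_grading(1)[OF minus_root[OF assms]] by simp
  then show ?thesis by (simp only: of_int_eq_iff)
qed

text \<open>Here \<open>U\<close> assigns to each weight in \<open>J\<close> a subspace of its weight space. If their sum is stable under
  \<open>x\<close> and \<open>y\<close>, the trace of \<open>[x, y]\<close> on it vanishes, as the trace of a commutator; on the other hand
  it can be read off from the weights.\<close>

lemma weight_trace_zero:
  assumes J: "J \<subseteq> weights" and sub: "\<And>\<gamma>. \<gamma> \<in> J \<Longrightarrow> subspace (U \<gamma>)"
    and UW: "\<And>\<gamma>. \<gamma> \<in> J \<Longrightarrow> U \<gamma> \<subseteq> weight_space \<hh> \<gamma>"
    and U: "\<And>\<gamma> u. \<gamma> \<in> J \<Longrightarrow> u \<in> U \<gamma> \<Longrightarrow> bracket x u \<in> span (\<Union>\<gamma>\<in>J. U \<gamma>)"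
      "\<And>\<gamma> u. \<gamma> \<in> J \<Longrightarrow> u \<in> U \<gamma> \<Longrightarrow> bracket y u \<in> span (\<Union>\<gamma>\<in>J. U \<gamma>)"
    and t: "bracket x y \<in> \<hh>" "\<And>\<gamma> u. \<gamma> \<in> J \<Longrightarrow> u \<in> U \<gamma> \<Longrightarrow> bracket (bracket x y) u \<in> U \<gamma>"
  shows "(\<Sum>\<gamma>\<in>J. \<gamma> (bracket x y) * of_nat (dim (U \<gamma>))) = 0"
proof -
  let ?U = "span (\<Union>\<gamma>\<in>J. U \<gamma>)"
  have stable: "bracket z u \<in> ?U" if "\<And>\<gamma> u. \<gamma> \<in> J \<Longrightarrow> u \<in> U \<gamma> \<Longrightarrow> bracket z u \<in> ?U" "u \<in> ?U" for z u
    by (rule endo_span_subset[OF endo_ad _ subspace_span that(2)]) (use that(1) in blast)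
  have "trace_on ?U (bracket (bracket x y)) = 0"
    by (rule trace_on_bracket[OF subspace_span]) (use stable U in blast)+
  moreover have "trace_on ?U (bracket (bracket x y)) = (\<Sum>\<gamma>\<in>J. \<gamma> (bracket x y) * of_nat (dim (U \<gamma>)))"
  proof (rule trace_on_gen_eigenspaces)
    show "finite J" using J finite_weights by (rule finite_subset)
    show "direct_family J U"
      by (rule direct_family_mono[OF weight_space_decomposition(1)[OF nilpotent_cartan] finite_weights J UW
            subspace_weight_space])
    show "U \<gamma> \<subseteq> gen_eigenspace (bracket (bracket x y)) (\<gamma> (bracket x y))" if "\<gamma> \<in> J" for \<gamma>
      using UW[OF that] t(1) by (auto simp: weight_space_def)
  qed (use sub endo_ad t(2) in auto)
  ultimately show ?thesis by simp
qed

lemma cartan_stable_weight_space: "h \<in> \<hh> \<Longrightarrow> u \<in> weight_space \<hh> \<gamma> \<Longrightarrow> bracket h u \<in> weight_space \<hh> \<gamma>"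
  using invariant_weight_space[OF nilpotent_cartan] by (auto simp: invariant_under_def)

text \<open>Weight spaces of functionals other than \<open>0\<close> and the roots vanish, so stability of a sum of weight
  spaces has to be checked for the weights only.\<close>

lemma bracket_in_weight_sum:
  assumes "x \<in> weight_space \<hh> \<alpha>" "u \<in> weight_space \<hh> \<gamma>" "\<alpha> \<in> weights" "\<gamma> \<in> weights"
    and "(\<lambda>h. \<alpha> h + \<gamma> h) \<in> weights \<Longrightarrow> weight_space \<hh> (\<lambda>h. \<alpha> h + \<gamma> h) \<subseteq> U" and "subspace U"
  shows "bracket x u \<in> U"
proof -
  have xu: "bracket x u \<in> weight_space \<hh> (\<lambda>h. \<alpha> h + \<gamma> h)"
    by (rule bracket_weight_space[OF assms(1,2)])
  show ?thesis
  proof (cases "weight_space \<hh> (\<lambda>h. \<alpha> h + \<gamma> h) = {0}")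
    case True
    then show ?thesis using xu subspace_0[OF assms(6)] by simp
  next
    case False
    then have "(\<lambda>h. \<alpha> h + \<gamma> h) \<in> weights"
      by (rule weight_space_nonzero_weight) (simp add: root_outside[OF assms(3)] root_outside[OF assms(4)])
    then show ?thesis using xu assms(5) by blast
  qed
qed

text \<open>If \<open>\<alpha>(t) = 0\<close> for \<open>t = [e\<^sub>\<alpha>, y]\<close>, the trace of \<open>t\<close> on the \<open>\<alpha>\<close>-string through \<open>\<gamma>\<close> is a positive
  multiple of \<open>\<gamma>(t)\<close>, so every root vanishes at \<open>t\<close> and \<open>t\<close> is orthogonal to the Cartan
  subalgebra.\<close>

lemma root_coroot_nonzero:
  assumes \<alpha>: "\<alpha> \<in> roots \<hh>" and y: "y \<in> weight_space \<hh> (\<lambda>h. - \<alpha> h)" "killing (e \<alpha>) y \<noteq> 0"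
  shows "bracket (e \<alpha>) y \<in> \<hh>" "\<alpha> (bracket (e \<alpha>) y) \<noteq> 0"
proof -
  let ?t = "bracket (e \<alpha>) y"
  note e = root_vector_weight[OF \<alpha>]
  have w: "\<alpha> \<in> weights" "(\<lambda>h. - \<alpha> h) \<in> weights" using \<alpha> minus_root[OF \<alpha>] by auto
  show t: "?t \<in> \<hh>"
    using bracket_weight_space[OF e(1) y(1)] by (simp only: add.right_inverse weight_space_zero)
  show "\<alpha> ?t \<noteq> 0"
  proof
    assume zero: "\<alpha> ?t = 0"
    have "\<gamma> ?t = 0" if \<gamma>: "\<gamma> \<in> roots \<hh>" for \<gamma>
    proof -
      let ?J = "{\<gamma>' \<in> weights. \<exists>k::int. \<gamma>' = (\<lambda>h. \<gamma> h + of_int k * \<alpha> h)}"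
      let ?U = "span (\<Union>\<gamma>\<in>?J. weight_space \<hh> \<gamma>)"
      have sub: "weight_space \<hh> \<gamma>' \<subseteq> ?U" if "\<gamma>' \<in> ?J" for \<gamma>'
        by (rule order_trans[OF UN_upper[OF that] span_superset])
      have shift: "(\<lambda>h. s * \<alpha> h + \<gamma>' h) \<in> weights \<Longrightarrow> weight_space \<hh> (\<lambda>h. s * \<alpha> h + \<gamma>' h) \<subseteq> ?U"
        if mem: "\<gamma>' \<in> ?J" and s: "s = of_int j" for \<gamma>' s and j :: int
      proof (rule sub)
        assume wt: "(\<lambda>h. s * \<alpha> h + \<gamma>' h) \<in> weights"
        obtain k :: int where "\<gamma>' = (\<lambda>h. \<gamma> h + of_int k * \<alpha> h)" using mem by blast
        then have "(\<lambda>h. s * \<alpha> h + \<gamma>' h) = (\<lambda>h. \<gamma> h + of_int (j + k) * \<alpha> h)"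
          unfolding s by (simp add: algebra_simps)
        then show "(\<lambda>h. s * \<alpha> h + \<gamma>' h) \<in> ?J" using wt by blast
      qed
      have "(\<Sum>\<gamma>'\<in>?J. \<gamma>' ?t * of_nat (dim (weight_space \<hh> \<gamma>'))) = 0"
      proof (rule weight_trace_zero)
        fix \<gamma>' u assume *: "\<gamma>' \<in> ?J" "u \<in> weight_space \<hh> \<gamma>'"
        then have w': "\<gamma>' \<in> weights" by blast
        show "bracket (e \<alpha>) u \<in> ?U"
          by (rule bracket_in_weight_sum[OF e(1) *(2) w(1) w' _ subspace_span])
            (use shift[OF *(1), of 1 1] in simp)
        show "bracket y u \<in> ?U"
          by (rule bracket_in_weight_sum[OF y(1) *(2) w(2) w' _ subspace_span])
            (use shift[OF *(1), of "-1" "-1"] in simp)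
        show "bracket ?t u \<in> weight_space \<hh> \<gamma>'"
          by (rule cartan_stable_weight_space[OF t *(2)])
      qed (use t subspace_weight_space in auto)
      moreover define s where "s = (\<Sum>\<gamma>'\<in>?J. dim (weight_space \<hh> \<gamma>'))"
      moreover have "(\<Sum>\<gamma>'\<in>?J. \<gamma>' ?t * of_nat (dim (weight_space \<hh> \<gamma>'))) = \<gamma> ?t * of_nat s"
        unfolding s_def of_nat_sum sum_distrib_left by (rule sum.cong) (use zero in auto)
      moreover have "s > 0"
        unfolding s_def
      proof (rule sum_pos2[of _ \<gamma>])
        show "finite ?J" using finite_weights by simp
        show "\<gamma> \<in> ?J" using \<gamma> by (auto intro: exI[of _ 0])
      qed (use dim_weight_space_pos[OF \<gamma>] in auto)
      ultimately have "\<gamma> ?t * of_nat s = 0" "s \<noteq> 0" by (simp_all only: neq0_conv)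
      then show ?thesis by simp
    qed
    then have "killing ?t grading_element = 0"
      unfolding killing_weight_sum[OF nilpotent_cartan t grading_element(1)]
      by (intro sum.neutral) auto
    moreover have "killing ?t grading_element = \<alpha> grading_element * killing (e \<alpha>) y"
    proof -
      have "killing ?t grading_element = killing (bracket grading_element (e \<alpha>)) y"
        unfolding killing_commute[of ?t] by (rule killing_invariant[symmetric])
      then show ?thesis using e(3)[OF grading_element(1)] by (simp add: killing_scale_left)
    qed
    ultimately show False using root_grading_nonzero[OF \<alpha>] y(2) by simp
  qed
qed

text \<open>The trace of \<open>t = [e\<^sub>\<alpha>, y]\<close> on the sum of the line through \<open>e\<^sub>\<alpha>\<close> and the weight spaces of
  \<open>-k \<alpha>\<close>, \<open>k \<ge> 0\<close>, vanishes; it equals \<open>\<alpha>(t)\<close> times \<open>1 - \<Sum> k dim\<close>, so the weight space of \<open>-\<alpha>\<close> is a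
  line.\<close>

lemma dim_minus_root_space:
  assumes \<alpha>: "\<alpha> \<in> roots \<hh>"
  shows "dim (weight_space \<hh> (\<lambda>h. - \<alpha> h)) = 1"
proof -
  note e = root_vector_weight[OF \<alpha>]
  have w: "\<alpha> \<in> weights" "(\<lambda>h. - \<alpha> h) \<in> weights" using \<alpha> minus_root[OF \<alpha>] by auto
  obtain y where y: "y \<in> weight_space \<hh> (\<lambda>h. - \<alpha> h)" "killing (e \<alpha>) y \<noteq> 0"
    using killing_dual_weight_space[OF e(1,2) w(1)] .
  let ?t = "bracket (e \<alpha>) y"
  note t = root_coroot_nonzero[OF \<alpha> y]
  let ?h = grading_element
  define m where "m k = (\<lambda>h. - (of_nat k * \<alpha> h))" for k :: nat
  define I where "I = {\<gamma> \<in> weights. \<exists>k. \<gamma> = m k}"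
  define J where "J = insert \<alpha> I"
  define U where "U \<gamma> = (if \<gamma> = \<alpha> then span {e \<alpha>} else weight_space \<hh> \<gamma>)" for \<gamma>
  let ?V = "span (\<Union>\<gamma>\<in>J. U \<gamma>)"
  have notI: "\<alpha> \<noteq> m k" for k
  proof
    assume "\<alpha> = m k"
    then have "\<alpha> ?h = - (of_nat k * \<alpha> ?h)" unfolding m_def by metis
    then have "\<alpha> ?h + of_nat k * \<alpha> ?h = 0" by (simp only: eq_neg_iff_add_eq_0)
    then have "of_nat (Suc k) * \<alpha> ?h = 0" by (simp add: distrib_right)
    then show False using root_grading_nonzero[OF \<alpha>] by (simp del: of_nat_Suc)
  qed
  have \<alpha>I: "\<alpha> \<notin> I" using notI by (auto simp: I_def)
  have UI: "U \<gamma> = weight_space \<hh> \<gamma>" if "\<gamma> \<in> I" for \<gamma> using that \<alpha>I by (auto simp: U_def)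
  have m: "weight_space \<hh> (m k) \<subseteq> ?V" if "m k \<in> weights" for k
  proof -
    have "m k \<in> I" using that unfolding I_def by blast
    then have "U (m k) \<subseteq> (\<Union>\<gamma>\<in>J. U \<gamma>)" unfolding J_def by blast
    then show ?thesis using UI[OF \<open>m k \<in> I\<close>] span_superset by (metis order_trans)
  qed
  have eV: "e \<alpha> \<in> ?V" by (rule span_base) (auto simp: J_def U_def intro: span_base)
  have m0: "m 0 = (\<lambda>_. 0)" by (simp add: m_def)
  have hV: "\<hh> \<subseteq> ?V" using m[of 0] by (simp only: m0 weight_space_zero insertI1)
  have U_cases: "(\<exists>c. u = c *s e \<alpha>) \<or> (\<exists>k. \<gamma> = m k \<and> m k \<in> weights \<and> u \<in> weight_space \<hh> (m k))"
    if "\<gamma> \<in> J" "u \<in> U \<gamma>" for \<gamma> u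
    using that notI by (auto simp: J_def I_def U_def span_singleton split: if_splits)
  have "(\<Sum>\<gamma>\<in>J. \<gamma> ?t * of_nat (dim (U \<gamma>))) = 0"
  proof (rule weight_trace_zero)
    show "J \<subseteq> weights" using w by (auto simp: J_def I_def)
    show "subspace (U \<gamma>)" for \<gamma> by (simp add: U_def subspace_weight_space)
    show "U \<gamma> \<subseteq> weight_space \<hh> \<gamma>" for \<gamma>
      using e(1) by (simp add: U_def span_minimal subspace_weight_space)
    show "?t \<in> \<hh>" by (rule t)
    show "bracket ?t u \<in> U \<gamma>" if u: "\<gamma> \<in> J" "u \<in> U \<gamma>" for \<gamma> u
    proof (cases "\<gamma> = \<alpha>")
      case True
      then obtain c where "u = c *s e \<alpha>" using u(2) by (auto simp: U_def span_singleton)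
      then show ?thesis
        using True e(3)[OF t(1)] by (simp add: U_def bracket_scale_right span_scale span_base)
    next
      case False
      then show ?thesis using u(2) cartan_stable_weight_space[OF t(1)] by (simp add: U_def)
    qed
  next
    fix \<gamma> u assume *: "\<gamma> \<in> J" "u \<in> U \<gamma>"
    show "bracket (e \<alpha>) u \<in> ?V"
      using U_cases[OF *]
    proof (elim disjE exE conjE)
      fix c assume "u = c *s e \<alpha>"
      then show ?thesis by (simp add: bracket_scale_right bracket_self span_zero)
    next
      fix k assume k: "m k \<in> weights" "u \<in> weight_space \<hh> (m k)"
      show ?thesis
      proof (cases k)
        case 0
        then have "u \<in> \<hh>" using k(2) by (simp only: m0 weight_space_zero)
        then have "bracket (e \<alpha>) u = (- \<alpha> u) *s e \<alpha>"
          using e(3)[of u] bracket_anti[of "e \<alpha>" u] by simp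
        then show ?thesis using eV by (simp only: span_scale)
      next
        case (Suc j)
        then have eq: "(\<lambda>h. \<alpha> h + m k h) = m j" by (simp add: m_def fun_eq_iff algebra_simps)
        show ?thesis
          by (rule bracket_in_weight_sum[OF e(1) k(2) w(1) k(1) _ subspace_span]) (simp only: eq m)
      qed
    qed
    show "bracket y u \<in> ?V"
      using U_cases[OF *]
    proof (elim disjE exE conjE)
      fix c assume "u = c *s e \<alpha>"
      then have "bracket y u = (- c) *s ?t"
        using bracket_anti[of y "e \<alpha>"] by (simp add: bracket_scale_right)
      then show ?thesis using t(1) hV by (auto intro: span_neg span_scale)
    next
      fix k assume k: "m k \<in> weights" "u \<in> weight_space \<hh> (m k)"
      have eq: "(\<lambda>h. - \<alpha> h + m k h) = m (Suc k)" by (simp add: m_def fun_eq_iff algebra_simps)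
      show ?thesis
        by (rule bracket_in_weight_sum[OF y(1) k(2) w(2) k(1) _ subspace_span]) (simp only: eq m)
    qed
  qed
  moreover have finI: "finite I" unfolding I_def using finite_weights by simp
  moreover have "dim (U \<alpha>) = 1"
    using e(2) dim_span[of "{e \<alpha>}"] by (simp add: U_def)
  ultimately have trace: "\<alpha> ?t + (\<Sum>\<gamma>\<in>I. \<gamma> ?t * of_nat (dim (weight_space \<hh> \<gamma>))) = 0"
    using \<alpha>I by (simp add: J_def UI cong: sum.cong)
  have "\<forall>\<gamma>\<in>I. \<exists>k. \<gamma> = m k" by (simp add: I_def)
  then obtain k where k: "\<And>\<gamma>. \<gamma> \<in> I \<Longrightarrow> \<gamma> = m (k \<gamma>)" by metis
  let ?s = "\<Sum>\<gamma>\<in>I. k \<gamma> * dim (weight_space \<hh> \<gamma>)"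
  have "(\<Sum>\<gamma>\<in>I. \<gamma> ?t * of_nat (dim (weight_space \<hh> \<gamma>))) = - (\<alpha> ?t * of_nat ?s)"
    unfolding of_nat_sum sum_distrib_left sum_negf[symmetric]
  proof (rule sum.cong[OF refl])
    fix \<gamma> assume "\<gamma> \<in> I"
    then have "\<gamma> ?t = - (of_nat (k \<gamma>) * \<alpha> ?t)" using k[of \<gamma>] unfolding m_def by metis
    then show "\<gamma> ?t * of_nat (dim (weight_space \<hh> \<gamma>)) = - (\<alpha> ?t * of_nat (k \<gamma> * dim (weight_space \<hh> \<gamma>)))"
      by simp
  qed
  then have "\<alpha> ?t * (1 - of_nat ?s) = 0" using trace by (simp add: algebra_simps)
  then have "(of_nat ?s :: complex) = of_nat 1" using t(2) by simp
  then have s: "?s = 1" by (simp only: of_nat_eq_iff)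
  \<comment> \<open>The root \<open>-\<alpha>\<close> contributes its dimension to the sum \<open>1\<close> of non-negative terms.\<close>
  have m1: "m 1 = (\<lambda>h. - \<alpha> h)" by (simp add: m_def)
  have "m 1 \<in> I" using w(2) by (auto simp: I_def m1[symmetric])
  have "k (m 1) = 1"
  proof -
    have "m 1 ?h = m (k (m 1)) ?h" using k[OF \<open>m 1 \<in> I\<close>] by simp
    then have "(of_nat (k (m 1)) :: complex) = of_nat 1"
      using root_grading_nonzero[OF \<alpha>] by (simp add: m_def)
    then show ?thesis by (simp only: of_nat_eq_iff)
  qed
  then have "dim (weight_space \<hh> (m 1)) \<le> ?s"
    using member_le_sum[OF \<open>m 1 \<in> I\<close> _ finI, of "\<lambda>\<gamma>. k \<gamma> * dim (weight_space \<hh> \<gamma>)"] by simp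
  then show ?thesis
    using s dim_weight_space_pos[OF minus_root[OF \<alpha>]] unfolding m1 by linarith
qed

theorem weight_space_root:
  assumes "\<alpha> \<in> roots \<hh>"
  shows "weight_space \<hh> \<alpha> = span {e \<alpha>}"
proof -
  have "dim (weight_space \<hh> \<alpha>) = 1"
    using dim_minus_root_space[OF minus_root[OF assms]] by simp
  moreover have "dim (span {e \<alpha>}) = 1"
    using root_vector_weight(2)[OF assms] dim_span[of "{e \<alpha>}"] by simp
  moreover have "span {e \<alpha>} \<subseteq> weight_space \<hh> \<alpha>"
    using root_vector_weight(1)[OF assms] by (simp add: span_minimal subspace_weight_space)
  ultimately show ?thesis
    by (metis order_refl subspace_dim_equal subspace_span subspace_weight_space)
qed

end

section \<open>Bracket and form of the loop algebra\<close>

lemma loop_sum_single: "(\<Sum>k\<in>Poly_Mapping.keys x. Poly_Mapping.single k (Poly_Mapping.lookup x k)) = x"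
  by (rule poly_mapping_eqI) (simp add: lookup_sum lookup_single when_def in_keys_iff)

lemma loop_induct [case_names single add]:
  assumes single: "\<And>k a. P (Poly_Mapping.single k a)" and add: "\<And>x y. P x \<Longrightarrow> P y \<Longrightarrow> P (x + y)"
  shows "P (x :: 'g::ab_group_add loop)"
proof -
  have "P (\<Sum>k\<in>K. Poly_Mapping.single k (Poly_Mapping.lookup x k))" if "finite K" for K
    using that
  proof (induction K)
    case empty
    show ?case using single[of 0 0] by simp
  next
    case (insert k K)
    then show ?case using add[OF single insert.IH] by simp
  qed
  from this[OF finite_keys[of x]] show ?thesis by (simp only: loop_sum_single)
qed

context lie_algebra
begin

lemma loop_bracket_superset:
  assumes "finite I" "Poly_Mapping.keys x \<subseteq> I" "finite J" "Poly_Mapping.keys y \<subseteq> J"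
  shows "loop_bracket x y = (\<Sum>i\<in>I. \<Sum>j\<in>J.
     Poly_Mapping.single (i + j) (bracket (Poly_Mapping.lookup x i) (Poly_Mapping.lookup y j)))"
proof -
  have "loop_bracket x y = (\<Sum>i\<in>Poly_Mapping.keys x. \<Sum>j\<in>J.
     Poly_Mapping.single (i + j) (bracket (Poly_Mapping.lookup x i) (Poly_Mapping.lookup y j)))"
    unfolding loop_bracket_def
    by (intro sum.cong refl sum.mono_neutral_left assms) (auto simp: in_keys_iff bracket_0_right)
  also have "\<dots> = (\<Sum>i\<in>I. \<Sum>j\<in>J.
     Poly_Mapping.single (i + j) (bracket (Poly_Mapping.lookup x i) (Poly_Mapping.lookup y j)))"
    by (intro sum.mono_neutral_left assms) (auto simp: in_keys_iff bracket_0_left)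
  finally show ?thesis .
qed

lemma loop_bracket_add_left: "loop_bracket (x + x') y = loop_bracket x y + loop_bracket x' y"
proof -
  let ?I = "Poly_Mapping.keys x \<union> Poly_Mapping.keys x'"
  have *: "loop_bracket z y = (\<Sum>i\<in>?I. \<Sum>j\<in>Poly_Mapping.keys y.
      Poly_Mapping.single (i + j) (bracket (Poly_Mapping.lookup z i) (Poly_Mapping.lookup y j)))"
    if "Poly_Mapping.keys z \<subseteq> ?I" for z
    by (rule loop_bracket_superset) (use that in auto)
  show ?thesis
    unfolding *[OF keys_add] *[OF Un_upper1] *[OF Un_upper2] lookup_add bracket_add_left single_add sum.distrib ..
qed

lemma loop_bracket_add_right: "loop_bracket y (x + x') = loop_bracket y x + loop_bracket y x'"
proof -
  let ?I = "Poly_Mapping.keys x \<union> Poly_Mapping.keys x'"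
  have *: "loop_bracket y z = (\<Sum>i\<in>Poly_Mapping.keys y. \<Sum>j\<in>?I.
      Poly_Mapping.single (i + j) (bracket (Poly_Mapping.lookup y i) (Poly_Mapping.lookup z j)))"
    if "Poly_Mapping.keys z \<subseteq> ?I" for z
    by (rule loop_bracket_superset) (use that in auto)
  show ?thesis
    unfolding *[OF keys_add] *[OF Un_upper1] *[OF Un_upper2] lookup_add bracket_add_right single_add sum.distrib ..
qed

lemma loop_bracket_single:
  "loop_bracket (Poly_Mapping.single i a) (Poly_Mapping.single j b) = Poly_Mapping.single (i + j) (bracket a b)"
  by (subst loop_bracket_superset[of "{i}" _ "{j}"]) auto

lemma loop_bracket_diff_left: "loop_bracket (x - x') y = loop_bracket x y - loop_bracket x' y"
  using loop_bracket_add_left[of "x - x'" x' y] by simp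

lemma loop_bracket_anti: "loop_bracket x y = - loop_bracket y x"
proof (induction x rule: loop_induct)
  case (single k a)
  show ?case
  proof (induction y rule: loop_induct)
    case (single j b)
    show ?case
      using bracket_anti[of a b] by (simp add: loop_bracket_single single_uminus add.commute)
  qed (simp add: loop_bracket_add_left loop_bracket_add_right)
qed (simp add: loop_bracket_add_left loop_bracket_add_right)

lemma loop_bracket_self: "loop_bracket x x = 0"
proof -
  have "loop_bracket x x + loop_bracket x x = 0"
    using loop_bracket_anti[of x x] by (simp only: eq_neg_iff_add_eq_0)
  then have "loop_scale 2 (loop_bracket x x) = 0"
    using loop.scale_left_distrib[of 1 1 "loop_bracket x x"] by simp
  then show ?thesis by simp
qed

lemma loop_form_superset:
  assumes "finite K" "Poly_Mapping.keys x \<subseteq> K"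
  shows "loop_form x y = (\<Sum>k\<in>K. killing (Poly_Mapping.lookup x k) (Poly_Mapping.lookup y (- k)))"
  unfolding loop_form_def
  by (intro sum.mono_neutral_left assms) (auto simp: in_keys_iff killing_0_left)

lemma loop_form_add_left: "loop_form (x + x') y = loop_form x y + loop_form x' y"
proof -
  let ?I = "Poly_Mapping.keys x \<union> Poly_Mapping.keys x'"
  have *: "loop_form z y = (\<Sum>k\<in>?I. killing (Poly_Mapping.lookup z k) (Poly_Mapping.lookup y (- k)))"
    if "Poly_Mapping.keys z \<subseteq> ?I" for z
    by (rule loop_form_superset) (use that in auto)
  show ?thesis
    unfolding *[OF keys_add] *[OF Un_upper1] *[OF Un_upper2] lookup_add killing_add_left sum.distrib ..
qed

lemma loop_form_add_right: "loop_form y (x + x') = loop_form y x + loop_form y x'"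
  by (simp add: loop_form_def lookup_add killing_add_right sum.distrib)

lemma loop_form_scale_right: "loop_form y (loop_scale c x) = c * loop_form y x"
  by (simp add: loop_form_def killing_scale_right sum_distrib_left)

lemma loop_form_single:
  "loop_form (Poly_Mapping.single k a) y = killing a (Poly_Mapping.lookup y (- k))"
  by (subst loop_form_superset[of "{k}"]) auto

lemma loop_form_0_left: "loop_form 0 y = 0"
  and loop_form_0_right: "loop_form y 0 = 0"
  by (simp_all add: loop_form_def killing_0_right)

lemma loop_form_minus_right: "loop_form y (- x) = - loop_form y x"
  using loop_form_add_right[of y "- x" x] by (simp add: loop_form_0_right eq_neg_iff_add_eq_0)

lemma loop_form_commute: "loop_form x y = loop_form y x"
proof (induction x rule: loop_induct)
  case (single k a)
  show ?case
  proof (induction y rule: loop_induct)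
    case (single j b)
    show ?case
      using killing_commute[of a b]
      by (auto simp: loop_form_single lookup_single when_def killing_0_right)
  qed (simp add: loop_form_add_left loop_form_add_right)
qed (simp add: loop_form_add_left loop_form_add_right)

lemma loop_form_invariant: "loop_form (loop_bracket x y) z = loop_form x (loop_bracket y z)"
proof (induction x rule: loop_induct)
  case (single i a)
  show ?case
  proof (induction y rule: loop_induct)
    case (single j b)
    show ?case
    proof (induction z rule: loop_induct)
      case (single k c)
      show ?case
        using killing_invariant[of a b c]
        by (auto simp: loop_form_single loop_bracket_single lookup_single when_def killing_0_right)
    qed (simp add: loop_form_add_right loop_bracket_add_right)
  qed (simp add: loop_form_add_left loop_form_add_right loop_bracket_add_left loop_bracket_add_right)
qed (simp add: loop_form_add_left loop_bracket_add_left)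

end

section \<open>The grading\<close>

context kostant_toda
begin

abbreviation coxeter :: int where
  "coxeter \<equiv> root_length \<Delta> \<beta> + 1"

abbreviation graded_sum :: "int set \<Rightarrow> 'g set" where
  "graded_sum A \<equiv> span (\<Union>k\<in>A. graded k)"

lemma root_length_bound:
  assumes "\<alpha> \<in> roots \<hh>"
  shows "\<bar>root_length \<Delta> \<alpha>\<bar> < coxeter"
proof -
  have "root_length \<Delta> \<alpha> \<le> root_length \<Delta> \<beta>" "- root_length \<Delta> \<alpha> \<le> root_length \<Delta> \<beta>"
    using longest_root(2)[OF assms] longest_root(2)[OF minus_root[OF assms]] root_length_minus[OF assms]
    by auto
  then show ?thesis by linarith
qed

lemma coxeter_pos: "coxeter > 1"
  using root_length_bound[OF longest_root(1)] root_length_grading(2)[OF longest_root(1)] by linarith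

lemma subspace_graded: "subspace (graded k)"
  by (simp add: graded_def subspace_cartan)

lemma weight_space_subset_graded:
  assumes "\<gamma> \<in> weights" "\<gamma> grading_element = of_int k"
  shows "weight_space \<hh> \<gamma> \<subseteq> graded k"
proof (cases "\<gamma> = (\<lambda>_. 0)")
  case True
  then have "k = 0" using assms(2) by simp
  then show ?thesis using True by (simp add: graded_def weight_space_zero)
next
  case False
  then have \<gamma>: "\<gamma> \<in> roots \<hh>" using assms(1) by blast
  then have "(of_int (root_length \<Delta> \<gamma>) :: complex) = of_int k"
    using root_length_grading(1) assms(2) by simp
  then have k: "root_length \<Delta> \<gamma> = k" by (simp only: of_int_eq_iff)
  then have "k \<noteq> 0" using root_length_grading(2)[OF \<gamma>] by simp
  then have "graded k = span {e \<alpha> | \<alpha>. \<alpha> \<in> roots \<hh> \<and> root_length \<Delta> \<alpha> = k}"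
    by (simp add: graded_def)
  moreover have "{e \<gamma>} \<subseteq> {e \<alpha> | \<alpha>. \<alpha> \<in> roots \<hh> \<and> root_length \<Delta> \<alpha> = k}" using \<gamma> k by blast
  ultimately show ?thesis unfolding weight_space_root[OF \<gamma>] by (simp only: span_mono)
qed

lemma root_vector_graded: "\<alpha> \<in> roots \<hh> \<Longrightarrow> e \<alpha> \<in> graded (root_length \<Delta> \<alpha>)"
  using weight_space_subset_graded[of \<alpha> "root_length \<Delta> \<alpha>"] root_length_grading(1)[of \<alpha>]
    root_vector_weight(1)[of \<alpha>] by auto

text \<open>In terms of weight spaces the piece of degree \<open>0\<close> is no exception, so brackets of pieces can be
  treated uniformly.\<close>

lemma graded_eq_weight_spaces:
  "graded k = span (\<Union>\<gamma>\<in>{\<gamma> \<in> weights. \<gamma> grading_element = of_int k}. weight_space \<hh> \<gamma>)"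
proof (rule antisym)
  show "span (\<Union>\<gamma>\<in>{\<gamma> \<in> weights. \<gamma> grading_element = of_int k}. weight_space \<hh> \<gamma>) \<subseteq> graded k"
    by (intro span_minimal subspace_graded UN_least) (simp only: mem_Collect_eq weight_space_subset_graded)
  show "graded k \<subseteq> span (\<Union>\<gamma>\<in>{\<gamma> \<in> weights. \<gamma> grading_element = of_int k}. weight_space \<hh> \<gamma>)"
    (is "_ \<subseteq> span ?S")
  proof (cases "k = 0")
    case True
    have "weight_space \<hh> (\<lambda>_. 0) \<subseteq> ?S" using True by (intro UN_upper) simp
    moreover have "graded k = weight_space \<hh> (\<lambda>_. 0)"
      using True by (simp add: graded_def weight_space_zero)
    ultimately have "graded k \<subseteq> ?S" by (simp only:)
    then show ?thesis using span_superset by (rule order_trans)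
  next
    case False
    have "{e \<alpha> | \<alpha>. \<alpha> \<in> roots \<hh> \<and> root_length \<Delta> \<alpha> = k} \<subseteq> ?S"
    proof
      fix x assume "x \<in> {e \<alpha> | \<alpha>. \<alpha> \<in> roots \<hh> \<and> root_length \<Delta> \<alpha> = k}"
      then obtain \<alpha> where \<alpha>: "x = e \<alpha>" "\<alpha> \<in> roots \<hh>" "root_length \<Delta> \<alpha> = k" by blast
      then have "\<alpha> \<in> {\<gamma> \<in> weights. \<gamma> grading_element = of_int k}"
        using root_length_grading(1)[OF \<alpha>(2)] by simp
      moreover have "x \<in> weight_space \<hh> \<alpha>" using root_vector_weight(1)[OF \<alpha>(2)] \<alpha>(1) by simp
      ultimately show "x \<in> ?S" by blast
    qed
    then show ?thesis using False by (simp add: graded_def span_mono)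
  qed
qed

text \<open>The degree is an eigenvalue of the grading element, hence different pieces are independent.\<close>

lemma graded_subset_gen_eigenspace:
  "graded k \<subseteq> gen_eigenspace (bracket grading_element) (of_int k)"
  unfolding graded_eq_weight_spaces
proof (intro span_minimal subspace_gen_eigenspace endo_ad UN_least)
  fix \<gamma> assume \<gamma>: "\<gamma> \<in> {\<gamma> \<in> weights. \<gamma> grading_element = of_int k}"
  have "weight_space \<hh> \<gamma> \<subseteq> gen_eigenspace (bracket grading_element) (\<gamma> grading_element)"
    using grading_element(1) unfolding weight_space_def by blast
  then show "weight_space \<hh> \<gamma> \<subseteq> gen_eigenspace (bracket grading_element) (of_int k)"
    using \<gamma> by simp
qed

lemma bracket_span:
  assumes "\<And>x y. x \<in> A \<Longrightarrow> y \<in> B \<Longrightarrow> bracket x y \<in> U" "subspace U" "x \<in> span A" "y \<in> span B"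
  shows "bracket x y \<in> U"
proof -
  have "bracket a y \<in> U" if "a \<in> A" for a
    by (rule endo_span_subset[OF endo_ad assms(1)[OF that] assms(2,4)])
  then show ?thesis
    by (rule endo_span_subset[OF bracket_linear_left _ assms(2,3)])
qed

lemma bracket_graded:
  assumes "x \<in> graded m" "y \<in> graded n"
  shows "bracket x y \<in> graded (m + n)"
proof (rule bracket_span[OF _ subspace_graded])
  let ?S = "\<lambda>k. \<Union>\<gamma>\<in>{\<gamma> \<in> weights. \<gamma> grading_element = of_int k}. weight_space \<hh> \<gamma>"
  show "x \<in> span (?S m)" "y \<in> span (?S n)"
    using assms by (simp_all only: graded_eq_weight_spaces)
  fix x y assume "x \<in> ?S m" "y \<in> ?S n"
  then obtain \<gamma> \<gamma>' where *: "\<gamma> \<in> weights" "\<gamma> grading_element = of_int m" "x \<in> weight_space \<hh> \<gamma>"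
    "\<gamma>' \<in> weights" "\<gamma>' grading_element = of_int n" "y \<in> weight_space \<hh> \<gamma>'" by blast
  show "bracket x y \<in> graded (m + n)"
    by (rule bracket_in_weight_sum[OF *(3,6,1,4) _ subspace_graded])
      (rule weight_space_subset_graded, use * in simp_all)
qed

lemma graded_outside:
  assumes "coxeter \<le> \<bar>k\<bar>"
  shows "graded k = {0}"
proof -
  have "{e \<alpha> | \<alpha>. \<alpha> \<in> roots \<hh> \<and> root_length \<Delta> \<alpha> = k} = {}"
    using assms root_length_bound by fastforce
  moreover have "k \<noteq> 0" using assms coxeter_pos by auto
  ultimately show ?thesis by (simp only: graded_def if_False span_empty)
qed

lemma graded_sum_subset:
  assumes "\<And>k. k \<in> A \<Longrightarrow> \<bar>k\<bar> < coxeter \<Longrightarrow> k \<in> B"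
  shows "graded_sum A \<subseteq> graded_sum B"
proof (intro span_minimal subspace_span UN_least)
  fix k assume k: "k \<in> A"
  show "graded k \<subseteq> graded_sum B"
  proof (cases "\<bar>k\<bar> < coxeter")
    case True
    have "graded k \<subseteq> (\<Union>k\<in>B. graded k)" by (rule UN_upper[OF assms[OF k True]])
    then show ?thesis using span_superset by (rule order_trans)
  next
    case False
    then show ?thesis using graded_outside[of k] span_zero by simp
  qed
qed

text \<open>Pieces of degree at least the Coxeter number in absolute value vanish, so sums of degrees in that
  range impose no condition.\<close>

lemma bracket_graded_sum:
  assumes "x \<in> graded_sum A" "y \<in> graded_sum B"
    and "\<And>a b. a \<in> A \<Longrightarrow> b \<in> B \<Longrightarrow> \<bar>a\<bar> < coxeter \<Longrightarrow> \<bar>b\<bar> < coxeter \<Longrightarrow> \<bar>a + b\<bar> < coxeter \<Longrightarrow> a + b \<in> C"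
  shows "bracket x y \<in> graded_sum C"
proof (rule bracket_span[OF _ subspace_span assms(1,2)])
  fix x y assume "x \<in> (\<Union>k\<in>A. graded k)" "y \<in> (\<Union>k\<in>B. graded k)"
  then obtain a b where ab: "a \<in> A" "x \<in> graded a" "b \<in> B" "y \<in> graded b" by blast
  show "bracket x y \<in> graded_sum C"
  proof (cases "\<bar>a\<bar> < coxeter \<and> \<bar>b\<bar> < coxeter")
    case False
    then have "x = 0 \<or> y = 0" using ab graded_outside[of a] graded_outside[of b] by auto
    then have "bracket x y = 0" by (auto simp: bracket_0_left bracket_0_right)
    then show ?thesis by (simp add: span_zero)
  next
    case True
    have "bracket x y \<in> graded_sum {a + b}"
      using bracket_graded[OF ab(2,4)] by (simp add: span_base)
    moreover have "graded_sum {a + b} \<subseteq> graded_sum C"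
      by (rule graded_sum_subset) (use assms(3) ab True in auto)
    ultimately show ?thesis by blast
  qed
qed

lemma graded_sum_decomposition:
  assumes "x \<in> graded_sum A"
  shows "\<exists>f. (\<forall>k. f k \<in> graded k) \<and> (\<forall>k. k \<notin> A \<longrightarrow> f k = 0) \<and> x = (\<Sum>k\<in>{- coxeter..coxeter}. f k)"
  using assms
proof (induction rule: span_induct_alt)
  case base
  then show ?case
    by (intro exI[of _ "\<lambda>_. 0"]) (simp add: subspace_0[OF subspace_graded])
next
  case (step c a y)
  then obtain f k where f: "\<forall>k. f k \<in> graded k" "\<forall>k. k \<notin> A \<longrightarrow> f k = 0"
    "y = (\<Sum>k\<in>{- coxeter..coxeter}. f k)" and k: "k \<in> A" "a \<in> graded k" by blast
  let ?g = "\<lambda>j. (if j = k then c *s a else 0) + f j"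
  have "c *s a + y = (\<Sum>j\<in>{- coxeter..coxeter}. ?g j)"
  proof (cases "\<bar>k\<bar> < coxeter")
    case True
    then have "k \<in> {- coxeter..coxeter}" by auto
    then show ?thesis by (simp add: sum.distrib f(3))
  next
    case False
    then have "a = 0" using k graded_outside[of k] by auto
    then show ?thesis by (simp only: f(3) scale_zero_right if_cancel add_0_left)
  qed
  moreover have "\<forall>j. ?g j \<in> graded j"
    using f(1) k(2) subspace_graded by (auto intro: subspace_add subspace_scale)
  moreover have "\<forall>j. j \<notin> A \<longrightarrow> ?g j = 0" using f(2) k(1) by auto
  ultimately show ?case by (intro exI[of _ ?g] conjI)
qed

lemma graded_sum_disjoint:
  assumes "x \<in> graded_sum A" "x \<in> graded_sum B" "A \<inter> B = {}"
  shows "x = 0"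
proof -
  obtain f where "\<forall>k. f k \<in> graded k" "\<forall>k. k \<notin> A \<longrightarrow> f k = 0"
    and f3: "x = (\<Sum>k\<in>{- coxeter..coxeter}. f k)"
    using graded_sum_decomposition[OF assms(1)] by (elim exE conjE)
  then have f: "f k \<in> graded k" "k \<notin> A \<Longrightarrow> f k = 0" for k by simp_all
  obtain g where "\<forall>k. g k \<in> graded k" "\<forall>k. k \<notin> B \<longrightarrow> g k = 0"
    and g3: "x = (\<Sum>k\<in>{- coxeter..coxeter}. g k)"
    using graded_sum_decomposition[OF assms(2)] by (elim exE conjE)
  then have g: "g k \<in> graded k" "k \<notin> B \<Longrightarrow> g k = 0" for k by simp_all
  let ?K = "{- coxeter..coxeter}"
  let ?y = "\<lambda>\<mu>. f (the_inv complex_of_int \<mu>) - g (the_inv complex_of_int \<mu>)"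
  have inj: "inj complex_of_int" by (simp add: inj_on_def)
  have inv: "the_inv complex_of_int (complex_of_int k) = k" for k by (rule the_inv_f_f[OF inj])
  have "(\<Sum>\<mu>\<in>complex_of_int ` ?K. ?y \<mu>) = (\<Sum>k\<in>?K. f k - g k)"
    by (subst sum.reindex) (use inj in \<open>auto simp: inv inj_on_def\<close>)
  also have "\<dots> = 0" unfolding sum_subtractf f3[symmetric] g3[symmetric] by simp
  finally have zero: "(\<Sum>\<mu>\<in>complex_of_int ` ?K. ?y \<mu>) = 0" .
  have "\<forall>\<mu>\<in>complex_of_int ` ?K. ?y \<mu> = 0"
  proof (rule gen_eigenspace_independent[OF endo_ad[of grading_element] _ _ zero])
    fix \<mu> assume "\<mu> \<in> complex_of_int ` ?K"
    then obtain k where k: "\<mu> = of_int k" by blast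
    have "f k - g k \<in> graded k" by (rule subspace_diff[OF subspace_graded f(1) g(1)])
    then show "?y \<mu> \<in> gen_eigenspace (bracket grading_element) \<mu>"
      unfolding k inv by (rule subsetD[OF graded_subset_gen_eigenspace])
  qed simp
  then have fg: "f k = g k" if "k \<in> ?K" for k using that inv by force
  have "f k = 0" if "k \<in> ?K" for k
  proof (cases "k \<in> A")
    case True
    then have "k \<notin> B" using assms(3) by blast
    then show ?thesis using fg[OF that] g(2) by simp
  next
    case False
    then show ?thesis by (rule f(2))
  qed
  then show ?thesis unfolding f3 by (rule sum.neutral[OF ballI])
qed

lemma single_in_loop_graded_sum:
  assumes "x \<in> graded_sum A" "\<And>m. m \<in> A \<Longrightarrow> \<bar>m\<bar> < coxeter \<Longrightarrow> m + coxeter * k \<in> B"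
  shows "Poly_Mapping.single k x \<in> loop.span (\<Union>i\<in>B. loop_graded i)"
proof -
  let ?B = "{m. m + coxeter * k \<in> B}"
  let ?S = "loop.span (\<Union>i\<in>B. loop_graded i)"
  have "x \<in> graded_sum ?B"
    using assms graded_sum_subset[of A ?B] by blast
  then show ?thesis
  proof (induction rule: span_induct_alt)
    case base
    then show ?case by (simp add: loop.span_zero)
  next
    case (step c a y)
    then obtain m where m: "m + coxeter * k \<in> B" "a \<in> graded m" by blast
    have "Poly_Mapping.single k a \<in> loop_graded (m + coxeter * k)"
      unfolding loop_graded_def using m(2) by (intro loop.span_base) blast
    then have "Poly_Mapping.single k a \<in> ?S" using m(1) by (intro loop.span_base) blast
    moreover have "Poly_Mapping.single k (c *s a + y) = loop_scale c (Poly_Mapping.single k a) + Poly_Mapping.single k y"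
      by (rule poly_mapping_eqI) (simp add: lookup_add lookup_single when_def)
    ultimately show ?case using step by (simp only: loop.span_add loop.span_scale)
  qed
qed

lemma coefficient_in_graded_sum:
  assumes "x \<in> loop.span (\<Union>i\<in>B. loop_graded i)"
  shows "Poly_Mapping.lookup x k \<in> graded_sum {m. m + coxeter * k \<in> B}"
proof -
  let ?S = "\<lambda>k. graded_sum {m. m + coxeter * k \<in> B}"
  have sub: "loop.subspace {x. \<forall>k. Poly_Mapping.lookup x k \<in> ?S k}"
    by (rule loop.subspaceI) (auto simp: lookup_add span_zero span_add span_scale)
  have "Poly_Mapping.lookup (Poly_Mapping.single j a) k \<in> ?S k"
    if "m + coxeter * j \<in> B" "a \<in> graded m" for j a m k
  proof (cases "k = j")
    case True
    have "a \<in> (\<Union>m\<in>{m. m + coxeter * j \<in> B}. graded m)" using that by blast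
    then show ?thesis using True by (simp add: span_base)
  next
    case False
    then show ?thesis by (simp add: lookup_single when_def span_zero)
  qed
  then have "loop_graded i \<subseteq> {x. \<forall>k. Poly_Mapping.lookup x k \<in> ?S k}" if "i \<in> B" for i
    unfolding loop_graded_def using that by (intro loop.span_minimal sub) blast
  then have "loop.span (\<Union>i\<in>B. loop_graded i) \<subseteq> {x. \<forall>k. Poly_Mapping.lookup x k \<in> ?S k}"
    by (intro loop.span_minimal sub UN_least)
  then show ?thesis using assms by blast
qed

text \<open>The coefficient of \<open>\<lambda>\<^sup>k\<close> of an element of \<open>loop_plus\<close> has components of degree at least
  \<open>- coxeter * k\<close> only, for \<open>loop_minus\<close> they are of smaller degree.\<close>

lemma loop_plus_inter_loop_minus:
  assumes "x \<in> loop_plus" "x \<in> loop_minus"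
  shows "x = 0"
proof (rule poly_mapping_eqI)
  fix k
  have "Poly_Mapping.lookup x k = 0"
    by (rule graded_sum_disjoint[OF
          coefficient_in_graded_sum[OF assms(1)[unfolded loop_plus_def]]
          coefficient_in_graded_sum[OF assms(2)[unfolded loop_minus_def]]]) auto
  then show "Poly_Mapping.lookup x k = Poly_Mapping.lookup 0 k" by simp
qed

lemma proj_eqI:
  assumes "x \<in> loop_plus" "y \<in> loop_minus"
  shows "proj_plus (x + y) = x" "proj_minus (x + y) = y"
proof -
  have subP: "loop.subspace loop_plus" and subM: "loop.subspace loop_minus"
    by (simp_all add: loop_plus_def loop_minus_def)
  have unique: "u = x \<and> v = y" if "u \<in> loop_plus" "v \<in> loop_minus" "u + v = x + y" for u v
  proof -
    have P: "u - x \<in> loop_plus" using that(1) assms(1) by (rule loop.subspace_diff[OF subP])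
    have eq: "u - x = y - v" using that(3) by (simp add: algebra_simps)
    have M: "y - v \<in> loop_minus" using assms(2) that(2) by (rule loop.subspace_diff[OF subM])
    have "u - x = 0"
      by (rule loop_plus_inter_loop_minus[OF P]) (simp only: eq M)
    then have "u = x" by (simp only: right_minus_eq)
    then show ?thesis using that(3) by simp
  qed
  show "proj_plus (x + y) = x"
    unfolding proj_plus_def
  proof (rule the_equality)
    fix u assume "u \<in> loop_plus \<and> x + y - u \<in> loop_minus"
    then have "u = x \<and> x + y - u = y" by (intro unique) simp_all
    then show "u = x" ..
  qed (use assms in simp)
  show "proj_minus (x + y) = y"
    unfolding proj_minus_def
  proof (rule the_equality)
    fix v assume "v \<in> loop_minus \<and> x + y - v \<in> loop_plus"
    then have "x + y - v = x \<and> v = y" by (intro unique) simp_all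
    then show "v = y" ..
  qed (use assms in simp)
qed

end

section \<open>Functions on the loop algebra and their gradients\<close>

lemma generated_algebra_mono:
  assumes "F \<in> generated_algebra S" "S \<subseteq> T"
  shows "F \<in> generated_algebra T"
  using assms(1) by (induction rule: generated_algebra.induct) (use assms(2) in \<open>auto intro: generated_algebra.intros\<close>)

lemma generated_algebra_sum:
  assumes "\<And>i. i \<in> I \<Longrightarrow> F i \<in> generated_algebra S"
  shows "(\<lambda>x. \<Sum>i\<in>I. F i x) \<in> generated_algebra S"
  using assms
proof (induction I rule: infinite_finite_induct)
  case (insert i I)
  then have "(\<lambda>x. F i x + (\<Sum>i\<in>I. F i x)) \<in> generated_algebra S"
    by (intro generated_algebra.add) auto
  then show ?case using insert.hyps by simp
qed (simp_all add: generated_algebra.const)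

lemma generated_algebra_compose:
  assumes "F \<in> generated_algebra S" "\<And>\<phi>. \<phi> \<in> S \<Longrightarrow> (\<lambda>x. \<phi> (f x)) \<in> generated_algebra T"
  shows "(\<lambda>x. F (f x)) \<in> generated_algebra T"
  using assms(1) by (induction rule: generated_algebra.induct) (use assms(2) in \<open>auto intro: generated_algebra.intros\<close>)

context lie_algebra
begin

abbreviation loop_functional :: "('g loop \<Rightarrow> complex) \<Rightarrow> bool" where
  "loop_functional \<equiv> Vector_Spaces.linear loop_scale (*)"

lemma loop_functionalI:
  assumes "\<And>x y. \<phi> (x + y) = \<phi> x + \<phi> y" "\<And>c x. \<phi> (loop_scale c x) = c * \<phi> x"
  shows "loop_functional \<phi>"
  by unfold_locales (simp_all add: assms algebra_simps)

lemmas loop_functional_add = module_hom.add[OF module_hom_linearI[where ?s1.0 = loop_scale and ?s2.0 = "(*)"]]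
  and loop_functional_scale = module_hom.scale[OF module_hom_linearI[where ?s1.0 = loop_scale and ?s2.0 = "(*)"]]
  and loop_functional_0 = module_hom.zero[OF module_hom_linearI[where ?s1.0 = loop_scale and ?s2.0 = "(*)"]]

text \<open>Truncation to the powers of \<open>\<lambda>\<close> that occur in the phase space. Composing with it turns an
  arbitrary linear form into one that vanishes on almost all graded pieces, without changing its
  restriction to the phase space.\<close>

definition truncate :: "'g loop \<Rightarrow> 'g loop" where
  "truncate x = Poly_Mapping.single (-1) (Poly_Mapping.lookup x (-1)) +
     Poly_Mapping.single 0 (Poly_Mapping.lookup x 0) + Poly_Mapping.single 1 (Poly_Mapping.lookup x 1)"

lemma lookup_truncate:
  "Poly_Mapping.lookup (truncate x) k = (if k \<in> {-1, 0, 1} then Poly_Mapping.lookup x k else 0)"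
  by (auto simp: truncate_def lookup_add lookup_single when_def)

lemma truncate_add: "truncate (x + y) = truncate x + truncate y"
  by (rule poly_mapping_eqI) (simp add: lookup_truncate lookup_add)

lemma truncate_scale: "truncate (loop_scale c x) = loop_scale c (truncate x)"
  by (rule poly_mapping_eqI) (simp add: lookup_truncate)

lemma loop_form_truncate: "loop_form (truncate x) y = killing (Poly_Mapping.lookup x (-1)) (Poly_Mapping.lookup y 1) +
    killing (Poly_Mapping.lookup x 0) (Poly_Mapping.lookup y 0) +
    killing (Poly_Mapping.lookup x 1) (Poly_Mapping.lookup y (-1))"
  unfolding truncate_def loop_form_add_left loop_form_single by simp

lemma loop_form_truncate_commute: "loop_form (truncate x) (truncate y) = loop_form (truncate x) y"
  by (simp add: loop_form_truncate lookup_truncate)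

definition truncated_functionals :: "('g loop \<Rightarrow> complex) set" where
  "truncated_functionals = {\<lambda>x. \<phi> (truncate x) | \<phi>. loop_functional \<phi>}"

lemma truncate_functional: "loop_functional \<phi> \<Longrightarrow> loop_functional (\<lambda>x. \<phi> (truncate x))"
  by (rule loop_functionalI)
    (simp_all add: truncate_add truncate_scale loop_functional_add loop_functional_scale)

text \<open>A polynomial function that extends the Hamiltonian from the phase space to the loop algebra.\<close>

definition energy :: "'g loop \<Rightarrow> complex" where
  "energy x = 1/2 * loop_form (truncate x) (truncate x)"

lemma killing_expand:
  "killing u v = (\<Sum>b\<in>Basis. representation Basis u b * killing b v)"
proof -
  have "killing (\<Sum>b\<in>B. c b *s b) v = (\<Sum>b\<in>B. c b * killing b v)" if "finite B" for B c
    using that by (induction B) (simp_all add: killing_0_left killing_add_left killing_scale_left)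
  from this[OF finite_Basis, of "representation Basis u"] show ?thesis
    by (subst (asm) sum_representation_eq) (auto simp: independent_Basis span_Basis finite_Basis)
qed

lemma energy_in_algebra: "energy \<in> generated_algebra truncated_functionals"
proof -
  have coeff: "(\<lambda>x. f (Poly_Mapping.lookup x k)) \<in> generated_algebra truncated_functionals"
    if f: "\<And>u v. f (u + v) = f u + f v" "\<And>c u. f (c *s u) = c * f u" and k: "k \<in> {-1, 0, 1}" for f k
  proof (rule generated_algebra.gen)
    have "loop_functional (\<lambda>x. f (Poly_Mapping.lookup x k))"
      by (rule loop_functionalI) (simp_all add: lookup_add f)
    moreover have "(\<lambda>x. f (Poly_Mapping.lookup x k)) = (\<lambda>x. f (Poly_Mapping.lookup (truncate x) k))"
      using k by (simp add: lookup_truncate)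
    ultimately show "(\<lambda>x. f (Poly_Mapping.lookup x k)) \<in> truncated_functionals"
      unfolding truncated_functionals_def
      by (intro CollectI exI[of _ "\<lambda>x. f (Poly_Mapping.lookup x k)"] conjI)
  qed
  have product: "(\<lambda>x. killing (Poly_Mapping.lookup x j) (Poly_Mapping.lookup x k))
      \<in> generated_algebra truncated_functionals" if "j \<in> {-1, 0, 1}" "k \<in> {-1, 0, 1}" for j k
    unfolding killing_expand[of "Poly_Mapping.lookup x j" for x]
    by (intro generated_algebra_sum generated_algebra.mult coeff that)
      (simp_all add: representation_add representation_scale independent_Basis span_Basis
        killing_add_right killing_scale_right)
  have "energy = (\<lambda>x. 1/2 * (killing (Poly_Mapping.lookup x (-1)) (Poly_Mapping.lookup x 1) +
    killing (Poly_Mapping.lookup x 0) (Poly_Mapping.lookup x 0) +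
    killing (Poly_Mapping.lookup x 1) (Poly_Mapping.lookup x (-1))))"
    by (rule ext) (simp add: energy_def loop_form_truncate lookup_truncate)
  also have "\<dots> \<in> generated_algebra truncated_functionals"
    by (intro generated_algebra.mult generated_algebra.add generated_algebra.const product) auto
  finally show ?thesis .
qed

end

context kostant_toda
begin

text \<open>By non-degeneracy the map that sends \<open>a\<close> to the vector with coordinates \<open>\<langle>a | b\<rangle>\<close>, for \<open>b\<close> in the
  basis, is injective and therefore onto.\<close>

lemma killing_represents:
  assumes f: "\<And>u v. f (u + v) = f u + f v" "\<And>c u. f (c *s u) = c * f u"
  obtains a where "\<And>y. f y = killing a y"
proof -
  define T where "T a = (\<Sum>b\<in>Basis. killing a b *s b)" for a
  have rep: "representation Basis (\<Sum>b\<in>Basis. c b *s b) b = c b" if "b \<in> Basis" for c b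
  proof -
    have "representation Basis (\<Sum>b\<in>Basis. c b *s b) b = (\<Sum>b'\<in>Basis. representation Basis (c b' *s b') b)"
      by (subst representation_sum) (auto simp: independent_Basis span_Basis)
    also have "\<dots> = (\<Sum>b'\<in>Basis. if b' = b then c b' else 0)"
      by (rule sum.cong)
        (auto simp: representation_scale representation_basis independent_Basis span_Basis)
    also have "\<dots> = c b" using that finite_Basis by simp
    finally show ?thesis .
  qed
  have T: "endo T"
    by (rule endoI)
      (simp_all add: T_def killing_add_left killing_scale_left scale_left_distrib sum.distrib
        scale_sum_right)
  have expand: "killing a y = (\<Sum>b\<in>Basis. representation Basis y b * killing a b)" for a y
    using killing_expand[of y a] by (simp only: killing_commute[of _ a])
  have repT: "representation Basis (T a) b = killing a b" if "b \<in> Basis" for a b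
    unfolding T_def by (rule rep[OF that])
  have "inj T"
  proof (rule injI)
    fix a a' assume eq: "T a = T a'"
    have same: "killing a b = killing a' b" if "b \<in> Basis" for b
      unfolding repT[OF that, of a, symmetric] eq by (rule repT[OF that])
    have "killing a y = killing a' y" for y
      unfolding expand[of a y] expand[of a' y] by (rule sum.cong) (simp_all add: same)
    then have "killing (a - a') y = 0" for y
      using killing_linear_left[of a "-1" a' y] by simp
    then show "a = a'" using killing_nondegenerate[of "a - a'"] by simp
  qed
  then have "surj T" by (rule linear_inj_imp_surj[OF T])
  then obtain a where "T a = (\<Sum>b\<in>Basis. f b *s b)" by (metis surjD)
  then have a: "killing a b = f b" if "b \<in> Basis" for b
    using repT[OF that, of a] rep[OF that, of f] by (simp only:)
  have f0: "f 0 = 0" using f(2)[of 0 0] by simp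
  have fsum: "f (\<Sum>b\<in>B. c b *s b) = (\<Sum>b\<in>B. c b * f b)" if "finite B" for B c
    using that by (induction B) (simp_all add: f f0)
  have "f y = killing a y" for y
  proof -
    have "f y = (\<Sum>b\<in>Basis. representation Basis y b * f b)"
      using fsum[OF finite_Basis, of "representation Basis y"]
      by (subst (asm) sum_representation_eq) (auto simp: independent_Basis span_Basis finite_Basis)
    also have "\<dots> = killing a y" unfolding expand[of a y] by (rule sum.cong) (simp_all add: a)
    finally show ?thesis .
  qed
  then show thesis using that by blast
qed

lemma loop_form_nondegenerate:
  assumes "\<And>y. loop_form x y = loop_form x' y"
  shows "x = x'"
proof (rule poly_mapping_eqI)
  fix k
  have "killing (Poly_Mapping.lookup x k - Poly_Mapping.lookup x' k) v = 0" for v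
  proof -
    have "loop_form (Poly_Mapping.single (- k) v) x = loop_form (Poly_Mapping.single (- k) v) x'"
      using assms[of "Poly_Mapping.single (- k) v"] by (simp only: loop_form_commute[of "Poly_Mapping.single (- k) v"])
    then have "killing (Poly_Mapping.lookup x k) v = killing (Poly_Mapping.lookup x' k) v"
      by (simp add: loop_form_single killing_commute[of v])
    then show ?thesis
      using killing_linear_left[of "Poly_Mapping.lookup x k" "-1" "Poly_Mapping.lookup x' k" v] by simp
  qed
  then show "Poly_Mapping.lookup x k = Poly_Mapping.lookup x' k"
    using killing_nondegenerate by (metis right_minus_eq)
qed

lemma truncated_functional_represents:
  assumes \<phi>: "loop_functional \<phi>"
  obtains g where "\<And>y. \<phi> (truncate y) = loop_form g y"
proof -
  have "\<exists>a. \<forall>y. \<phi> (Poly_Mapping.single k y) = killing a y" for k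
  proof -
    have "Poly_Mapping.single k (c *s u) = loop_scale c (Poly_Mapping.single k u)" for c u
      by (rule poly_mapping_eqI) (simp add: lookup_single when_def)
    then obtain a where "\<And>y. \<phi> (Poly_Mapping.single k y) = killing a y"
      using killing_represents[of "\<lambda>y. \<phi> (Poly_Mapping.single k y)"]
      by (metis loop_functional_add[OF \<phi>] loop_functional_scale[OF \<phi>] single_add)
    then show ?thesis by blast
  qed
  then obtain a where a: "\<And>k y. \<phi> (Poly_Mapping.single k y) = killing (a k) y" by metis
  have "\<phi> (truncate y) = loop_form (Poly_Mapping.single 1 (a (-1)) + Poly_Mapping.single 0 (a 0) +
      Poly_Mapping.single (-1) (a 1)) y" for y
    by (simp add: truncate_def loop_functional_add[OF \<phi>] a loop_form_add_left loop_form_single)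
  then show thesis using that by blast
qed

definition has_gradient :: "('g loop \<Rightarrow> complex) \<Rightarrow> 'g loop \<Rightarrow> 'g loop \<Rightarrow> bool" where
  "has_gradient F x g \<longleftrightarrow> (\<forall>y. ((\<lambda>t. F (x + loop_scale t y)) has_field_derivative loop_form g y) (at 0))"

lemma gradient_eqI:
  assumes "has_gradient F x g"
  shows "gradient F x = g"
  unfolding gradient_def
proof (rule the_equality)
  show "\<forall>y. ((\<lambda>t. F (x + loop_scale t y)) has_field_derivative loop_form g y) (at 0)"
    using assms by (simp add: has_gradient_def)
next
  fix g' assume "\<forall>y. ((\<lambda>t. F (x + loop_scale t y)) has_field_derivative loop_form g' y) (at 0)"
  then show "g' = g"
    using assms unfolding has_gradient_def by (intro loop_form_nondegenerate) (metis DERIV_unique)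
qed

lemma truncated_algebra_gradient:
  assumes "F \<in> generated_algebra truncated_functionals"
  obtains g where "has_gradient F x g"
proof -
  have "\<exists>g. has_gradient F x g"
    using assms
  proof (induction rule: generated_algebra.induct)
    case (const c)
    then show ?case
      by (intro exI[of _ 0]) (simp add: has_gradient_def loop_form_0_left)
  next
    case (gen \<psi>)
    then obtain \<phi> where \<phi>: "loop_functional \<phi>" and \<psi>: "\<psi> = (\<lambda>x. \<phi> (truncate x))"
      by (auto simp: truncated_functionals_def)
    obtain g where g: "\<And>y. \<phi> (truncate y) = loop_form g y"
      using truncated_functional_represents[OF \<phi>] by blast
    have "((\<lambda>t. loop_form g x + t * loop_form g y) has_field_derivative loop_form g y) (at 0)" for y
      by (auto intro!: derivative_eq_intros)
    then have "has_gradient \<psi> x g"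
      by (simp add: has_gradient_def \<psi> g loop_form_add_right loop_form_scale_right)
    then show ?case by blast
  next
    case (add F G)
    then obtain f g where fg: "has_gradient F x f" "has_gradient G x g" by blast
    have "has_gradient (\<lambda>x. F x + G x) x (f + g)"
      unfolding has_gradient_def loop_form_add_left
      using fg by (auto simp: has_gradient_def intro!: DERIV_add)
    then show ?case by blast
  next
    case (mult F G)
    then obtain f g where fg: "has_gradient F x f" "has_gradient G x g" by blast
    have scale_left: "loop_form (loop_scale c u) y = c * loop_form u y" for c u y
      using loop_form_scale_right[of y c u] by (simp only: loop_form_commute[of y])
    have "has_gradient (\<lambda>x. F x * G x) x (loop_scale (G x) f + loop_scale (F x) g)"
      unfolding has_gradient_def loop_form_add_left scale_left
    proof
      fix y
      have "((\<lambda>t. F (x + loop_scale t y) * G (x + loop_scale t y)) has_field_derivative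
          loop_form f y * G (x + loop_scale 0 y) + loop_form g y * F (x + loop_scale 0 y)) (at 0)"
        by (rule DERIV_mult) (use fg in \<open>auto simp: has_gradient_def\<close>)
      then show "((\<lambda>t. F (x + loop_scale t y) * G (x + loop_scale t y)) has_field_derivative
          G x * loop_form f y + F x * loop_form g y) (at 0)"
        by (simp add: mult.commute)
    qed
    then show ?case by blast
  qed
  then show thesis using that by blast
qed

text \<open>The form pairs \<open>\<lambda>\<^sup>k\<close> with \<open>\<lambda>\<^sup>-\<^sup>k\<close>, so for truncated \<open>L\<close> the part of \<open>y\<close> that truncation removes is
  orthogonal to \<open>L\<close>.\<close>

lemma energy_gradient:
  assumes "truncate L = L"
  shows "has_gradient energy L L"
  unfolding has_gradient_def
proof
  fix y
  let ?f = "\<lambda>t. 1/2 * loop_form L L + t * loop_form L y + t\<^sup>2 * (1/2 * loop_form (truncate y) y)"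
  have Ly: "loop_form L (truncate y) = loop_form L y" for y
    using loop_form_truncate_commute[of L y] assms by simp
  have "energy (L + loop_scale t y) = ?f t" for t
    unfolding energy_def loop_form_truncate_commute
    using Ly[of y] loop_form_commute[of "truncate y" L]
    by (simp add: truncate_add truncate_scale assms loop_form_add_left loop_form_add_right
        loop_form_scale_right loop_form_commute[of "loop_scale t (truncate y)"]
        loop_form_commute[of y "truncate y"] power2_eq_square algebra_simps)
  moreover have "(?f has_field_derivative loop_form L y) (at 0)"
    by (auto intro!: derivative_eq_intros)
  ultimately show "((\<lambda>t. energy (L + loop_scale t y)) has_field_derivative loop_form L y) (at 0)"
    by simp
qed

text \<open>Truncation leaves three powers of \<open>\<lambda>\<close>, and only finitely many pieces of \<open>\<gg>\<close> are non-zero.\<close>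

lemma truncated_functional_local:
  assumes \<phi>: "loop_functional \<phi>"
  shows "finite {i. \<exists>x\<in>loop_graded i. \<phi> (truncate x) \<noteq> 0}"
proof (rule finite_subset)
  let ?I = "(\<lambda>(k, m). m + coxeter * k) ` ({-1, 0, 1} \<times> {- coxeter..coxeter})"
  show "finite ?I" by simp
  show "{i. \<exists>x\<in>loop_graded i. \<phi> (truncate x) \<noteq> 0} \<subseteq> ?I"
  proof
    fix i assume "i \<in> {i. \<exists>x\<in>loop_graded i. \<phi> (truncate x) \<noteq> 0}"
    then obtain x where x: "x \<in> loop_graded i" "\<phi> (truncate x) \<noteq> 0" by blast
    show "i \<in> ?I"
    proof (rule ccontr)
      assume i: "i \<notin> ?I"
      have "loop.subspace {x. \<phi> (truncate x) = 0}"
        by (rule loop.subspaceI)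
          (simp_all add: truncate_functional[OF \<phi>, THEN loop_functional_add]
            truncate_functional[OF \<phi>, THEN loop_functional_scale] truncate_functional[OF \<phi>, THEN loop_functional_0])
      moreover have "truncate (Poly_Mapping.single k a) = 0" if km: "m + coxeter * k = i" "a \<in> graded m" for k m a
      proof (cases "k \<in> {-1, 0, 1}")
        case True
        then have "m \<notin> {- coxeter..coxeter}" using km(1) i by force
        then have "a = 0" using km(2) graded_outside[of m] by auto
        then show ?thesis by (simp add: truncate_def)
      next
        case False
        then show ?thesis by (intro poly_mapping_eqI) (auto simp: lookup_truncate lookup_single when_def)
      qed
      ultimately have "loop_graded i \<subseteq> {x. \<phi> (truncate x) = 0}"
        unfolding loop_graded_def
        by (intro loop.span_minimal) (auto simp: loop_functional_0[OF \<phi>])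
      then show False using x by blast
    qed
  qed
qed

lemma truncated_algebra_subset: "F \<in> generated_algebra truncated_functionals \<Longrightarrow> F \<in> loop_functions"
  unfolding loop_functions_def
proof (erule generated_algebra_mono, rule subsetI)
  fix \<psi> assume "\<psi> \<in> truncated_functionals"
  then obtain \<phi> where \<phi>: "loop_functional \<phi>" "\<psi> = (\<lambda>x. \<phi> (truncate x))"
    by (auto simp: truncated_functionals_def)
  then show "\<psi> \<in> {\<phi>. loop_functional \<phi> \<and> finite {i. \<exists>x\<in>loop_graded i. \<phi> x \<noteq> 0}}"
    using truncate_functional[OF \<phi>(1)] truncated_functional_local[OF \<phi>(1)] by simp
qed

section \<open>The phase space and the Lax equation\<close>

lemma truncate_phase_space: "L \<in> phase_space \<Longrightarrow> truncate L = L"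
  by (intro poly_mapping_eqI) (auto simp: phase_space_def lookup_truncate lookup_add lookup_single when_def)

lemma phase_function_lift:
  assumes "F \<in> phase_functions"
  obtains F' where "F' \<in> generated_algebra truncated_functionals" "F = restrict F' phase_space"
proof -
  obtain F0 where F0: "F0 \<in> generated_algebra {\<phi>. loop_functional \<phi>}" "F = restrict F0 phase_space"
    using assms by (auto simp: phase_functions_def)
  have "(\<lambda>x. F0 (truncate x)) \<in> generated_algebra truncated_functionals"
    using F0(1)
    by (rule generated_algebra_compose)
      (auto simp: truncated_functionals_def intro: generated_algebra.gen)
  moreover have "F = restrict (\<lambda>x. F0 (truncate x)) phase_space"
    unfolding F0(2) by (rule restrict_ext) (simp add: truncate_phase_space)
  ultimately show thesis using that by blast
qed

lemma phase_space_translate: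
  assumes "L \<in> phase_space" "V \<in> phase_direction"
  shows "L + loop_scale t V \<in> phase_space"
proof -
  obtain y z where L: "L = Poly_Mapping.single (-1) y + Poly_Mapping.single 0 (z + (\<Sum>\<delta>\<in>\<Delta>. e \<delta>)) +
      Poly_Mapping.single 1 (e (\<lambda>x. - \<beta> x))" "y \<in> graded_pos" "z \<in> graded_nonpos"
    using assms(1) by (auto simp: phase_space_def)
  obtain y' z' where V: "V = Poly_Mapping.single (-1) y' + Poly_Mapping.single 0 z'"
      "y' \<in> graded_pos" "z' \<in> graded_nonpos"
    using assms(2) by (auto simp: phase_direction_def)
  have "L + loop_scale t V = Poly_Mapping.single (-1) (y + t *s y') +
      Poly_Mapping.single 0 ((z + t *s z') + (\<Sum>\<delta>\<in>\<Delta>. e \<delta>)) + Poly_Mapping.single 1 (e (\<lambda>x. - \<beta> x))"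
    unfolding L(1) V(1)
    by (rule poly_mapping_eqI) (auto simp: lookup_add lookup_single when_def scale_right_distrib)
  moreover have "y + t *s y' \<in> graded_pos" "z + t *s z' \<in> graded_nonpos"
    using L(2,3) V(2,3) by (simp_all add: graded_pos_def graded_nonpos_def span_add span_scale)
  ultimately show ?thesis unfolding phase_space_def by blast
qed

text \<open>Write \<open>L = \<lambda>\<^sup>-\<^sup>1 y + (h + n + E) + \<lambda> f\<close> with \<open>y\<close> of positive, \<open>h\<close> of zero and \<open>n\<close> of negative degree,
  \<open>E\<close> the sum of the simple root vectors and \<open>f = e\<^sub>-\<^sub>\<beta>\<close>, so that \<open>L\<^sub>- = \<lambda>\<^sup>-\<^sup>1 y + n\<close>. In \<open>[L, L\<^sub>-]\<close> the coefficient
  of \<open>\<lambda>\<^sup>-\<^sup>1\<close> is \<open>[h + E, y]\<close>, as the brackets of \<open>y\<close> and \<open>n\<close> cancel; that of \<open>\<lambda>\<close> is \<open>[f, n] = 0\<close>, as it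
  has degree below \<open>-|\<beta>|\<close>; and that of \<open>1\<close> is \<open>[h + n + E, n] + [f, y]\<close>, of degree at most \<open>0\<close> as
  \<open>|\<beta>|\<close> is maximal.\<close>

lemma phase_space_Lax:
  assumes "L \<in> phase_space"
  shows "proj_plus L = L - proj_minus L" "loop_bracket L (proj_minus L) \<in> phase_direction"
proof -
  let ?E = "\<Sum>\<delta>\<in>\<Delta>. e \<delta>" and ?f = "e (\<lambda>x. - \<beta> x)"
  obtain y z where L: "L = Poly_Mapping.single (-1) y + Poly_Mapping.single 0 (z + ?E) + Poly_Mapping.single 1 ?f"
    and y: "y \<in> graded_sum {0<..}" and z: "z \<in> graded_sum {..0}"
    using assms by (auto simp: phase_space_def graded_pos_def graded_nonpos_def)
  have "{..0::int} = {0} \<union> {..<0}" by auto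
  then have "(\<Union>k\<in>{..0}. graded k) = (\<Union>k\<in>{0}. graded k) \<union> (\<Union>k\<in>{..<0}. graded k)"
    by (simp only: UN_Un)
  then obtain h n where hn: "z = h + n" and h: "h \<in> graded_sum {0}" and n: "n \<in> graded_sum {..<0}"
    using z by (auto simp only: span_Un mem_Collect_eq)
  have "e \<delta> \<in> graded 1" if "\<delta> \<in> \<Delta>" for \<delta>
  proof -
    have \<delta>: "\<delta> \<in> roots \<hh>" using base that by (auto simp: root_base_def)
    have "(of_int (root_length \<Delta> \<delta>) :: complex) = of_int 1"
      using root_length_grading(1)[OF \<delta>] grading_element(2)[OF that] by simp
    then have "root_length \<Delta> \<delta> = 1" by (simp only: of_int_eq_iff)
    then show ?thesis using root_vector_graded[OF \<delta>] by simp
  qed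
  then have E: "?E \<in> graded_sum {1}" by (intro span_sum) (simp add: span_base)
  have f: "?f \<in> graded_sum {1 - coxeter}"
    using root_vector_graded[OF minus_root[OF longest_root(1)]] root_length_minus[OF longest_root(1)]
    by (simp add: span_base)
  have mono: "x \<in> graded_sum B" if "x \<in> graded_sum A" "A \<subseteq> B" for x A B
    using that graded_sum_subset[of A B] by blast
  have hE: "h + ?E \<in> graded_sum {0, 1}"
    by (rule span_add[OF mono[OF h] mono[OF E]]) auto
  let ?M = "Poly_Mapping.single (-1) y + Poly_Mapping.single 0 n"
  let ?P = "Poly_Mapping.single 0 (h + ?E) + Poly_Mapping.single 1 ?f"
  have "?P \<in> loop_plus"
    unfolding loop_plus_def
    by (intro loop.span_add single_in_loop_graded_sum[OF hE] single_in_loop_graded_sum[OF f]) auto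
  moreover have "?M \<in> loop_minus"
    unfolding loop_minus_def
    by (intro loop.span_add single_in_loop_graded_sum[OF y] single_in_loop_graded_sum[OF n]) auto
  moreover have PM: "L = ?P + ?M"
    unfolding L hn by (simp add: single_add algebra_simps)
  ultimately have proj: "proj_plus L = ?P" "proj_minus L = ?M"
    using proj_eqI[of ?P ?M] by simp_all
  show "proj_plus L = L - proj_minus L"
    unfolding proj using PM by simp
  have "bracket ?f n \<in> graded_sum {}"
    by (rule bracket_graded_sum[OF f n]) auto
  then have fn: "bracket ?f n = 0" by simp
  have pos: "bracket (h + ?E) y \<in> graded_pos"
    unfolding graded_pos_def by (rule bracket_graded_sum[OF hE y]) auto
  have "z + ?E \<in> graded_sum {..1}"
    by (rule span_add[OF mono[OF z] mono[OF E]]) auto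
  then have "bracket (z + ?E) n \<in> graded_nonpos"
    unfolding graded_nonpos_def by (rule bracket_graded_sum[OF _ n]) auto
  moreover have "bracket ?f y \<in> graded_nonpos"
    unfolding graded_nonpos_def by (rule bracket_graded_sum[OF f y]) auto
  ultimately have nonpos: "bracket (z + ?E) n + bracket ?f y \<in> graded_nonpos"
    unfolding graded_nonpos_def by (rule span_add)
  have eq: "bracket y n + bracket (z + ?E) y = bracket (h + ?E) y"
    using bracket_anti[of y n] by (simp add: hn bracket_add_left algebra_simps)
  have "loop_bracket L ?M =
      (Poly_Mapping.single (-1) (bracket y n) + Poly_Mapping.single (-1) (bracket (z + ?E) y)) +
      (Poly_Mapping.single 0 (bracket (z + ?E) n) + Poly_Mapping.single 0 (bracket ?f y))"
    unfolding L loop_bracket_add_left loop_bracket_add_right loop_bracket_single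
    by (simp add: bracket_self fn add_ac)
  then have "loop_bracket L ?M =
      Poly_Mapping.single (-1) (bracket (h + ?E) y) + Poly_Mapping.single 0 (bracket (z + ?E) n + bracket ?f y)"
    unfolding eq[symmetric] by (simp only: single_add)
  then show "loop_bracket L (proj_minus L) \<in> phase_direction"
    unfolding proj(2) phase_direction_def using pos nonpos by blast
qed

text \<open>By invariance \<open>\<langle>L | [X, L]\<rangle> = 0\<close> for every \<open>X\<close>, in particular for \<open>X = R (\<nabla>F)\<close>, so only the
  projections of \<open>L\<close> itself enter; and \<open>R L = L - 2 L\<^sub>-\<close>.\<close>

lemma R_poisson_energy:
  assumes L: "L \<in> phase_space"
  shows "R_poisson F energy L = loop_form (gradient F L) (loop_bracket L (proj_minus L))"
proof -
  let ?g = "gradient F L" and ?M = "proj_minus L"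
  have grad: "gradient energy L = L"
    by (rule gradient_eqI[OF energy_gradient[OF truncate_phase_space[OF L]]])
  have R: "R_operator L = L - ?M - ?M"
    by (simp add: R_operator_def phase_space_Lax(1)[OF L])
  have "loop_form L (loop_bracket (R_operator ?g) L) = - loop_form (loop_bracket L L) (R_operator ?g)"
    unfolding loop_form_invariant
    by (subst loop_bracket_anti) (rule loop_form_minus_right)
  then have 1: "loop_form L (loop_bracket (R_operator ?g) L) = 0"
    by (simp add: loop_bracket_self loop_form_0_left)
  have "loop_form L (loop_bracket ?g (R_operator L)) = loop_form ?g (loop_bracket (R_operator L) L)"
    by (subst loop_form_commute) (rule loop_form_invariant)
  also have "loop_bracket (R_operator L) L = loop_bracket L ?M + loop_bracket L ?M"
    unfolding R loop_bracket_diff_left loop_bracket_self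
    using loop_bracket_anti[of ?M L] by simp
  finally have "loop_form L (loop_bracket ?g (R_operator L)) = 2 * loop_form ?g (loop_bracket L ?M)"
    by (simp add: loop_form_add_right)
  then show ?thesis
    by (simp add: R_poisson_def R_bracket_def grad loop_form_scale_right loop_form_add_right 1)
qed

lemma restrict_translate_derivative:
  assumes L: "L \<in> phase_space" and V: "V \<in> phase_direction" and F: "has_gradient F L g"
  shows "((\<lambda>t. restrict F phase_space (L + loop_scale t V)) has_field_derivative loop_form g V) (at 0)"
proof -
  have "restrict F phase_space (L + loop_scale t V) = F (L + loop_scale t V)" for t
    using phase_space_translate[OF L V] by simp
  then show ?thesis using F by (simp add: has_gradient_def)
qed

text \<open>The Lax field has the right derivative along every lifted function. Conversely, a Hamiltonian
  vector field is determined by the derivatives of the linear forms \<open>\<langle>g | \<cdot>\<rangle>\<close>.\<close>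

theorem hamiltonian_vector_field_Lax:
  assumes P: "reduced_poisson_bracket P"
  shows "hamiltonian_vector_field P (restrict toda_hamiltonian phase_space) V \<longleftrightarrow>
    (\<forall>L\<in>phase_space. V L = loop_bracket L (proj_minus L))"
proof -
  have "restrict toda_hamiltonian phase_space = restrict energy phase_space"
    by (rule restrict_ext) (simp add: toda_hamiltonian_def energy_def truncate_phase_space)
  then have bracket: "P (restrict F phase_space) (restrict toda_hamiltonian phase_space) L =
      loop_form (gradient F L) (loop_bracket L (proj_minus L))"
    if "F \<in> generated_algebra truncated_functionals" "L \<in> phase_space" for F L
    using P that truncated_algebra_subset[OF that(1)] truncated_algebra_subset[OF energy_in_algebra]
    by (simp add: reduced_poisson_bracket_def R_poisson_energy)
  show ?thesis
  proof
    assume V: "hamiltonian_vector_field P (restrict toda_hamiltonian phase_space) V"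
    show "\<forall>L\<in>phase_space. V L = loop_bracket L (proj_minus L)"
    proof
      fix L assume L: "L \<in> phase_space"
      let ?X = "loop_bracket L (proj_minus L)"
      have VL: "V L \<in> phase_direction" using V L by (simp add: hamiltonian_vector_field_def)
      have "loop_form (V L) g = loop_form ?X g" for g
      proof -
        define F where "F x = loop_form g (truncate x)" for x
        have \<phi>: "loop_functional (loop_form g)"
          by (rule loop_functionalI) (simp_all add: loop_form_add_right loop_form_scale_right)
        then have F: "F \<in> generated_algebra truncated_functionals"
          unfolding F_def truncated_functionals_def by (blast intro: generated_algebra.gen)
        have "restrict F phase_space = restrict (loop_form g) phase_space"
          by (rule restrict_ext) (simp add: F_def truncate_phase_space)
        then have "restrict F phase_space \<in> phase_functions"
          unfolding phase_functions_def using \<phi> by (blast intro: generated_algebra.gen)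
        then have "((\<lambda>t. restrict F phase_space (L + loop_scale t (V L))) has_field_derivative
            P (restrict F phase_space) (restrict toda_hamiltonian phase_space) L) (at 0)"
          using V L unfolding hamiltonian_vector_field_def by blast
        moreover obtain f where f: "has_gradient F L f"
          using truncated_algebra_gradient[OF F] by blast
        ultimately have "loop_form f (V L) = loop_form f ?X"
          using restrict_translate_derivative[OF L VL f] bracket[OF F L] gradient_eqI[OF f]
          by (metis DERIV_unique)
        moreover have "loop_form f y = loop_form g (truncate y)" for y
        proof -
          have "((\<lambda>t. loop_form g (truncate L) + t * loop_form g (truncate y))
              has_field_derivative loop_form g (truncate y)) (at 0)"
            by (auto intro!: derivative_eq_intros)
          then have "((\<lambda>t. F (L + loop_scale t y)) has_field_derivative loop_form g (truncate y)) (at 0)"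
            by (simp add: F_def truncate_add truncate_scale loop_form_add_right loop_form_scale_right)
          then show ?thesis
            using f DERIV_unique unfolding has_gradient_def by blast
        qed
        moreover have "truncate W = W" if "W \<in> phase_direction" for W
          using that
          by (intro poly_mapping_eqI)
            (auto simp: phase_direction_def lookup_truncate lookup_add lookup_single when_def)
        ultimately have "loop_form g (V L) = loop_form g ?X"
          using VL phase_space_Lax(2)[OF L] by simp
        then show ?thesis by (simp only: loop_form_commute[of _ g])
      qed
      then show "V L = ?X" by (rule loop_form_nondegenerate)
    qed
  next
    assume V: "\<forall>L\<in>phase_space. V L = loop_bracket L (proj_minus L)"
    show "hamiltonian_vector_field P (restrict toda_hamiltonian phase_space) V"
      unfolding hamiltonian_vector_field_def
    proof (intro ballI conjI)
      fix L assume L: "L \<in> phase_space"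
      have VL: "V L = loop_bracket L (proj_minus L)" using V L by blast
      then show direction: "V L \<in> phase_direction" using phase_space_Lax(2)[OF L] by simp
      fix F assume "F \<in> phase_functions"
      then obtain F' where F': "F' \<in> generated_algebra truncated_functionals" "F = restrict F' phase_space"
        using phase_function_lift by blast
      obtain f where f: "has_gradient F' L f"
        using truncated_algebra_gradient[OF F'(1)] by blast
      show "((\<lambda>t. F (L + loop_scale t (V L))) has_field_derivative
          P F (restrict toda_hamiltonian phase_space) L) (at 0)"
        unfolding F'(2) bracket[OF F'(1) L] gradient_eqI[OF f] VL[symmetric]
        by (rule restrict_translate_derivative[OF L direction f])
    qed
  qed
qed

end

theorem proposition5:
  fixes scale :: "complex \<Rightarrow> 'g::ab_group_add \<Rightarrow> 'g"
    and Basis :: "'g set"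
    and bracket :: "'g \<Rightarrow> 'g \<Rightarrow> 'g"
    and \<hh> :: "'g set"
    and \<Delta> :: "('g \<Rightarrow> complex) set"
    and \<beta> :: "'g \<Rightarrow> complex"
    and e :: "('g \<Rightarrow> complex) \<Rightarrow> 'g"
    and P :: "('g loop \<Rightarrow> complex) \<Rightarrow> ('g loop \<Rightarrow> complex) \<Rightarrow> 'g loop \<Rightarrow> complex"
    and V :: "'g loop \<Rightarrow> 'g loop"
  assumes "kostant_toda scale Basis bracket \<hh> \<Delta> \<beta> e"
    and "kostant_toda.reduced_poisson_bracket scale Basis bracket \<hh> \<Delta> \<beta> e P"
  shows "kostant_toda.hamiltonian_vector_field scale bracket \<hh> \<Delta> \<beta> e P
      (restrict (kostant_toda.toda_hamiltonian scale Basis bracket)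
        (kostant_toda.phase_space scale bracket \<hh> \<Delta> \<beta> e)) V \<longleftrightarrow>
    (\<forall>L \<in> kostant_toda.phase_space scale bracket \<hh> \<Delta> \<beta> e.
       V L = lie_algebra.loop_bracket bracket L
         (kostant_toda.proj_minus scale bracket \<hh> \<Delta> \<beta> e L))"
proof -
  interpret kostant_toda scale Basis bracket \<hh> \<Delta> \<beta> e by (rule assms(1))
  show ?thesis by (rule hamiltonian_vector_field_Lax[OF assms(2)])
qed

end
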